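(* Consider the controlled system with forced renewals described in the context. Suppose Assumption 1 holds, and that Assumption 2 holds for a given $\epsilon>0$. Fix constants $V\ge 0$, $C\ge 0$, $\delta\ge 0$, and suppose that on every renewal frame $r\in\{0,1,2,\ldots\}$ the controller uses a $(C,\delta)$-approximation (as defined in the context). If $\epsilon>\phi\delta$, then all virtual queues $X_l$ ($l\in\{1,\ldots,L\}$) and all queues $Q_n$ ($n\in\mathcal N$) are strongly stable, and all the constraints $$\overline y_l\le 0\ \ \forall l\in\{1,\ldots,L\},\qquad \overline Q_n<\infty\ \ \forall n\in\mathcal N,\qquad \alpha(t)\in\mathcal A_{\Omega(t),z(t)}\ \ \forall t\in\{0,1,2,\ldots\}$$ are satisfied. In particular, for all positive integers $R$, $$\frac1R\sum_{r=0}^{R-1}\left[\sum_{n\in\mathcal N}\mathbb E\{Q_n(t_r)\}+\sum_{l=1}^L\mathbb E\{X_l(t_r)\}\right]\le\frac{B/\phi+C\phi+V(\phi\delta+2\beta)}{\epsilon-\phi\delta}.$$ Further, the time average penalty satisfies $$\limsup_{t\to\infty}\frac1t\sum_{\tau=0}^{t-1}\mathbb E\{y_0(\tau)\}\le y_0^{opt}+\frac{B/\phi+C\phi}{V}+\phi\delta\left[1+\frac{\beta-y_0^{opt}}{\epsilon}\right],$$ where for $V=0$ this last bound is understood to be vacuous (right-hand side $+\infty$). Here $B=\frac{(2-\phi)\beta^2(N+L)}{2}$.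
   Context: System. Time is slotted, $t\in\{0,1,2,\ldots\}$. $\mathcal Z$ is a finite state space with a distinguished state $0$ (the renewal state). On each slot there is a random event $\Omega(t)=[\omega(t),\phi(t)]$, i.i.d. over slots, where $\phi(t)\in\{0,1\}$ is Bernoulli with $\Pr[\phi(t)=1]=\phi>0$ and is independent of $\omega(t)$. On each slot the controller observes $\Omega(t)$ and the state $z(t)\in\mathcal Z$ and chooses a control action $\alpha(t)\in\mathcal A_{\Omega(t),z(t)}$. Given $z(t)=i$, $\alpha(t)=\alpha$, $\Omega(t)=\Omega$, the next state is $j$ with probability $P_{ij}(\alpha,\Omega)$; if $\phi(t)=1$ (a forced renewal event) then $z(t+1)=0$ with probability 1. Policies are causal (no knowledge of the future) and may be randomized and history dependent. There are $N$ stability-constrained queues, indexed by a set $\mathcal N$ with $|\mathcal N|=N$, with $d_n(t)=\hat d_n(\alpha(t),\Omega(t),z(t))$ and $$Q_n(t+1)=\max[Q_n(t)+d_n(t),0],\quad n\in\mathcal N,$$ and penalties $y_l(t)=\hat y_l(\alpha(t),\Omega(t),z(t))$, $l\in\{0,1,\ldots,L\}$, where $\hat d_n,\hat y_l$ are deterministic functions. There is a finite constant $\beta$ with $|y_l(t)|\le\beta$ and $|d_n(t)|\le\beta$ for all $l,n,t$. Virtual queues are defined by $$X_l(t+1)=\max[X_l(t)+y_l(t),0],\quad l\in\{1,\ldots,L\}.$$ All queues $Q_n,X_l$ are initially $0$, and $z(0)=0$. Write $\boldsymbol\Theta(t)=[(X_l(t))_{l=1}^L,(Q_n(t))_{n\in\mathcal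 N}]$. (Wireless instance: $K$ delay-constrained queues with buffers of size $b$ have state $z(t)=(Q_k(t))_{k\in\mathcal K}\in\mathcal Z=\{0,\ldots,b\}^K$; $\omega(t)=[\boldsymbol A(t),\boldsymbol S(t)]$ is the vector of arrivals and channel states; $\alpha(t)$ determines transmissions $\boldsymbol\mu(t)\in\Gamma_{\boldsymbol S(t)}$ and drops $D_k(t)$; $d_n=A_n-\mu_n$ for $n\in\mathcal N$; and $Q_k(t+1)=Q_k(t)-\mu_k(t)-D_k(t)+A_k(t)$ for $k\in\mathcal K$, with $\mu_k(t)\in\{0,\ldots,Q_k(t)\}$, with $D_k(t)\in\{\max[A_k(t)+Q_k(t)-b,0],\ldots,A_k(t)\}$ if $\phi(t)=0$ and $D_k(t)=Q_k(t)-\mu_k(t)+A_k(t)$ if $\phi(t)=1$.) Renewal frames. $t_0=0$, and a new frame starts on the slot just after each slot with $\phi(t)=1$; $t_r$ is the start of the $r$th frame and $T_r=t_{r+1}-t_r$ its duration. The $T_r$ are i.i.d. geometric with $\mathbb E\{T_r\}=1/\phi$, and $z(t_r)=0$. Averages. $\overline Q_n=\limsup_{t\to\infty}\frac1t\sum_{\tau=0}^{t-1}\mathbb E\{Q_n(\tau)\}$; $\overline y_l$ and $\overline d_n$ are defined likewise from $y_l(\tau)$ and $d_n(\tau)$. A queue $Q$ is strongly stable if $\limsup_{t\to\infty}\frac1t\sum_{\tau=0}^{t-1}\mathbb E\{Q(\tau)\}<\infty$. $y_0^{opt}$ is the infimum of $\overline y_0$ over all policies satisfying $\overline y_l\le0$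 for all $l\in\{1,\ldots,L\}$, $\overline d_n\le 0$ for all $n\in\mathcal N$, and $\alpha(t)\in\mathcal A_{\Omega(t),z(t)}$ for all $t$. An $(\Omega,z)$-only policy chooses $\alpha(t)\in\mathcal A_{\Omega(t),z(t)}$ as a stationary, possibly randomized, function of $(\Omega(t),z(t))$ only. Assumption 1: there is an $(\Omega,z)$-only policy whose values $y_l^*(\tau),d_n^*(\tau)$ satisfy, over any renewal frame, $\phi\,\mathbb E\{\sum_{\tau=t_r}^{t_r+T_r-1}y_0^*(\tau)\}=y_0^{opt}$, $\ \phi\,\mathbb E\{\sum_{\tau=t_r}^{t_r+T_r-1}d_n^*(\tau)\}\le0$ for all $n\in\mathcal N$, and $\phi\,\mathbb E\{\sum_{\tau=t_r}^{t_r+T_r-1}y_l^*(\tau)\}\le0$ for all $l\in\{1,\ldots,L\}$. Assumption 2 (for $\epsilon>0$): there is an $(\Omega,z)$-only policy (possibly different from that of Assumption 1) whose values satisfy, over any renewal frame, $\phi\,\mathbb E\{\sum_{\tau=t_r}^{t_r+T_r-1}d_n^*(\tau)\}\le-\epsilon$ for all $n\in\mathcal N$, and $\phi\,\mathbb E\{\sum_{\tau=t_r}^{t_r+T_r-1}y_l^*(\tau)\}\le-\epsilon$ for all $l\in\{1,\ldots,L\}$. $(C,\delta)$-approximation. Let $$D(\boldsymbol\Theta(t_r))=\sum_{n\in\mathcal N}Q_n(t_r)\sum_{\tau=t_r}^{t_r+T_r-1}d_n(\tau)+\sum_{l=1}^LX_l(t_r)\sum_{\tau=t_r}^{t_r+T_r-1}y_l(\tau).$$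 A policy for choosing $\alpha(\tau)$ over the frame $\tau\in\{t_r,\ldots,t_r+T_r-1\}$ is a $(C,\delta)$-approximation if $$\mathbb E\Big\{D(\boldsymbol\Theta(t_r))+V\sum_{\tau=t_r}^{t_r+T_r-1}y_0(\tau)\,\Big|\,\boldsymbol\Theta(t_r)\Big\}\le\mathbb E\Big\{D^*(\boldsymbol\Theta(t_r))+V\sum_{\tau=t_r}^{t_r+T_r-1}y_0^*(\tau)\,\Big|\,\boldsymbol\Theta(t_r)\Big\}+C+\delta\sum_{n\in\mathcal N}Q_n(t_r)+\delta\sum_{l=1}^LX_l(t_r)+V\delta,$$ where $D^*$ and $y_0^*$ are the corresponding quantities under any alternative policy $\alpha^*$ that can be implemented over the frame. *)

theory Defs
  imports "HOL-Probability.Probability"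
begin

text \<open>
  A random event is a pair \<open>(\<omega>, \<phi>)\<close>; the forced-renewal indicator \<open>\<phi>\<close> is a Boolean.
  The finite state space is the type \<open>'z\<close>.
\<close>

type_synonym 'w event = "'w \<times> bool"

record ('w, 'z, 'a, 'n) system =
  omega_law :: "'w measure"
  renewal_prob :: real
  renewal_state :: 'z
  action_space :: "'a measure"
  actions :: "'w event \<Rightarrow> 'z \<Rightarrow> 'a set"
  transition :: "'z \<Rightarrow> 'a \<Rightarrow> 'w event \<Rightarrow> 'z pmf"
  queues :: "'n set"
  queue_diff :: "'n \<Rightarrow> 'a \<Rightarrow> 'w event \<Rightarrow> 'z \<Rightarrow> real"
  num_penalties :: nat
  penalty :: "nat \<Rightarrow> 'a \<Rightarrow> 'w event \<Rightarrow> 'z \<Rightarrow> real"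

definition event_law :: "('w, 'z, 'a, 'n) system \<Rightarrow> 'w event measure" where
  "event_law S = omega_law S \<Otimes>\<^sub>M measure_pmf (bernoulli_pmf (renewal_prob S))"

text \<open>
  The bounds are only required for admissible actions. The measurability conditions make
  the expectations in the model meaningful for general event and action spaces; they hold
  automatically when these spaces are discrete and countable.
\<close>

locale forced_renewal_system =
  fixes S :: "('w, 'z::finite, 'a, 'n) system" and \<beta> :: real
  assumes prob_space_omega: "prob_space (omega_law S)"
    and renewal_prob_pos: "0 < renewal_prob S"
    and renewal_prob_le_1: "renewal_prob S \<le> 1"
    and forced_renewal:
      "\<And>i a \<Omega>. snd \<Omega> \<Longrightarrow> transition S i a \<Omega> = return_pmf (renewal_state S)"
    and finite_queues: "finite (queues S)"
    and queue_diff_bounded: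
      "\<And>n \<Omega> z a. n \<in> queues S \<Longrightarrow> \<Omega> \<in> space (event_law S) \<Longrightarrow> a \<in> actions S \<Omega> z \<Longrightarrow>
         \<bar>queue_diff S n a \<Omega> z\<bar> \<le> \<beta>"
    and penalty_bounded:
      "\<And>l \<Omega> z a. l \<le> num_penalties S \<Longrightarrow> \<Omega> \<in> space (event_law S) \<Longrightarrow> a \<in> actions S \<Omega> z \<Longrightarrow>
         \<bar>penalty S l a \<Omega> z\<bar> \<le> \<beta>"
    and actions_subset:
      "\<And>\<Omega> z. \<Omega> \<in> space (event_law S) \<Longrightarrow> actions S \<Omega> z \<subseteq> space (action_space S)"
    and actions_measurable:
      "\<And>z. {(a, \<Omega>). \<Omega> \<in> space (event_law S) \<and> a \<in> actions S \<Omega> z}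
         \<in> sets (action_space S \<Otimes>\<^sub>M event_law S)"
    and transition_measurable:
      "\<And>i j. (\<lambda>(a, \<Omega>). pmf (transition S i a \<Omega>) j)
         \<in> borel_measurable (action_space S \<Otimes>\<^sub>M event_law S)"
    and queue_diff_measurable:
      "\<And>n z. n \<in> queues S \<Longrightarrow> (\<lambda>(a, \<Omega>). queue_diff S n a \<Omega> z)
         \<in> borel_measurable (action_space S \<Otimes>\<^sub>M event_law S)"
    and penalty_measurable:
      "\<And>l z. l \<le> num_penalties S \<Longrightarrow> (\<lambda>(a, \<Omega>). penalty S l a \<Omega> z)
         \<in> borel_measurable (action_space S \<Otimes>\<^sub>M event_law S)"

text \<open>A slot \<open>(\<Omega>(t), z(t), \<alpha>(t))\<close>; a path is a sequence of slots.\<close>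

type_synonym ('w, 'z, 'a) slot = "'w event \<times> 'z \<times> 'a"
type_synonym ('w, 'z, 'a) path = "nat \<Rightarrow> ('w, 'z, 'a) slot"

definition slot_space :: "('w, 'z, 'a, 'n) system \<Rightarrow> ('w, 'z, 'a) slot measure" where
  "slot_space S = event_law S \<Otimes>\<^sub>M (count_space UNIV \<Otimes>\<^sub>M action_space S)"

abbreviation event_at :: "('w, 'z, 'a) path \<Rightarrow> nat \<Rightarrow> 'w event" where
  "event_at w t \<equiv> fst (w t)"
abbreviation state_at :: "('w, 'z, 'a) path \<Rightarrow> nat \<Rightarrow> 'z" where
  "state_at w t \<equiv> fst (snd (w t))"
abbreviation action_at :: "('w, 'z, 'a) path \<Rightarrow> nat \<Rightarrow> 'a" where
  "action_at w t \<equiv> snd (snd (w t))"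
abbreviation renewal_at :: "('w, 'z, 'a) path \<Rightarrow> nat \<Rightarrow> bool" where
  "renewal_at w t \<equiv> snd (event_at w t)"

text \<open>
  \<open>\<pi> t h \<Omega> z\<close> is the conditional distribution of \<open>\<alpha>(t)\<close> given the slots \<open>h\<close> before \<open>t\<close>,
  \<open>\<Omega>(t) = \<Omega>\<close> and \<open>z(t) = z\<close>. Causality is built in, as \<open>h\<close> ranges over functions that are
  \<open>undefined\<close> from \<open>t\<close> on.
\<close>

type_synonym ('w, 'z, 'a) policy =
  "nat \<Rightarrow> ('w, 'z, 'a) path \<Rightarrow> 'w event \<Rightarrow> 'z \<Rightarrow> 'a measure"

definition policies :: "('w, 'z, 'a, 'n) system \<Rightarrow> ('w, 'z, 'a) policy set" where
  "policies S = {\<pi>. \<forall>t.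
     (\<lambda>(h, \<Omega>, z). \<pi> t h \<Omega> z) \<in>
        (\<Pi>\<^sub>M i\<in>{0..<t}. slot_space S) \<Otimes>\<^sub>M (event_law S \<Otimes>\<^sub>M count_space UNIV)
          \<rightarrow>\<^sub>M prob_algebra (action_space S) \<and>
     (\<forall>h\<in>space (\<Pi>\<^sub>M i\<in>{0..<t}. slot_space S). \<forall>\<Omega>\<in>space (event_law S). \<forall>z.
        AE a in \<pi> t h \<Omega> z. a \<in> actions S \<Omega> z)}"

definition omega_z_only_policies :: "('w, 'z, 'a, 'n) system \<Rightarrow> ('w, 'z, 'a) policy set" where
  "omega_z_only_policies S = {\<pi> \<in> policies S. \<exists>k. \<forall>t h \<Omega> z. \<pi> t h \<Omega> z = k \<Omega> z}"

fun state_law :: "('w, 'z, 'a, 'n) system \<Rightarrow> nat \<Rightarrow> ('w, 'z, 'a) path \<Rightarrow> 'z pmf" where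
  "state_law S 0 h = return_pmf (renewal_state S)"
| "state_law S (Suc t) h = transition S (state_at h t) (action_at h t) (event_at h t)"

definition slot_law ::
  "('w, 'z, 'a, 'n) system \<Rightarrow> ('w, 'z, 'a) policy \<Rightarrow> nat \<Rightarrow> ('w, 'z, 'a) path \<Rightarrow>
     ('w, 'z, 'a) slot measure" where
  "slot_law S \<pi> t h =
     measure_pmf (state_law S t h) \<bind> (\<lambda>z.
     event_law S \<bind> (\<lambda>\<Omega>.
     \<pi> t h \<Omega> z \<bind> (\<lambda>a.
     return (slot_space S) (\<Omega>, z, a))))"

text \<open>
  The law on paths under \<open>\<pi>\<close> is the one that the Ionescu-Tulcea theorem assigns to the kernels
  \<open>slot_law S \<pi> t\<close>.
\<close>

definition law :: "('w, 'z, 'a, 'n) system \<Rightarrow> ('w, 'z, 'a) policy \<Rightarrow> ('w, 'z, 'a) path measure" where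
  "law S \<pi> = projective_family.lim UNIV
     (Ionescu_Tulcea.CI (slot_law S \<pi>) (\<lambda>_. slot_space S)) (\<lambda>_. slot_space S)"

context forced_renewal_system
begin

lemma prob_space_event: "prob_space (event_law S)"
proof -
  interpret a: prob_space "omega_law S" by (rule prob_space_omega)
  interpret b: prob_space "measure_pmf (bernoulli_pmf (renewal_prob S))" by (rule measure_pmf.prob_space_axioms)
  interpret pair_prob_space "omega_law S" "measure_pmf (bernoulli_pmf (renewal_prob S))" ..
  show ?thesis unfolding event_law_def by (rule prob_space_axioms)
qed

lemma state_law_measurable:
  "(\<lambda>h. measure_pmf (state_law S t h)) \<in> (\<Pi>\<^sub>M i\<in>{0..<t}. slot_space S) \<rightarrow>\<^sub>M prob_algebra (count_space UNIV)"
proof (rule measurable_prob_algebraI)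
  show "prob_space (measure_pmf (state_law S t h))" for h by (rule measure_pmf.prob_space_axioms)
next
  have pm: "(\<lambda>h. pmf (state_law S t h) j) \<in> borel_measurable (\<Pi>\<^sub>M i\<in>{0..<t}. slot_space S)" for j
  proof (cases t)
    case 0 then show ?thesis by simp
  next
    case (Suc u)
    have c: "(\<lambda>h. h u) \<in> (\<Pi>\<^sub>M i\<in>{0..<t}. slot_space S) \<rightarrow>\<^sub>M slot_space S"
      using Suc by (intro measurable_component_singleton) auto
    have "(\<lambda>x. pmf (transition S (fst (snd x)) (snd (snd x)) (fst x)) j)
        \<in> borel_measurable (slot_space S)"
    proof (rule measurable_compose_countable[where f = "\<lambda>i x. pmf (transition S i (snd (snd x)) (fst x)) j"])
      show "(\<lambda>x. fst (snd x)) \<in> slot_space S \<rightarrow>\<^sub>M count_space UNIV"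
        unfolding slot_space_def by measurable
      have *: "(\<lambda>x. (snd (snd x), fst x)) \<in> slot_space S \<rightarrow>\<^sub>M action_space S \<Otimes>\<^sub>M event_law S"
        unfolding slot_space_def by measurable
      show "(\<lambda>x. pmf (transition S i (snd (snd x)) (fst x)) j) \<in> borel_measurable (slot_space S)" for i
        using measurable_compose[OF * transition_measurable[of i j]] by simp
    qed
    from measurable_compose[OF c this] show ?thesis using Suc by (simp add: case_prod_unfold)
  qed
  show "(\<lambda>h. measure_pmf (state_law S t h)) \<in> (\<Pi>\<^sub>M i\<in>{0..<t}. slot_space S) \<rightarrow>\<^sub>M subprob_algebra (count_space UNIV)"
  proof (rule measurable_subprob_algebra)
    fix h show "subprob_space (measure_pmf (state_law S t h))" by (rule measure_pmf.subprob_space_axioms)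
    show "sets (measure_pmf (state_law S t h)) = sets (count_space UNIV)" by simp
  next
    fix A :: "'z set"
    have "emeasure (measure_pmf (state_law S t h)) A = (\<Sum>j\<in>A. ennreal (pmf (state_law S t h) j))" for h
      by (subst emeasure_measure_pmf_finite) auto
    then show "(\<lambda>h. emeasure (measure_pmf (state_law S t h)) A) \<in> borel_measurable (\<Pi>\<^sub>M i\<in>{0..<t}. slot_space S)"
      using pm by simp
  qed
qed

lemma slot_law_measurable:
  assumes "\<pi> \<in> policies S"
  shows "slot_law S \<pi> t \<in> (\<Pi>\<^sub>M i\<in>{0..<t}. slot_space S) \<rightarrow>\<^sub>M prob_algebra (slot_space S)"
proof -
  let ?H = "\<Pi>\<^sub>M i\<in>{0..<t}. slot_space S" and ?Z = "count_space (UNIV :: 'z set)"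
  have \<pi>: "(\<lambda>(h, \<Omega>, z). \<pi> t h \<Omega> z) \<in> ?H \<Otimes>\<^sub>M (event_law S \<Otimes>\<^sub>M ?Z) \<rightarrow>\<^sub>M prob_algebra (action_space S)"
    using assms by (simp add: policies_def)
  have perm: "(\<lambda>p. (fst (fst p), snd p, snd (fst p)))
      \<in> (?H \<Otimes>\<^sub>M ?Z) \<Otimes>\<^sub>M event_law S \<rightarrow>\<^sub>M ?H \<Otimes>\<^sub>M (event_law S \<Otimes>\<^sub>M ?Z)"
    by measurable
  have k: "(\<lambda>p. \<pi> t (fst (fst p)) (snd p) (snd (fst p)))
      \<in> (?H \<Otimes>\<^sub>M ?Z) \<Otimes>\<^sub>M event_law S \<rightarrow>\<^sub>M prob_algebra (action_space S)"
    using measurable_compose[OF perm \<pi>] by simp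
  have ev: "event_law S \<in> space (prob_algebra (event_law S))"
    using prob_space_event by (simp add: space_prob_algebra)
  have tup: "(\<lambda>p. (snd (fst p), snd (fst (fst p)), snd p))
      \<in> ((?H \<Otimes>\<^sub>M ?Z) \<Otimes>\<^sub>M event_law S) \<Otimes>\<^sub>M action_space S \<rightarrow>\<^sub>M slot_space S"
    unfolding slot_space_def by measurable
  have ret: "(\<lambda>p. return (slot_space S) (snd (fst p), snd (fst (fst p)), snd p))
      \<in> ((?H \<Otimes>\<^sub>M ?Z) \<Otimes>\<^sub>M event_law S) \<Otimes>\<^sub>M action_space S \<rightarrow>\<^sub>M prob_algebra (slot_space S)"
    by (rule measurable_compose[OF tup measurable_return_prob_space])
  have act: "(\<lambda>p. \<pi> t (fst (fst p)) (snd p) (snd (fst p)) \<bind>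
        (\<lambda>a. return (slot_space S) (snd p, snd (fst p), a)))
      \<in> (?H \<Otimes>\<^sub>M ?Z) \<Otimes>\<^sub>M event_law S \<rightarrow>\<^sub>M prob_algebra (slot_space S)"
    using ret by (intro measurable_bind_prob_space2[OF k]) (simp add: case_prod_unfold)
  have evt: "(\<lambda>q. event_law S \<bind> (\<lambda>\<Omega>. \<pi> t (fst q) \<Omega> (snd q) \<bind>
        (\<lambda>a. return (slot_space S) (\<Omega>, snd q, a))))
      \<in> ?H \<Otimes>\<^sub>M ?Z \<rightarrow>\<^sub>M prob_algebra (slot_space S)"
    using act by (intro measurable_bind_prob_space2[OF measurable_const[OF ev]])
      (simp add: case_prod_unfold)
  show ?thesis
    unfolding slot_law_def using evt
    by (intro measurable_bind_prob_space2[OF state_law_measurable]) (simp add: case_prod_unfold)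
qed

lemma Ionescu_Tulcea_slot_law:
  assumes "\<pi> \<in> policies S"
  shows "Ionescu_Tulcea (slot_law S \<pi>) (\<lambda>_. slot_space S)"
proof (rule Ionescu_Tulcea.intro)
  fix t :: nat
  show "slot_law S \<pi> t \<in> (\<Pi>\<^sub>M i\<in>{0..<t}. slot_space S) \<rightarrow>\<^sub>M subprob_algebra (slot_space S)"
    by (rule measurable_prob_algebraD[OF slot_law_measurable[OF assms]])
next
  fix t :: nat and h
  assume h: "h \<in> space (\<Pi>\<^sub>M i\<in>{0..<t}. slot_space S)"
  show "prob_space (slot_law S \<pi> t h)"
    using measurable_space[OF slot_law_measurable[OF assms] h] unfolding space_prob_algebra by blast
qed

end

definition diff_at :: "('w, 'z, 'a, 'n) system \<Rightarrow> 'n \<Rightarrow> nat \<Rightarrow> ('w, 'z, 'a) path \<Rightarrow> real" where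
  "diff_at S n t w = queue_diff S n (action_at w t) (event_at w t) (state_at w t)"

definition penalty_at :: "('w, 'z, 'a, 'n) system \<Rightarrow> nat \<Rightarrow> nat \<Rightarrow> ('w, 'z, 'a) path \<Rightarrow> real" where
  "penalty_at S l t w = penalty S l (action_at w t) (event_at w t) (state_at w t)"

fun queue :: "('w, 'z, 'a, 'n) system \<Rightarrow> 'n \<Rightarrow> nat \<Rightarrow> ('w, 'z, 'a) path \<Rightarrow> real" where
  "queue S n 0 w = 0"
| "queue S n (Suc t) w = max (queue S n t w + diff_at S n t w) 0"

fun virtual_queue :: "('w, 'z, 'a, 'n) system \<Rightarrow> nat \<Rightarrow> nat \<Rightarrow> ('w, 'z, 'a) path \<Rightarrow> real" where
  "virtual_queue S l 0 w = 0"
| "virtual_queue S l (Suc t) w = max (virtual_queue S l t w + penalty_at S l t w) 0"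

text \<open>
  On the null set of paths with finitely many forced renewals, late values of
  \<open>frame_start\<close> are arbitrary.
\<close>

fun frame_start :: "nat \<Rightarrow> ('w, 'z, 'a) path \<Rightarrow> nat" where
  "frame_start 0 w = 0"
| "frame_start (Suc r) w = Suc (LEAST t. frame_start r w \<le> t \<and> renewal_at w t)"

definition frame_sum ::
  "(nat \<Rightarrow> ('w, 'z, 'a) path \<Rightarrow> real) \<Rightarrow> nat \<Rightarrow> ('w, 'z, 'a) path \<Rightarrow> real" where
  "frame_sum f r w = (\<Sum>t\<in>{frame_start r w..<frame_start (Suc r) w}. f t w)"

definition time_avg ::
  "('w, 'z, 'a, 'n) system \<Rightarrow> ('w, 'z, 'a) policy \<Rightarrow> (nat \<Rightarrow> ('w, 'z, 'a) path \<Rightarrow> real) \<Rightarrow> ereal" where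
  "time_avg S \<pi> f = limsup (\<lambda>t. ereal (1 / real t * (\<Sum>\<tau><t. \<integral>w. f \<tau> w \<partial>law S \<pi>)))"

definition strongly_stable ::
  "('w, 'z, 'a, 'n) system \<Rightarrow> ('w, 'z, 'a) policy \<Rightarrow> (nat \<Rightarrow> ('w, 'z, 'a) path \<Rightarrow> real) \<Rightarrow> bool" where
  "strongly_stable S \<pi> Q \<longleftrightarrow> time_avg S \<pi> Q < \<infinity>"

definition y0_opt :: "('w, 'z, 'a, 'n) system \<Rightarrow> ereal" where
  "y0_opt S = Inf {time_avg S \<pi> (penalty_at S 0) | \<pi>. \<pi> \<in> policies S \<and>
     (\<forall>l\<in>{1..num_penalties S}. time_avg S \<pi> (penalty_at S l) \<le> 0) \<and>
     (\<forall>n\<in>queues S. time_avg S \<pi> (diff_at S n) \<le> 0)}"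

definition assumption1 :: "('w, 'z, 'a, 'n) system \<Rightarrow> bool" where
  "assumption1 S \<longleftrightarrow> (\<exists>\<pi>\<in>omega_z_only_policies S. \<forall>r.
     ereal (renewal_prob S * (\<integral>w. frame_sum (penalty_at S 0) r w \<partial>law S \<pi>)) = y0_opt S \<and>
     (\<forall>n\<in>queues S.
        renewal_prob S * (\<integral>w. frame_sum (diff_at S n) r w \<partial>law S \<pi>) \<le> 0) \<and>
     (\<forall>l\<in>{1..num_penalties S}.
        renewal_prob S * (\<integral>w. frame_sum (penalty_at S l) r w \<partial>law S \<pi>) \<le> 0))"

definition assumption2 :: "('w, 'z, 'a, 'n) system \<Rightarrow> real \<Rightarrow> bool" where
  "assumption2 S \<epsilon> \<longleftrightarrow> (\<exists>\<pi>\<in>omega_z_only_policies S. \<forall>r.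
     (\<forall>n\<in>queues S.
        renewal_prob S * (\<integral>w. frame_sum (diff_at S n) r w \<partial>law S \<pi>) \<le> - \<epsilon>) \<and>
     (\<forall>l\<in>{1..num_penalties S}.
        renewal_prob S * (\<integral>w. frame_sum (penalty_at S l) r w \<partial>law S \<pi>) \<le> - \<epsilon>))"

text \<open>\<open>queue_vector S t\<close> is \<open>\<Theta>(t)\<close>; \<open>queue_algebra S r\<close> is the \<open>\<sigma>\<close>-algebra generated by \<open>\<Theta>(t\<^sub>r)\<close>.\<close>

definition queue_vector ::
  "('w, 'z, 'a, 'n) system \<Rightarrow> nat \<Rightarrow> ('w, 'z, 'a) path \<Rightarrow> (nat \<Rightarrow> real) \<times> ('n \<Rightarrow> real)" where
  "queue_vector S t w =
     (\<lambda>l\<in>{1..num_penalties S}. virtual_queue S l t w, \<lambda>n\<in>queues S. queue S n t w)"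

definition queue_algebra :: "('w, 'z, 'a, 'n) system \<Rightarrow> nat \<Rightarrow> ('w, 'z, 'a) path measure" where
  "queue_algebra S r =
     vimage_algebra (space (\<Pi>\<^sub>M t\<in>(UNIV :: nat set). slot_space S))
       (\<lambda>w. queue_vector S (frame_start r w) w)
       ((\<Pi>\<^sub>M l\<in>{1..num_penalties S}. borel) \<Otimes>\<^sub>M (\<Pi>\<^sub>M n\<in>queues S. borel))"

definition frame_drift :: "('w, 'z, 'a, 'n) system \<Rightarrow> nat \<Rightarrow> ('w, 'z, 'a) path \<Rightarrow> real" where
  "frame_drift S r w =
     (\<Sum>n\<in>queues S. queue S n (frame_start r w) w * frame_sum (diff_at S n) r w) +
     (\<Sum>l=1..num_penalties S.
        virtual_queue S l (frame_start r w) w * frame_sum (penalty_at S l) r w)"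

definition frame_objective ::
  "('w, 'z, 'a, 'n) system \<Rightarrow> real \<Rightarrow> nat \<Rightarrow> ('w, 'z, 'a) path \<Rightarrow> real" where
  "frame_objective S V r w = frame_drift S r w + V * frame_sum (penalty_at S 0) r w"

text \<open>
  The policy that follows \<open>\<pi>\<close> in the frames before frame \<open>r\<close> and \<open>\<pi>'\<close> afterwards: slot \<open>t\<close> lies
  in the frame whose index is the number of forced renewals before \<open>t\<close>.
\<close>

definition switch_at_frame ::
  "nat \<Rightarrow> ('w, 'z, 'a) policy \<Rightarrow> ('w, 'z, 'a) policy \<Rightarrow> ('w, 'z, 'a) policy" where
  "switch_at_frame r \<pi> \<pi>' t h \<Omega> z =
     (if card {\<tau>. \<tau> < t \<and> renewal_at h \<tau>} < r then \<pi> t h \<Omega> z else \<pi>' t h \<Omega> z)"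

text \<open>
  Both conditional expectations are functions of \<open>\<Theta>(t\<^sub>r)\<close>, which has the same distribution under
  \<open>\<pi>\<close> and under \<open>switch_at_frame r \<pi> \<pi>'\<close>, so they can be compared almost everywhere.
\<close>

definition cd_approximation ::
  "('w, 'z, 'a, 'n) system \<Rightarrow> real \<Rightarrow> real \<Rightarrow> real \<Rightarrow> nat \<Rightarrow> ('w, 'z, 'a) policy \<Rightarrow> bool" where
  "cd_approximation S V C \<delta> r \<pi> \<longleftrightarrow> (\<forall>\<pi>'\<in>policies S. AE w in law S \<pi>.
     real_cond_exp (law S \<pi>) (queue_algebra S r) (frame_objective S V r) w
     \<le> real_cond_exp (law S (switch_at_frame r \<pi> \<pi>')) (queue_algebra S r) (frame_objective S V r) w
       + C + \<delta> * (\<Sum>n\<in>queues S. queue S n (frame_start r w) w)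
       + \<delta> * (\<Sum>l=1..num_penalties S. virtual_queue S l (frame_start r w) w) + V * \<delta>)"

end

theory Submission
  imports Defs
begin

text \<open>
  Write \<open>\<phi>\<close> for \<open>renewal_prob S\<close>, \<open>t\<^sub>r\<close> for the start of frame \<open>r\<close> and \<open>T\<^sub>r\<close> for its length. Let
  \<open>Q\<close> range over all queues, real and virtual, with increments \<open>d\<close>. The theorem is a Lyapunov drift
  argument over frames instead of slots.

  \<^bold>\<open>Drift.\<close> Bounded increments give
  \<open>Q(t\<^sub>r\<^sub>+\<^sub>1)\<^sup>2 \<le> Q(t\<^sub>r)\<^sup>2 + 2 Q(t\<^sub>r) (\<Sum>d over frame r) + \<beta>\<^sup>2 T\<^sub>r\<^sup>2\<close> almost surely
  (\<open>backlog_square_drift\<close>). Since \<open>T\<^sub>r\<close> is geometric, \<open>E T\<^sub>r\<^sup>2 = (2 - \<phi>) / \<phi>\<^sup>2\<close>, which explains the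
  constant \<open>B\<close>. So the mean drift of half the sum of squares plus \<open>V\<close> times the mean penalty is at
  most \<open>B / \<phi>\<^sup>2\<close> plus the mean of the objective that the controller approximately minimises
  (\<open>sum_penalty_le_sum_objective\<close>).

  \<^bold>\<open>Comparison.\<close> The approximation property compares the conditional objective of \<open>\<pi>\<close>, given the
  queues at \<open>t\<^sub>r\<close>, with that of the policy that switches to \<open>\<pi>'\<close> at frame \<open>r\<close>. Both policies produce
  the same law of the queues at \<open>t\<^sub>r\<close>, hence the comparison holds for plain expectations
  (\<open>cd_approximation_expectation\<close>). If \<open>\<pi>'\<close> is \<open>(\<Omega>, z)\<close>-only, then frame \<open>r\<close> regenerates: it starts
  in the renewal state, is independent of the queues at \<open>t\<^sub>r\<close> and is distributed as the first frame
  under \<open>\<pi>'\<close> (\<open>nn_integral_frame_regeneration\<close>). Therefore the objective is explicit in the mean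
  queues and in the frame averages that the two assumptions control (\<open>objective_le\<close>).

  \<^bold>\<open>Conclusions over frames.\<close> The policy with slack \<open>\<epsilon>\<close> makes the drift at most a constant minus
  \<open>(\<epsilon> / \<phi> - \<delta>)\<close> times the total mean queue, and summation bounds the average queue
  (\<open>sum_mean_backlog_le\<close>). For the penalty, the bound from the slack policy with weight
  \<open>\<theta> = \<phi> \<delta> / \<epsilon>\<close> and the bound from the optimal policy with weight \<open>1 - \<theta>\<close> are added; this choice of
  \<open>\<theta>\<close> cancels the queues (\<open>sum_penalty_le\<close>).

  \<^bold>\<open>From frames to slots.\<close> Strong stability carries over because a queue changes by at most
  \<open>\<beta> T\<^sub>r\<close> within a frame (\<open>sum_backlog_linear\<close>). A strongly stable queue with bounded
  increments has \<open>E Q(t) = o(t)\<close>, which forces the average of its increments to be nonpositive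
  (\<open>time_avg_cost_nonpos\<close>). The penalty average over slots is bounded by the one over frames since
  \<open>t\<^sub>R\<close> deviates from \<open>R / \<phi>\<close> only by the order of \<open>sqrt R\<close> (\<open>time_avg_le_frame_avg\<close>).
\<close>

section \<open>Two sums\<close>

lemma sums_geometric_odd:
  fixes x :: real
  assumes "0 \<le> x" "x < 1"
  shows "(\<lambda>j. x ^ j * (2 * real j + 1)) sums ((1 + x) / (1 - x)\<^sup>2)"
proof -
  have "(\<lambda>j. 2 * (of_nat (Suc j) * x ^ j) - x ^ j) sums (2 * (1 / (1 - x)\<^sup>2) - 1 / (1 - x))"
    using assms by (intro sums_diff sums_mult geometric_deriv_sums geometric_sums) auto
  moreover have "2 * (1 / (1 - x)\<^sup>2) - 1 / (1 - x) = (1 + x) / (1 - x)\<^sup>2"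
  proof -
    have "2 * (1 / y\<^sup>2) - 1 / y = (2 - y) / y\<^sup>2" if "y \<noteq> 0" for y :: real
      using that by (simp add: field_simps power2_eq_square)
    from this[of "1 - x"] show ?thesis using assms by simp
  qed
  moreover have "2 * (of_nat (Suc j) * x ^ j) - x ^ j = x ^ j * (2 * real j + 1)" for j
    by (simp add: algebra_simps)
  ultimately show ?thesis by simp
qed

lemma sum_odd_numbers: "(\<Sum>j<n. 2 * real j + 1) = (real n)\<^sup>2"
  by (induction n) (simp_all add: power2_eq_square algebra_simps)

context forced_renewal_system
begin

section \<open>The path law, one slot at a time\<close>

abbreviation histories :: "nat \<Rightarrow> ('w, 'z, 'a) path measure" where
  "histories t \<equiv> \<Pi>\<^sub>M i\<in>{0..<t}. slot_space S"

abbreviation paths :: "('w, 'z, 'a) path measure" where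
  "paths \<equiv> \<Pi>\<^sub>M i\<in>(UNIV :: nat set). slot_space S"

abbreviation past :: "nat \<Rightarrow> ('w, 'z, 'a) path \<Rightarrow> ('w, 'z, 'a) path" where
  "past t w \<equiv> restrict w {0..<t}"

lemma measurable_past [measurable]: "past t \<in> paths \<rightarrow>\<^sub>M histories t"
  by (rule measurable_restrict_subset) auto

lemma past_in_histories: "w \<in> space paths \<Longrightarrow> past t w \<in> space (histories t)"
  by (rule measurable_space[OF measurable_past])

lemma sets_law [measurable_cong]: "\<pi> \<in> policies S \<Longrightarrow> sets (law S \<pi>) = sets paths"
proof -
  assume "\<pi> \<in> policies S"
  then interpret IT: Ionescu_Tulcea "slot_law S \<pi>" "\<lambda>_. slot_space S"
    by (rule Ionescu_Tulcea_slot_law)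
  show ?thesis by (simp add: law_def)
qed

lemma space_law: "\<pi> \<in> policies S \<Longrightarrow> space (law S \<pi>) = space paths"
  by (rule sets_eq_imp_space_eq[OF sets_law])

text \<open>
  The Ionescu-Tulcea theorem describes the path law by its finite-dimensional marginals; this is the
  marginal on the slots before \<open>t\<close>.
\<close>

lemma nn_integral_law_past:
  assumes \<pi>: "\<pi> \<in> policies S" and g [measurable]: "g \<in> borel_measurable (histories t)"
  shows "(\<integral>\<^sup>+w. g (past t w) \<partial>law S \<pi>)
    = (\<integral>\<^sup>+h. g h \<partial>Ionescu_Tulcea.C (slot_law S \<pi>) (\<lambda>_. slot_space S) 0 t (\<lambda>_. undefined))"
proof -
  interpret IT: Ionescu_Tulcea "slot_law S \<pi>" "\<lambda>_. slot_space S"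
    by (rule Ionescu_Tulcea_slot_law[OF \<pi>])
  let ?C = "IT.C 0 t (\<lambda>_. undefined)"
  have u: "(\<lambda>_. undefined) \<in> space (histories 0)"
    by (simp add: space_PiM)
  have sC: "sets ?C = sets (histories t)"
    using IT.sets_C[OF u, of t] by simp
  have m: "past t \<in> law S \<pi> \<rightarrow>\<^sub>M histories t"
    by (subst measurable_cong_sets[OF sets_law[OF \<pi>] refl]) (rule measurable_past)
  have up: "IT.up_to {0..<t} = t"
    using IT.up_to[of "{0..<t}"] by (intro antisym) (auto simp: IT.up_to_iff_Ico)
  have d: "distr (law S \<pi>) (histories t) (past t) = distr ?C (histories t) (past t)"
    using IT.distr_lim[of "{0..<t}"] by (simp add: law_def IT.CI_def up)
  have mC: "past t \<in> ?C \<rightarrow>\<^sub>M histories t"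
    by (subst measurable_cong_sets[OF sC refl]) (rule measurable_restrict_subset, simp)
  have "(\<integral>\<^sup>+w. g (past t w) \<partial>law S \<pi>) = (\<integral>\<^sup>+h. g h \<partial>distr (law S \<pi>) (histories t) (past t))"
    by (rule nn_integral_distr[OF m, symmetric]) simp
  also have "\<dots> = (\<integral>\<^sup>+h. g (past t h) \<partial>?C)"
    unfolding d by (rule nn_integral_distr[OF mC]) simp
  also have "\<dots> = (\<integral>\<^sup>+h. g h \<partial>?C)"
    by (rule nn_integral_cong)
      (simp add: sets_eq_imp_space_eq[OF sC] space_PiM PiE_iff extensional_restrict)
  finally show ?thesis .
qed

lemma prob_space_law: "\<pi> \<in> policies S \<Longrightarrow> prob_space (law S \<pi>)"
proof
  assume \<pi>: "\<pi> \<in> policies S"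
  interpret IT: Ionescu_Tulcea "slot_law S \<pi>" "\<lambda>_. slot_space S"
    by (rule Ionescu_Tulcea_slot_law[OF \<pi>])
  have "(\<integral>\<^sup>+w. 1 \<partial>law S \<pi>) = (\<integral>\<^sup>+h. 1 \<partial>IT.C 0 0 (\<lambda>_. undefined))"
    by (rule nn_integral_law_past[OF \<pi>, where g = "\<lambda>_. 1"]) simp
  also have "\<dots> = 1"
    using prob_space.emeasure_space_1[OF IT.prob_space_C[of "\<lambda>_. undefined" 0 0]]
    by (simp add: space_PiM)
  finally show "emeasure (law S \<pi>) (space (law S \<pi>)) = 1"
    by simp
qed

lemma measurable_extend_history:
  "(\<lambda>(h, x). h(t := x)) \<in> histories t \<Otimes>\<^sub>M slot_space S \<rightarrow>\<^sub>M histories (Suc t)"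
  unfolding case_prod_beta
  by (rule measurable_fun_upd[where J = "{0..<t}"]) (auto simp: atLeast0_lessThan_Suc)

lemma measurable_slot_law:
  "\<pi> \<in> policies S \<Longrightarrow> slot_law S \<pi> t \<in> histories t \<rightarrow>\<^sub>M subprob_algebra (slot_space S)"
  by (rule measurable_prob_algebraD[OF slot_law_measurable])

lemma measurable_integral_slot_law:
  assumes \<pi>: "\<pi> \<in> policies S" and g: "g \<in> borel_measurable (histories (Suc t))"
  shows "(\<lambda>h. \<integral>\<^sup>+x. g (h(t := x)) \<partial>slot_law S \<pi> t h) \<in> borel_measurable (histories t)"
  by (rule nn_integral_measurable_subprob_algebra2[OF _ measurable_slot_law[OF \<pi>]])
    (use measurable_compose[OF measurable_extend_history g] in \<open>simp add: case_prod_unfold\<close>)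

lemma sets_slot_law:
  "\<pi> \<in> policies S \<Longrightarrow> h \<in> space (histories t) \<Longrightarrow> sets (slot_law S \<pi> t h) = sets (slot_space S)"
  using subprob_measurableD(2)[OF measurable_slot_law] .

text \<open>
  Conditioning on the past: given the slots before \<open>t\<close>, slot \<open>t\<close> is distributed as
  \<open>slot_law S \<pi> t\<close>. Every distributional fact below is an iteration of this one.
\<close>

lemma nn_integral_law_step:
  assumes \<pi>: "\<pi> \<in> policies S" and g [measurable]: "g \<in> borel_measurable (histories (Suc t))"
  shows "(\<integral>\<^sup>+w. g (past (Suc t) w) \<partial>law S \<pi>)
    = (\<integral>\<^sup>+w. (\<integral>\<^sup>+x. g ((past t w)(t := x)) \<partial>slot_law S \<pi> t (past t w)) \<partial>law S \<pi>)"
proof -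
  interpret IT: Ionescu_Tulcea "slot_law S \<pi>" "\<lambda>_. slot_space S"
    by (rule Ionescu_Tulcea_slot_law[OF \<pi>])
  let ?u = "\<lambda>_. undefined"
  have u: "?u \<in> space (histories 0)"
    by (simp add: space_PiM)
  have sC: "sets (IT.C 0 t ?u) = sets (histories t)"
    using IT.sets_C[OF u, of t] by simp
  have mg: "(\<lambda>h. \<integral>\<^sup>+x. g (h(t := x)) \<partial>slot_law S \<pi> t h) \<in> borel_measurable (histories t)"
    by (rule measurable_integral_slot_law[OF \<pi> g])
  have "(\<integral>\<^sup>+w. g (past (Suc t) w) \<partial>law S \<pi>) = (\<integral>\<^sup>+h. g h \<partial>IT.C 0 (Suc t) ?u)"
    by (rule nn_integral_law_past[OF \<pi> g])
  also have "\<dots> = (\<integral>\<^sup>+h. (\<integral>\<^sup>+h'. g h' \<partial>IT.eP t h) \<partial>IT.C 0 t ?u)"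
    unfolding IT.C.simps add_0
    by (rule nn_integral_bind[OF g], subst measurable_cong_sets[OF sC refl], rule IT.measurable_eP)
  also have "\<dots> = (\<integral>\<^sup>+h. (\<integral>\<^sup>+x. g (h(t := x)) \<partial>slot_law S \<pi> t h) \<partial>IT.C 0 t ?u)"
    by (rule nn_integral_cong) (simp add: sets_eq_imp_space_eq[OF sC] IT.nn_integral_eP[OF _ g])
  also have "\<dots> = (\<integral>\<^sup>+w. (\<integral>\<^sup>+x. g ((past t w)(t := x)) \<partial>slot_law S \<pi> t (past t w)) \<partial>law S \<pi>)"
    using nn_integral_law_past[OF \<pi> mg] by simp
  finally show ?thesis .
qed

text \<open>
  With the invariance under \<open>past t\<close> one function serves both as a random variable on paths and as
  a function of the history, so no passage between the two is needed when conditioning. Values are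
  \<open>ennreal\<close> because the random horizons below lead to infinite sums of integrals, which for
  nonnegative terms can be rearranged freely.
\<close>

definition history_functional :: "nat \<Rightarrow> (('w, 'z, 'a) path \<Rightarrow> ennreal) \<Rightarrow> bool" where
  "history_functional t Y \<longleftrightarrow>
     Y \<in> borel_measurable (histories t) \<and> (\<forall>w. Y (past t w) = Y w)"

lemma history_functional_past: "history_functional t Y \<Longrightarrow> Y (past t w) = Y w"
  by (simp add: history_functional_def)

lemma history_functional_measurable:
  assumes "history_functional t Y" shows "Y \<in> borel_measurable paths"
proof -
  have "(\<lambda>w. Y (past t w)) \<in> borel_measurable paths"
    using assms by (intro measurable_compose[OF measurable_past]) (simp add: history_functional_def)
  then show ?thesis using assms by (simp add: history_functional_def)
qed

lemma history_functional_mono: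
  assumes "history_functional s Y" "s \<le> t" shows "history_functional t Y"
proof -
  have "past s (past t w) = past s w" for w :: "('w, 'z, 'a) path"
    using \<open>s \<le> t\<close> by (auto simp: restrict_def fun_eq_iff)
  then have "Y (past t w) = Y w" for w
    using assms(1) by (metis history_functional_past)
  moreover have "Y \<in> borel_measurable (histories t)"
  proof -
    have "past s \<in> histories t \<rightarrow>\<^sub>M histories s"
      using \<open>s \<le> t\<close> by (intro measurable_restrict_subset) auto
    then have "(\<lambda>w. Y (past s w)) \<in> borel_measurable (histories t)"
      by (rule measurable_compose) (use assms(1) in \<open>simp add: history_functional_def\<close>)
    then show ?thesis using history_functional_past[OF assms(1)] by simp
  qed
  ultimately show ?thesis by (simp add: history_functional_def)
qed

lemma history_functional_const: "history_functional t (\<lambda>_. c)"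
  by (simp add: history_functional_def)

lemma history_functional_mult:
  "history_functional t X \<Longrightarrow> history_functional t Y \<Longrightarrow> history_functional t (\<lambda>w. X w * Y w)"
  by (auto simp: history_functional_def)

lemma history_functional_slot:
  assumes "i < t" "F \<in> borel_measurable (slot_space S)"
  shows "history_functional t (\<lambda>w. F (w i))"
proof -
  have "(\<lambda>h. h i) \<in> histories t \<rightarrow>\<^sub>M slot_space S"
    using assms(1) by (intro measurable_component_singleton) auto
  then show ?thesis using assms by (auto simp: history_functional_def intro: measurable_compose)
qed

lemma nn_integral_law_step_mult:
  assumes \<pi>: "\<pi> \<in> policies S" and Y: "history_functional t Y"
    and F [measurable]: "F \<in> borel_measurable (slot_space S)"
  shows "(\<integral>\<^sup>+w. Y w * F (w t) \<partial>law S \<pi>)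
    = (\<integral>\<^sup>+w. Y w * (\<integral>\<^sup>+x. F x \<partial>slot_law S \<pi> t (past t w)) \<partial>law S \<pi>)"
proof -
  let ?g = "\<lambda>h. Y h * F (h t)"
  have g: "history_functional (Suc t) ?g"
    by (intro history_functional_mult history_functional_mono[OF Y] history_functional_slot) auto
  have upd: "Y ((past t w)(t := x)) = Y w" for w x
    by (subst history_functional_past[OF Y, of w, symmetric],
        subst history_functional_past[OF Y, of "(past t w)(t := x)", symmetric])
      (auto intro!: arg_cong[where f = Y])
  have "(\<integral>\<^sup>+w. ?g w \<partial>law S \<pi>) = (\<integral>\<^sup>+w. ?g (past (Suc t) w) \<partial>law S \<pi>)"
    by (subst history_functional_past[OF g]) simp
  also have "\<dots> = (\<integral>\<^sup>+w. (\<integral>\<^sup>+x. ?g ((past t w)(t := x)) \<partial>slot_law S \<pi> t (past t w)) \<partial>law S \<pi>)"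
    using g by (intro nn_integral_law_step[OF \<pi>]) (simp add: history_functional_def)
  also have "\<dots> = (\<integral>\<^sup>+w. (\<integral>\<^sup>+x. Y w * F x \<partial>slot_law S \<pi> t (past t w)) \<partial>law S \<pi>)"
    by (simp add: upd del: restrict_upd)
  also have "\<dots> = (\<integral>\<^sup>+w. Y w * (\<integral>\<^sup>+x. F x \<partial>slot_law S \<pi> t (past t w)) \<partial>law S \<pi>)"
    by (intro nn_integral_cong nn_integral_cmult)
      (simp add: space_law[OF \<pi>] measurable_cong_sets[OF sets_slot_law[OF \<pi> past_in_histories] refl])
  finally show ?thesis .
qed

lemma measurable_policy_kernel:
  assumes \<pi>: "\<pi> \<in> policies S" and h: "h \<in> space (histories t)"
  shows "(\<lambda>\<Omega>. \<pi> t h \<Omega> z) \<in> event_law S \<rightarrow>\<^sub>M prob_algebra (action_space S)"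
proof -
  have k: "(\<lambda>(h, \<Omega>, z). \<pi> t h \<Omega> z) \<in> histories t \<Otimes>\<^sub>M (event_law S \<Otimes>\<^sub>M count_space UNIV)
      \<rightarrow>\<^sub>M prob_algebra (action_space S)"
    using \<pi> by (simp add: policies_def)
  have "(\<lambda>\<Omega>. (h, \<Omega>, z)) \<in> event_law S \<rightarrow>\<^sub>M histories t \<Otimes>\<^sub>M (event_law S \<Otimes>\<^sub>M count_space UNIV)"
    using h by (intro measurable_Pair measurable_const measurable_ident_sets) auto
  from measurable_compose[OF this k] show ?thesis by simp
qed

lemma policy_kernel:
  assumes "\<pi> \<in> policies S" "h \<in> space (histories t)" "\<Omega> \<in> space (event_law S)"
  shows "prob_space (\<pi> t h \<Omega> z)" "sets (\<pi> t h \<Omega> z) = sets (action_space S)"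
  using measurable_space[OF measurable_policy_kernel[OF assms(1,2)] assms(3), of z]
  by (auto simp: space_prob_algebra)

lemma policy_admissible:
  assumes "\<pi> \<in> policies S" "h \<in> space (histories t)" "\<Omega> \<in> space (event_law S)"
  shows "AE a in \<pi> t h \<Omega> z. a \<in> actions S \<Omega> z"
  using assms by (simp add: policies_def)

lemma nn_integral_slot_law:
  assumes \<pi>: "\<pi> \<in> policies S" and h: "h \<in> space (histories t)"
    and F: "F \<in> borel_measurable (slot_space S)"
  shows "(\<integral>\<^sup>+x. F x \<partial>slot_law S \<pi> t h)
    = (\<integral>\<^sup>+z. (\<integral>\<^sup>+\<Omega>. (\<integral>\<^sup>+a. F (\<Omega>, z, a) \<partial>\<pi> t h \<Omega> z) \<partial>event_law S) \<partial>measure_pmf (state_law S t h))"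
proof -
  interpret ev: prob_space "event_law S" by (rule prob_space_event)
  have tup: "(\<lambda>p. (fst p, z, snd p)) \<in> event_law S \<Otimes>\<^sub>M action_space S \<rightarrow>\<^sub>M slot_space S" for z
    unfolding slot_space_def by measurable
  have ret: "(\<lambda>(\<Omega>, a). return (slot_space S) (\<Omega>, z, a))
      \<in> event_law S \<Otimes>\<^sub>M action_space S \<rightarrow>\<^sub>M prob_algebra (slot_space S)" for z
    using measurable_compose[OF tup measurable_return_prob_space] by (simp add: case_prod_unfold)
  have ret': "(\<lambda>a. return (slot_space S) (\<Omega>, z, a))
      \<in> action_space S \<rightarrow>\<^sub>M subprob_algebra (slot_space S)" if "\<Omega> \<in> space (event_law S)" for \<Omega> z
    using measurable_compose[OF measurable_Pair1'[OF that] ret] by (simp add: measurable_prob_algebraD)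
  have act: "(\<lambda>\<Omega>. \<pi> t h \<Omega> z \<bind> (\<lambda>a. return (slot_space S) (\<Omega>, z, a)))
      \<in> event_law S \<rightarrow>\<^sub>M prob_algebra (slot_space S)" for z
    by (rule measurable_bind_prob_space2[OF measurable_policy_kernel[OF \<pi> h] ret])
  have evt: "event_law S \<bind> (\<lambda>\<Omega>. \<pi> t h \<Omega> z \<bind> (\<lambda>a. return (slot_space S) (\<Omega>, z, a)))
      \<in> space (prob_algebra (slot_space S))" for z
  proof -
    have "(\<lambda>_::unit. event_law S \<bind> (\<lambda>\<Omega>. \<pi> t h \<Omega> z \<bind> (\<lambda>a. return (slot_space S) (\<Omega>, z, a))))
        \<in> count_space UNIV \<rightarrow>\<^sub>M prob_algebra (slot_space S)"
      using act prob_space_event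
      by (intro measurable_bind_prob_space[where N = "event_law S"] measurable_const)
        (auto simp: space_prob_algebra)
    from measurable_space[OF this] show ?thesis by auto
  qed
  have 1: "(\<lambda>z. event_law S \<bind> (\<lambda>\<Omega>. \<pi> t h \<Omega> z \<bind> (\<lambda>a. return (slot_space S) (\<Omega>, z, a))))
      \<in> measure_pmf (state_law S t h) \<rightarrow>\<^sub>M subprob_algebra (slot_space S)"
    using evt by (auto simp: space_prob_algebra space_subprob_algebra prob_space_imp_subprob_space)
  have fix_event: "(\<integral>\<^sup>+y. F y \<partial>(\<pi> t h \<Omega> z \<bind> (\<lambda>a. return (slot_space S) (\<Omega>, z, a))))
      = (\<integral>\<^sup>+a. F (\<Omega>, z, a) \<partial>\<pi> t h \<Omega> z)" if \<Omega>: "\<Omega> \<in> space (event_law S)" for \<Omega> z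
  proof -
    note s = policy_kernel(2)[OF \<pi> h \<Omega>, of z]
    have "(\<integral>\<^sup>+y. F y \<partial>(\<pi> t h \<Omega> z \<bind> (\<lambda>a. return (slot_space S) (\<Omega>, z, a))))
        = (\<integral>\<^sup>+a. (\<integral>\<^sup>+y. F y \<partial>return (slot_space S) (\<Omega>, z, a)) \<partial>\<pi> t h \<Omega> z)"
      by (rule nn_integral_bind[OF F], subst measurable_cong_sets[OF s refl], rule ret'[OF \<Omega>])
    also have "\<dots> = (\<integral>\<^sup>+a. F (\<Omega>, z, a) \<partial>\<pi> t h \<Omega> z)"
      using \<Omega> by (intro nn_integral_cong nn_integral_return F)
        (simp add: sets_eq_imp_space_eq[OF s] slot_space_def space_pair_measure)
    finally show ?thesis .
  qed
  have "(\<integral>\<^sup>+x. F x \<partial>slot_law S \<pi> t h)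
      = (\<integral>\<^sup>+z. (\<integral>\<^sup>+x. F x \<partial>(event_law S \<bind> (\<lambda>\<Omega>. \<pi> t h \<Omega> z \<bind>
          (\<lambda>a. return (slot_space S) (\<Omega>, z, a))))) \<partial>measure_pmf (state_law S t h))"
    unfolding slot_law_def by (rule nn_integral_bind[OF F 1])
  also have "\<dots> = (\<integral>\<^sup>+z. (\<integral>\<^sup>+\<Omega>. (\<integral>\<^sup>+x. F x \<partial>(\<pi> t h \<Omega> z \<bind>
          (\<lambda>a. return (slot_space S) (\<Omega>, z, a)))) \<partial>event_law S) \<partial>measure_pmf (state_law S t h))"
    by (intro nn_integral_cong nn_integral_bind[OF F] measurable_prob_algebraD[OF act])
  also have "\<dots> = (\<integral>\<^sup>+z. (\<integral>\<^sup>+\<Omega>. (\<integral>\<^sup>+a. F (\<Omega>, z, a) \<partial>\<pi> t h \<Omega> z) \<partial>event_law S)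
      \<partial>measure_pmf (state_law S t h))"
    by (intro nn_integral_cong fix_event)
  finally show ?thesis .
qed

text \<open>
  Whatever the policy and the past, the random event has law \<open>event_law S\<close>: this is the independence
  of the events over slots.
\<close>

lemma nn_integral_slot_law_event:
  assumes \<pi>: "\<pi> \<in> policies S" and h: "h \<in> space (histories t)"
    and F: "F \<in> borel_measurable (event_law S)"
  shows "(\<integral>\<^sup>+x. F (fst x) \<partial>slot_law S \<pi> t h) = (\<integral>\<^sup>+\<Omega>. F \<Omega> \<partial>event_law S)"
proof -
  have "(\<lambda>x. F (fst x)) \<in> borel_measurable (slot_space S)"
    unfolding slot_space_def by (rule measurable_compose[OF measurable_fst F])
  then have "(\<integral>\<^sup>+x. F (fst x) \<partial>slot_law S \<pi> t h)
    = (\<integral>\<^sup>+z. (\<integral>\<^sup>+\<Omega>. (\<integral>\<^sup>+a. F \<Omega> \<partial>\<pi> t h \<Omega> z) \<partial>event_law S) \<partial>measure_pmf (state_law S t h))"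
    by (simp add: nn_integral_slot_law[OF \<pi> h])
  also have "\<dots> = (\<integral>\<^sup>+z. (\<integral>\<^sup>+\<Omega>. F \<Omega> \<partial>event_law S) \<partial>measure_pmf (state_law S t h))"
    by (intro nn_integral_cong)
      (simp add: prob_space.emeasure_space_1[OF policy_kernel(1)[OF \<pi> h]])
  also have "\<dots> = (\<integral>\<^sup>+\<Omega>. F \<Omega> \<partial>event_law S)"
    by simp
  finally show ?thesis .
qed

section \<open>Admissible slots\<close>

definition admissible :: "('w, 'z, 'a) slot \<Rightarrow> bool" where
  "admissible x \<longleftrightarrow> fst x \<in> space (event_law S) \<and> snd (snd x) \<in> actions S (fst x) (fst (snd x))"

text \<open>
  The model data are measurable in the action and the event for each fixed state; as there are only
  finitely many states, they are measurable on slots.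
\<close>

lemma measurable_by_state:
  assumes "\<And>z. (\<lambda>(a, \<Omega>). f z a \<Omega>) \<in> action_space S \<Otimes>\<^sub>M event_law S \<rightarrow>\<^sub>M N"
  shows "(\<lambda>x. f (fst (snd x)) (snd (snd x)) (fst x)) \<in> slot_space S \<rightarrow>\<^sub>M N"
proof (rule measurable_compose_countable[where f = "\<lambda>z x. f z (snd (snd x)) (fst x)"])
  show "(\<lambda>x. fst (snd x)) \<in> slot_space S \<rightarrow>\<^sub>M count_space UNIV"
    unfolding slot_space_def by measurable
  have "(\<lambda>x. (snd (snd x), fst x)) \<in> slot_space S \<rightarrow>\<^sub>M action_space S \<Otimes>\<^sub>M event_law S"
    unfolding slot_space_def by measurable
  from measurable_compose[OF this assms]
  show "(\<lambda>x. f z (snd (snd x)) (fst x)) \<in> slot_space S \<rightarrow>\<^sub>M N" for z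
    by simp
qed

lemma measurable_admissible [measurable]: "Measurable.pred (slot_space S) admissible"
proof -
  have "Measurable.pred (action_space S \<Otimes>\<^sub>M event_law S)
      (\<lambda>(a, \<Omega>). \<Omega> \<in> space (event_law S) \<and> a \<in> actions S \<Omega> z)" for z
  proof -
    have "{p \<in> space (action_space S \<Otimes>\<^sub>M event_law S).
        case p of (a, \<Omega>) \<Rightarrow> \<Omega> \<in> space (event_law S) \<and> a \<in> actions S \<Omega> z}
        = {(a, \<Omega>). \<Omega> \<in> space (event_law S) \<and> a \<in> actions S \<Omega> z}"
      using sets.sets_into_space[OF actions_measurable[of z]] by auto
    then show ?thesis
      using actions_measurable[of z] by (simp add: pred_def)
  qed
  then show ?thesis
    unfolding admissible_def
    by (intro measurable_by_state[where f = "\<lambda>z a \<Omega>. \<Omega> \<in> space (event_law S) \<and> a \<in> actions S \<Omega> z"]) 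
qed

lemma AE_admissible:
  assumes \<pi>: "\<pi> \<in> policies S"
  shows "AE w in law S \<pi>. \<forall>t. admissible (w t)"
  unfolding AE_all_countable
proof
  fix t
  let ?F = "indicator {x. \<not> admissible x} :: _ \<Rightarrow> ennreal"
  have F: "?F \<in> borel_measurable (slot_space S)"
    by measurable
  have "(\<integral>\<^sup>+a. ?F (\<Omega>, z, a) \<partial>\<pi> t h \<Omega> z) = 0"
    if "h \<in> space (histories t)" "\<Omega> \<in> space (event_law S)" for h \<Omega> z
    using policy_admissible[OF \<pi> that] that(2)
    by (intro nn_integral_zero') (auto elim!: eventually_mono simp: admissible_def indicator_def)
  then have 0: "(\<integral>\<^sup>+x. ?F x \<partial>slot_law S \<pi> t h) = 0" if "h \<in> space (histories t)" for h
    using that unfolding nn_integral_slot_law[OF \<pi> that F] by (simp cong: nn_integral_cong)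
  have "(\<integral>\<^sup>+w. ?F (w t) \<partial>law S \<pi>) = (\<integral>\<^sup>+w. (\<integral>\<^sup>+x. ?F x \<partial>slot_law S \<pi> t (past t w)) \<partial>law S \<pi>)"
    using nn_integral_law_step_mult[OF \<pi> history_functional_const[of t 1] F] by simp
  also have "\<dots> = (\<integral>\<^sup>+w. 0 \<partial>law S \<pi>)"
    by (intro nn_integral_cong 0 past_in_histories) (simp add: space_law[OF \<pi>])
  also have "\<dots> = 0"
    by simp
  finally have "AE w in law S \<pi>. ?F (w t) = 0"
    by (subst (asm) nn_integral_0_iff_AE)
      (simp_all add: measurable_cong_sets[OF sets_law[OF \<pi>] refl]
         measurable_compose[OF _ F, of "\<lambda>w. w t"])
  then show "AE w in law S \<pi>. admissible (w t)"
    by (rule AE_mp) (auto simp: indicator_def)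
qed

section \<open>Forced renewals\<close>

lemma measurable_renewal [measurable]: "Measurable.pred (slot_space S) (\<lambda>x. snd (fst x))"
proof -
  have "snd \<in> event_law S \<rightarrow>\<^sub>M count_space UNIV"
    unfolding event_law_def
    by (subst measurable_cong_sets[OF refl sets_measure_pmf_count_space[symmetric]]) (rule measurable_snd)
  then show ?thesis
    unfolding slot_space_def by (rule measurable_compose[OF measurable_fst])
qed

lemma nn_integral_no_renewal:
  "(\<integral>\<^sup>+\<Omega>. indicator {\<Omega>. \<not> snd \<Omega>} \<Omega> \<partial>event_law S) = ennreal (1 - renewal_prob S)"
proof -
  interpret a: prob_space "omega_law S" by (rule prob_space_omega)
  have "{\<Omega>. \<not> snd \<Omega>} \<inter> space (event_law S) = space (omega_law S) \<times> {False}"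
    by (auto simp: event_law_def space_pair_measure)
  moreover have "space (omega_law S) \<times> {False} \<in> sets (event_law S)"
    unfolding event_law_def by (intro pair_measureI) auto
  moreover have "(\<integral>\<^sup>+\<Omega>. indicator {\<Omega>. \<not> snd \<Omega>} \<Omega> \<partial>event_law S)
      = (\<integral>\<^sup>+\<Omega>. indicator ({\<Omega>. \<not> snd \<Omega>} \<inter> space (event_law S)) \<Omega> \<partial>event_law S)"
    by (rule nn_integral_cong) (simp add: indicator_def)
  ultimately have "(\<integral>\<^sup>+\<Omega>. indicator {\<Omega>. \<not> snd \<Omega>} \<Omega> \<partial>event_law S)
      = emeasure (event_law S) (space (omega_law S) \<times> {False})"
    by (simp only: nn_integral_indicator)
  also have "\<dots> = ennreal (1 - renewal_prob S)"
    unfolding event_law_def using renewal_prob_pos renewal_prob_le_1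
    by (subst measure_pmf.emeasure_pair_measure_Times)
      (auto simp: a.emeasure_space_1 emeasure_pmf_single)
  finally show ?thesis .
qed

text \<open>
  The event that a frame starting at \<open>s\<close> has not ended before slot \<open>s + j\<close>.
\<close>

definition no_renewal :: "nat \<Rightarrow> nat \<Rightarrow> ('w, 'z, 'a) path \<Rightarrow> bool" where
  "no_renewal s j w \<longleftrightarrow> (\<forall>i<j. \<not> renewal_at w (s + i))"

lemma no_renewal_0: "no_renewal s 0 w"
  by (simp add: no_renewal_def)

lemma no_renewal_Suc: "no_renewal s (Suc j) w \<longleftrightarrow> no_renewal s j w \<and> \<not> renewal_at w (s + j)"
  by (auto simp: no_renewal_def less_Suc_eq)

lemma indicator_no_renewal_Suc:
  "indicator {w. no_renewal s (Suc j) w} w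
    = indicator {w. no_renewal s j w} w * (indicator {x. \<not> snd (fst x)} (w (s + j)) :: ennreal)"
  by (auto simp: no_renewal_Suc indicator_def)

lemma history_functional_no_renewal:
  "history_functional (s + j) (indicator {w. no_renewal s j w})"
proof (induction j)
  case 0
  then show ?case by (simp add: no_renewal_0 history_functional_const)
next
  case (Suc j)
  have "history_functional (s + Suc j) (\<lambda>w. indicator {w. no_renewal s j w} w *
      indicator {x. \<not> snd (fst x)} (w (s + j)))"
    by (intro history_functional_mult history_functional_mono[OF Suc] history_functional_slot) auto
  then show ?case
    by (simp flip: indicator_no_renewal_Suc)
qed

text \<open>
  Each of the \<open>j\<close> slots adds a factor \<open>1 - \<phi>\<close>, since its event is independent of everything before
  it. This makes the remaining length of a frame geometric and independent of the past under every
  policy, in particular under one that reacts to the queues.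
\<close>

lemma nn_integral_no_renewal_path:
  assumes \<pi>: "\<pi> \<in> policies S" and Y: "history_functional s Y"
  shows "(\<integral>\<^sup>+w. Y w * indicator {w. no_renewal s j w} w \<partial>law S \<pi>)
    = (\<integral>\<^sup>+w. Y w \<partial>law S \<pi>) * ennreal ((1 - renewal_prob S) ^ j)"
proof (induction j)
  case 0
  then show ?case by (simp add: no_renewal_0)
next
  case (Suc j)
  let ?X = "\<lambda>w. Y w * indicator {w. no_renewal s j w} w"
  have X: "history_functional (s + j) ?X"
    by (intro history_functional_mult history_functional_mono[OF Y] history_functional_no_renewal) auto
  have E: "indicator {\<Omega>. \<not> snd \<Omega>} \<in> borel_measurable (event_law S)"
    unfolding event_law_def by measurable
  have F: "(\<lambda>x. indicator {\<Omega>. \<not> snd \<Omega>} (fst x) :: ennreal) \<in> borel_measurable (slot_space S)"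
    unfolding slot_space_def by (rule measurable_compose[OF measurable_fst E])
  have "(\<integral>\<^sup>+w. Y w * indicator {w. no_renewal s (Suc j) w} w \<partial>law S \<pi>)
      = (\<integral>\<^sup>+w. ?X w * indicator {\<Omega>. \<not> snd \<Omega>} (fst (w (s + j))) \<partial>law S \<pi>)"
    by (intro nn_integral_cong) (auto simp: no_renewal_Suc indicator_def)
  also have "\<dots> = (\<integral>\<^sup>+w. ?X w * ennreal (1 - renewal_prob S) \<partial>law S \<pi>)"
    unfolding nn_integral_law_step_mult[OF \<pi> X F]
    by (intro nn_integral_cong)
      (simp add: nn_integral_slot_law_event[OF \<pi> past_in_histories E] space_law[OF \<pi>]
        nn_integral_no_renewal)
  also have "\<dots> = (\<integral>\<^sup>+w. ?X w \<partial>law S \<pi>) * ennreal (1 - renewal_prob S)"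
    using history_functional_measurable[OF X]
    by (intro nn_integral_multc) (simp add: measurable_cong_sets[OF sets_law[OF \<pi>] refl])
  also have "\<dots> = (\<integral>\<^sup>+w. Y w \<partial>law S \<pi>) * ennreal ((1 - renewal_prob S) ^ Suc j)"
    using renewal_prob_le_1 by (simp add: Suc.IH mult.assoc flip: ennreal_mult' power_Suc2)
  finally show ?case .
qed

text \<open>
  A gap of length \<open>j\<close> has probability \<open>(1 - \<phi>)^j\<close>, so an endless one has probability zero. Outside
  this null set \<open>frame_start\<close> is not affected by the arbitrary value of \<open>LEAST\<close>.
\<close>

lemma AE_infinitely_many_renewals:
  assumes \<pi>: "\<pi> \<in> policies S"
  shows "AE w in law S \<pi>. \<forall>s. \<exists>t\<ge>s. renewal_at w t"
  unfolding AE_all_countable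
proof
  fix s
  interpret prob_space "law S \<pi>" by (rule prob_space_law[OF \<pi>])
  let ?c = "\<integral>\<^sup>+w. (INF j. indicator {w. no_renewal s j w} w) \<partial>law S \<pi>"
  have "?c \<le> ennreal ((1 - renewal_prob S) ^ j)" for j
  proof -
    have "?c \<le> (\<integral>\<^sup>+w. 1 * indicator {w. no_renewal s j w} w \<partial>law S \<pi>)"
      by (intro nn_integral_mono) (auto intro: INF_lower)
    also have "\<dots> = ennreal ((1 - renewal_prob S) ^ j)"
      using nn_integral_no_renewal_path[OF \<pi> history_functional_const[of s 1], of j]
      by (simp add: emeasure_space_1)
    finally show ?thesis .
  qed
  moreover have "(\<lambda>j. ennreal ((1 - renewal_prob S) ^ j)) \<longlonglongrightarrow> ennreal 0"
    using renewal_prob_pos renewal_prob_le_1 by (intro tendsto_ennrealI LIMSEQ_realpow_zero) auto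
  ultimately have "?c \<le> ennreal 0"
    by (intro LIMSEQ_le_const) auto
  then have "?c = 0" by simp
  moreover have "(\<lambda>w. INF j. indicator {w. no_renewal s j w} w :: ennreal) \<in> borel_measurable (law S \<pi>)"
    using history_functional_measurable[OF history_functional_no_renewal]
    by (intro borel_measurable_INF) (auto simp: measurable_cong_sets[OF sets_law[OF \<pi>] refl])
  ultimately have "AE w in law S \<pi>. (INF j. indicator {w. no_renewal s j w} w) = (0::ennreal)"
    by (subst (asm) nn_integral_0_iff_AE) auto
  then show "AE w in law S \<pi>. \<exists>t\<ge>s. renewal_at w t"
  proof (rule AE_mp, intro AE_I2 impI)
    fix w assume inf: "(INF j. indicator {w. no_renewal s j w} w) = (0::ennreal)"
    show "\<exists>t\<ge>s. renewal_at w t"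
    proof (rule ccontr)
      assume "\<not> (\<exists>t\<ge>s. renewal_at w t)"
      then have "no_renewal s j w" for j by (auto simp: no_renewal_def)
      then show False using inf by simp
    qed
  qed
qed

definition num_renewals :: "nat \<Rightarrow> ('w, 'z, 'a) path \<Rightarrow> nat" where
  "num_renewals t w = card {\<tau>. \<tau> < t \<and> renewal_at w \<tau>}"

lemma num_renewals_0: "num_renewals 0 w = 0"
  by (simp add: num_renewals_def)

lemma num_renewals_Suc:
  "num_renewals (Suc t) w = (if renewal_at w t then Suc (num_renewals t w) else num_renewals t w)"
proof -
  have "{\<tau>. \<tau> < Suc t \<and> renewal_at w \<tau>}
      = (if renewal_at w t then insert t {\<tau>. \<tau> < t \<and> renewal_at w \<tau>} else {\<tau>. \<tau> < t \<and> renewal_at w \<tau>})"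
    by (auto simp: less_Suc_eq)
  then show ?thesis by (simp add: num_renewals_def)
qed

lemma num_renewals_mono: "s \<le> t \<Longrightarrow> num_renewals s w \<le> num_renewals t w"
  unfolding num_renewals_def by (rule card_mono) auto

lemma num_renewals_cong: "(\<And>i. i < t \<Longrightarrow> w i = w' i) \<Longrightarrow> num_renewals t w = num_renewals t w'"
  unfolding num_renewals_def by (rule arg_cong[where f = card]) auto

lemma num_renewals_past [simp]: "num_renewals t (past t w) = num_renewals t w"
  by (rule num_renewals_cong) simp

lemma measurable_num_renewals:
  "s \<le> t \<Longrightarrow> num_renewals s \<in> histories t \<rightarrow>\<^sub>M count_space UNIV"
proof (induction s)
  case 0
  then show ?case by (simp add: num_renewals_0[abs_def])
next
  case (Suc s)
  have s: "(\<lambda>h. h s) \<in> histories t \<rightarrow>\<^sub>M slot_space S"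
    using Suc by (intro measurable_component_singleton) auto
  have "num_renewals s \<in> histories t \<rightarrow>\<^sub>M count_space UNIV"
    using Suc by simp
  note [measurable] = this measurable_compose[OF s measurable_renewal]
  show ?case
    unfolding num_renewals_Suc[abs_def] by measurable
qed

lemma history_functional_num_renewals:
  "history_functional t (\<lambda>w. f (num_renewals t w))"
  unfolding history_functional_def
  by (auto intro: measurable_compose[OF measurable_num_renewals])

section \<open>Switching the policy at a frame boundary\<close>

lemma switch_at_frame_early:
  "num_renewals t h < r \<Longrightarrow> switch_at_frame r \<pi> \<pi>' t h = \<pi> t h"
  by (intro ext) (simp add: switch_at_frame_def num_renewals_def)

lemma switch_at_frame_late:
  "r \<le> num_renewals t h \<Longrightarrow> switch_at_frame r \<pi> \<pi>' t h = \<pi>' t h"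
  by (intro ext) (simp add: switch_at_frame_def num_renewals_def)

lemma switch_at_frame_policy:
  assumes "\<pi> \<in> policies S" "\<pi>' \<in> policies S"
  shows "switch_at_frame r \<pi> \<pi>' \<in> policies S"
  unfolding policies_def mem_Collect_eq
proof (intro allI conjI ballI)
  fix t
  let ?M = "histories t \<Otimes>\<^sub>M (event_law S \<Otimes>\<^sub>M count_space UNIV)"
  have k: "(\<lambda>p. \<rho> t (fst p) (fst (snd p)) (snd (snd p))) \<in> ?M \<rightarrow>\<^sub>M prob_algebra (action_space S)"
    if "\<rho> \<in> policies S" for \<rho>
    using that by (simp add: policies_def case_prod_unfold)
  have "Measurable.pred ?M (\<lambda>p. num_renewals t (fst p) < r)"
    by (rule measurable_compose[OF measurable_compose[OF measurable_fst measurable_num_renewals]]) auto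
  from measurable_If_restrict_space_iff[THEN iffD2, OF _ conjI] k[OF assms(1)] k[OF assms(2)] this
  have "(\<lambda>p. if num_renewals t (fst p) < r then \<pi> t (fst p) (fst (snd p)) (snd (snd p))
      else \<pi>' t (fst p) (fst (snd p)) (snd (snd p))) \<in> ?M \<rightarrow>\<^sub>M prob_algebra (action_space S)"
    by (intro measurable_If) (auto simp: pred_def)
  then show "(\<lambda>(h, \<Omega>, z). switch_at_frame r \<pi> \<pi>' t h \<Omega> z) \<in> ?M \<rightarrow>\<^sub>M prob_algebra (action_space S)"
    by (simp add: switch_at_frame_def num_renewals_def case_prod_unfold)
next
  fix t h \<Omega> z assume h: "h \<in> space (histories t)" "\<Omega> \<in> space (event_law S)"
  have "switch_at_frame r \<pi> \<pi>' t h \<Omega> z \<in> {\<pi> t h \<Omega> z, \<pi>' t h \<Omega> z}"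
    by (simp add: switch_at_frame_def)
  then show "AE a in switch_at_frame r \<pi> \<pi>' t h \<Omega> z. a \<in> actions S \<Omega> z"
    using policy_admissible[OF assms(1) h, of z] policy_admissible[OF assms(2) h, of z]
    by (elim insertE emptyE) (simp_all only:)
qed

lemma slot_law_cong: "\<pi> t h = \<pi>' t h \<Longrightarrow> slot_law S \<pi> t h = slot_law S \<pi>' t h"
  by (simp add: slot_law_def)

text \<open>
  As long as fewer than \<open>r\<close> renewals have occurred, the switched policy uses the same kernels as
  \<open>\<pi>\<close>. So both laws agree on what is determined before frame \<open>r\<close> starts; the condition on \<open>g\<close> says
  that the last slot that \<open>g\<close> looks at was chosen while fewer than \<open>r\<close> renewals had occurred.
\<close>

lemma nn_integral_law_switch_past:
  assumes \<pi>: "\<pi> \<in> policies S" and \<pi>': "\<pi>' \<in> policies S"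
    and "g \<in> borel_measurable (histories s)"
    and "\<And>h. h \<in> space (histories s) \<Longrightarrow> g h \<noteq> 0 \<Longrightarrow> s \<noteq> 0 \<Longrightarrow> num_renewals (s - 1) h < r"
  shows "(\<integral>\<^sup>+w. g (past s w) \<partial>law S (switch_at_frame r \<pi> \<pi>')) = (\<integral>\<^sup>+w. g (past s w) \<partial>law S \<pi>)"
  using assms(3,4)
proof (induction s arbitrary: g)
  let ?\<sigma> = "switch_at_frame r \<pi> \<pi>'"
  note \<sigma> = switch_at_frame_policy[OF \<pi> \<pi>', of r]
  {
    case 0
    then show ?case
      by (simp add: prob_space.emeasure_space_1[OF prob_space_law] \<sigma> \<pi>)
  next
    case (Suc s)
    let ?g = "\<lambda>h. \<integral>\<^sup>+x. g (h(s := x)) \<partial>slot_law S \<pi> s h"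
    have upd: "h(s := x) \<in> space (histories (Suc s))"
      if "h \<in> space (histories s)" "x \<in> space (slot_space S)" for h x
      using measurable_space[OF measurable_extend_history, of "(h, x)"] that
      by (simp add: space_pair_measure)
    have zero: "(\<integral>\<^sup>+x. g (h(s := x)) \<partial>slot_law S \<rho> s h) = 0"
      if \<rho>: "\<rho> \<in> policies S" and h: "h \<in> space (histories s)" and "\<not> num_renewals s h < r" for \<rho> h
    proof -
      have "num_renewals s (h(s := x)) = num_renewals s h" for x
        by (rule num_renewals_cong) simp
      then have "g (h(s := x)) = 0" if "x \<in> space (slot_space S)" for x
        using Suc.prems(2)[OF upd[OF h that]] \<open>\<not> num_renewals s h < r\<close>
        by (metis diff_Suc_1 nat.distinct(1))
      then have "(\<integral>\<^sup>+x. g (h(s := x)) \<partial>slot_law S \<rho> s h) = (\<integral>\<^sup>+x. 0 \<partial>slot_law S \<rho> s h)"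
        by (intro nn_integral_cong) (simp add: sets_eq_imp_space_eq[OF sets_slot_law[OF \<rho> h]])
      then show ?thesis by simp
    qed
    have same: "(\<integral>\<^sup>+x. g (h(s := x)) \<partial>slot_law S ?\<sigma> s h) = ?g h"
      if h: "h \<in> space (histories s)" for h
    proof (cases "num_renewals s h < r")
      case True
      then show ?thesis
        by (simp add: slot_law_cong[of ?\<sigma> s h \<pi>, OF switch_at_frame_early])
    next
      case False
      then show ?thesis by (simp add: zero h \<sigma> \<pi>)
    qed
    have "(\<integral>\<^sup>+w. g (past (Suc s) w) \<partial>law S ?\<sigma>) = (\<integral>\<^sup>+w. ?g (past s w) \<partial>law S ?\<sigma>)"
      unfolding nn_integral_law_step[OF \<sigma> Suc.prems(1)]
      by (intro nn_integral_cong same past_in_histories) (simp add: space_law[OF \<sigma>])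
    also have "\<dots> = (\<integral>\<^sup>+w. ?g (past s w) \<partial>law S \<pi>)"
    proof (rule Suc.IH)
      show "?g \<in> borel_measurable (histories s)"
        by (rule measurable_integral_slot_law[OF \<pi> Suc.prems(1)])
      fix h assume "h \<in> space (histories s)" "?g h \<noteq> 0"
      then have "num_renewals s h < r"
        using zero[OF \<pi>] by auto
      then show "num_renewals (s - 1) h < r"
        using num_renewals_mono[of "s - 1" s h] by simp
    qed
    also have "\<dots> = (\<integral>\<^sup>+w. g (past (Suc s) w) \<partial>law S \<pi>)"
      unfolding nn_integral_law_step[OF \<pi> Suc.prems(1)] ..
    finally show ?case .
  }
qed

section \<open>Renewal frames\<close>

text \<open>
  Whether \<open>frame_start r w\<close> equals \<open>s\<close> depends, by definition, on a search through the whole path.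
  This equivalent form looks only at the slots before \<open>s\<close>, as a stopping time should, and is
  therefore the form in which frame boundaries enter conditional expectations.
\<close>

definition frame_starts_at :: "nat \<Rightarrow> nat \<Rightarrow> ('w, 'z, 'a) path \<Rightarrow> bool" where
  "frame_starts_at r s w \<longleftrightarrow> num_renewals s w = r \<and> (s = 0 \<or> renewal_at w (s - 1))"

abbreviation recurrent :: "('w, 'z, 'a) path \<Rightarrow> bool" where
  "recurrent w \<equiv> \<forall>s. \<exists>t\<ge>s. renewal_at w t"

lemma num_renewals_no_renewal: "no_renewal s j w \<Longrightarrow> num_renewals (s + j) w = num_renewals s w"
  by (induction j) (auto simp: no_renewal_Suc num_renewals_Suc)

lemma frame_end:
  assumes "recurrent w"
  obtains m where "frame_start (Suc r) w = Suc m" "frame_start r w \<le> m" "renewal_at w m"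
    "\<And>t. frame_start r w \<le> t \<Longrightarrow> t < m \<Longrightarrow> \<not> renewal_at w t"
proof
  let ?P = "\<lambda>t. frame_start r w \<le> t \<and> renewal_at w t"
  have ex: "\<exists>t. ?P t" using assms by blast
  show "frame_start (Suc r) w = Suc (LEAST t. ?P t)" by simp
  show "frame_start r w \<le> (LEAST t. ?P t)" "renewal_at w (LEAST t. ?P t)"
    using LeastI_ex[OF ex] by auto
  show "\<not> renewal_at w t" if "frame_start r w \<le> t" "t < (LEAST t. ?P t)" for t
    using not_less_Least[OF that(2)] that(1) by auto
qed

lemma frame_start_less: "recurrent w \<Longrightarrow> frame_start r w < frame_start (Suc r) w"
  by (rule frame_end[of w r]) auto

lemma frame_start_ge: "recurrent w \<Longrightarrow> r \<le> frame_start r w"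
proof (induction r)
  case (Suc r)
  from Suc.IH[OF Suc.prems] frame_start_less[OF Suc.prems, of r] show ?case by simp
qed simp

lemma no_renewal_iff_in_frame:
  assumes "recurrent w"
  shows "no_renewal (frame_start r w) j w \<longleftrightarrow> frame_start r w + j < frame_start (Suc r) w"
proof -
  obtain m where m: "frame_start (Suc r) w = Suc m" "frame_start r w \<le> m" "renewal_at w m"
    "\<And>t. frame_start r w \<le> t \<Longrightarrow> t < m \<Longrightarrow> \<not> renewal_at w t"
    by (rule frame_end[OF assms, of r]) blast
  show ?thesis
  proof
    assume nr: "no_renewal (frame_start r w) j w"
    show "frame_start r w + j < frame_start (Suc r) w"
    proof (rule ccontr)
      assume "\<not> ?thesis"
      then have "m - frame_start r w < j" "frame_start r w + (m - frame_start r w) = m"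
        using m(1,2) by auto
      with nr m(3) show False unfolding no_renewal_def by metis
    qed
  next
    assume "frame_start r w + j < frame_start (Suc r) w"
    then show "no_renewal (frame_start r w) j w"
      using m by (auto simp: no_renewal_def)
  qed
qed

lemma frame_starts_at_frame_start: "recurrent w \<Longrightarrow> frame_starts_at r (frame_start r w) w"
proof (induction r)
  case 0
  then show ?case by (simp add: frame_starts_at_def num_renewals_0)
next
  case (Suc r)
  obtain m where m: "frame_start (Suc r) w = Suc m" "frame_start r w \<le> m" "renewal_at w m"
    "\<And>t. frame_start r w \<le> t \<Longrightarrow> t < m \<Longrightarrow> \<not> renewal_at w t"
    by (rule frame_end[OF Suc.prems, of r]) blast
  have "no_renewal (frame_start r w) (m - frame_start r w) w"
    using m by (auto simp: no_renewal_def)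
  from num_renewals_no_renewal[OF this] m(2) Suc have "num_renewals m w = r"
    by (simp add: frame_starts_at_def)
  with m(1,3) show ?case by (simp add: frame_starts_at_def num_renewals_Suc)
qed

lemma frame_starts_at_unique:
  assumes "frame_starts_at r s w" "frame_starts_at r s' w" shows "s = s'"
proof -
  have False if "frame_starts_at r u w" "frame_starts_at r v w" "u < v" for u v
  proof -
    obtain v' where v: "v = Suc v'" using \<open>u < v\<close> by (cases v) auto
    with that have "num_renewals u w \<le> num_renewals v' w" "num_renewals v w = Suc (num_renewals v' w)"
      by (auto intro!: num_renewals_mono simp: frame_starts_at_def num_renewals_Suc)
    with that(1,2) show False by (simp add: frame_starts_at_def)
  qed
  from this[of s s'] this[of s' s] assms show ?thesis
    by (metis linorder_neqE_nat)
qed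

lemma frame_start_eq_iff: "recurrent w \<Longrightarrow> frame_start r w = s \<longleftrightarrow> frame_starts_at r s w"
  using frame_starts_at_frame_start frame_starts_at_unique by blast

lemma frame_starts_at_num_renewals_less:
  "frame_starts_at r s w \<Longrightarrow> s \<noteq> 0 \<Longrightarrow> num_renewals (s - 1) w < r"
  by (cases s) (auto simp: frame_starts_at_def num_renewals_Suc)

lemma frame_starts_at_past: "frame_starts_at r s (past s w) \<longleftrightarrow> frame_starts_at r s w"
  by (cases s) (auto simp: frame_starts_at_def num_renewals_0)

lemma history_functional_frame_starts_at:
  "history_functional s (indicator {w. frame_starts_at r s w})"
proof -
  have "history_functional s (\<lambda>w. (if num_renewals s w = r then 1 else 0) *
      (if s = 0 then 1 else indicator {x. snd (fst x)} (w (s - 1))))"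
    by (intro history_functional_mult history_functional_num_renewals[where f = "\<lambda>n. if n = r then 1 else 0"])
      (cases s; auto intro!: history_functional_const history_functional_slot)
  also have "(\<lambda>w. (if num_renewals s w = r then 1 else 0) *
      (if s = 0 then 1 else indicator {x. snd (fst x)} (w (s - 1))))
      = (indicator {w. frame_starts_at r s w} :: _ \<Rightarrow> ennreal)"
    by (auto simp: fun_eq_iff frame_starts_at_def indicator_def)
  finally show ?thesis .
qed

lemma state_at_frame_start:
  assumes "frame_starts_at r s w"
  shows "state_law S s w = return_pmf (renewal_state S)"
  using assms by (cases s) (auto simp: frame_starts_at_def intro!: forced_renewal)

section \<open>Expectations over a frame\<close>

lemma borel_measurable_law:
  assumes \<pi>: "\<pi> \<in> policies S"
  shows "borel_measurable (law S \<pi>) = borel_measurable paths"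
  by (rule measurable_cong_sets[OF sets_law[OF \<pi>] refl])

lemma measurable_path_slot: "(\<lambda>w. w t) \<in> paths \<rightarrow>\<^sub>M slot_space S"
  by (rule measurable_component_singleton) simp

text \<open>
  A quantity at the random time \<open>t\<^sub>r\<close> is split according to the value of \<open>t\<^sub>r\<close>, which turns it into
  history functionals of deterministic times.
\<close>

lemma nn_integral_frame_start:
  assumes \<pi>: "\<pi> \<in> policies S" and G: "\<And>s. history_functional s (G s)"
  shows "(\<integral>\<^sup>+w. G (frame_start r w) w \<partial>law S \<pi>)
    = (\<Sum>s. \<integral>\<^sup>+w. G s w * indicator {w. frame_starts_at r s w} w \<partial>law S \<pi>)"
proof -
  have "(\<integral>\<^sup>+w. G (frame_start r w) w \<partial>law S \<pi>)
      = (\<integral>\<^sup>+w. (\<Sum>s. G s w * indicator {w. frame_starts_at r s w} w) \<partial>law S \<pi>)"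
  proof (intro nn_integral_cong_AE eventually_mono[OF AE_infinitely_many_renewals[OF \<pi>]])
    fix w :: "('w, 'z, 'a) path" assume w: "recurrent w"
    have "(\<Sum>s. G s w * indicator {w. frame_starts_at r s w} w)
        = (\<Sum>s. if s = frame_start r w then G s w else 0)"
      by (intro suminf_cong) (auto simp: frame_start_eq_iff[OF w, symmetric])
    also have "\<dots> = G (frame_start r w) w"
      using sums_unique[OF sums_single[of "frame_start r w" "\<lambda>s. G s w"]] by simp
    finally show "G (frame_start r w) w = (\<Sum>s. G s w * indicator {w. frame_starts_at r s w} w)" ..
  qed
  also have "\<dots> = (\<Sum>s. \<integral>\<^sup>+w. G s w * indicator {w. frame_starts_at r s w} w \<partial>law S \<pi>)"
    using history_functional_measurable[OF history_functional_mult[OF G history_functional_frame_starts_at]]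
    by (intro nn_integral_suminf) (simp add: borel_measurable_law[OF \<pi>])
  finally show ?thesis .
qed

definition frame_length :: "nat \<Rightarrow> ('w, 'z, 'a) path \<Rightarrow> nat" where
  "frame_length r w = frame_start (Suc r) w - frame_start r w"

text \<open>
  A sum over a frame is split by the start \<open>s\<close> of the frame and the position \<open>j\<close> in it; slot
  \<open>s + j\<close> counts exactly if no renewal has ended the frame before.
\<close>

lemma nn_integral_frame_sum:
  assumes \<pi>: "\<pi> \<in> policies S" and G: "\<And>s. history_functional s (G s)"
    and F [measurable]: "\<And>j. F j \<in> borel_measurable (slot_space S)"
  shows "(\<integral>\<^sup>+w. G (frame_start r w) w *
        (\<Sum>j<frame_length r w. F j (w (frame_start r w + j))) \<partial>law S \<pi>)
    = (\<Sum>s. \<Sum>j. \<integral>\<^sup>+w. (G s w * indicator {w. frame_starts_at r s w} w) *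
        indicator {w. no_renewal s j w} w * F j (w (s + j)) \<partial>law S \<pi>)"
    (is "_ = (\<Sum>s. \<Sum>j. \<integral>\<^sup>+w. ?Y s j w \<partial>law S \<pi>)")
proof -
  have m: "?Y s j \<in> borel_measurable (law S \<pi>)" for s j
    unfolding borel_measurable_law[OF \<pi>]
    by (intro borel_measurable_times_ennreal history_functional_measurable[OF G]
        history_functional_measurable[OF history_functional_frame_starts_at]
        history_functional_measurable[OF history_functional_no_renewal]
        measurable_compose[OF measurable_path_slot F])
  have "(\<integral>\<^sup>+w. G (frame_start r w) w *
      (\<Sum>j<frame_length r w. F j (w (frame_start r w + j))) \<partial>law S \<pi>)
      = (\<integral>\<^sup>+w. (\<Sum>s. \<Sum>j. ?Y s j w) \<partial>law S \<pi>)"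
  proof (intro nn_integral_cong_AE eventually_mono[OF AE_infinitely_many_renewals[OF \<pi>]])
    fix w :: "('w, 'z, 'a) path" assume w: "recurrent w"
    let ?H = "\<lambda>s. \<Sum>j. G s w * indicator {w. no_renewal s j w} w * F j (w (s + j))"
    have "(\<Sum>s. \<Sum>j. ?Y s j w) = (\<Sum>s. if s = frame_start r w then ?H s else 0)"
      by (intro suminf_cong) (auto simp: frame_start_eq_iff[OF w, symmetric])
    also have "\<dots> = ?H (frame_start r w)"
      using sums_unique[OF sums_single[of "frame_start r w" ?H]] by simp
    also have "\<dots> = (\<Sum>j<frame_length r w. G (frame_start r w) w * F j (w (frame_start r w + j)))"
      by (subst suminf_finite[of "{..<frame_length r w}"])
        (auto simp: no_renewal_iff_in_frame[OF w] frame_length_def intro!: sum.cong)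
    finally show "G (frame_start r w) w * (\<Sum>j<frame_length r w. F j (w (frame_start r w + j)))
        = (\<Sum>s. \<Sum>j. ?Y s j w)"
      by (simp add: sum_distrib_left)
  qed
  also have "\<dots> = (\<Sum>s. \<integral>\<^sup>+w. (\<Sum>j. ?Y s j w) \<partial>law S \<pi>)"
    using m by (intro nn_integral_suminf borel_measurable_suminf) auto
  also have "\<dots> = (\<Sum>s. \<Sum>j. \<integral>\<^sup>+w. ?Y s j w \<partial>law S \<pi>)"
    using m by (intro suminf_cong nn_integral_suminf) auto
  finally show ?thesis .
qed

text \<open>
  The length of a frame is independent of what precedes the frame. With \<open>c j = 1\<close> and with
  \<open>c j = 2 j + 1\<close> this gives the first and the second moment of the length.
\<close>

lemma nn_integral_frame_length:
  assumes \<pi>: "\<pi> \<in> policies S" and G: "\<And>s. history_functional s (G s)"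
  shows "(\<integral>\<^sup>+w. G (frame_start r w) w * (\<Sum>j<frame_length r w. c j) \<partial>law S \<pi>)
    = (\<integral>\<^sup>+w. G (frame_start r w) w \<partial>law S \<pi>) * (\<Sum>j. ennreal ((1 - renewal_prob S) ^ j) * c j)"
proof -
  have Y: "history_functional s (\<lambda>w. G s w * indicator {w. frame_starts_at r s w} w)" for s
    by (intro history_functional_mult G history_functional_frame_starts_at)
  have "(\<integral>\<^sup>+w. X w * indicator {w. no_renewal s j w} w * c j \<partial>law S \<pi>)
      = (\<integral>\<^sup>+w. X w \<partial>law S \<pi>) * (ennreal ((1 - renewal_prob S) ^ j) * c j)"
    if X: "history_functional s X" for s j X
    using history_functional_measurable[OF X]
      history_functional_measurable[OF history_functional_no_renewal]
    by (subst nn_integral_multc)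
      (simp_all add: borel_measurable_law[OF \<pi>] nn_integral_no_renewal_path[OF \<pi> X] mult.assoc)
  note this[OF Y]
  then show ?thesis
    by (simp add: nn_integral_frame_sum[OF \<pi> G, where F = "\<lambda>j _. c j"]
        nn_integral_frame_start[OF \<pi> G])
qed

lemma nn_integral_switch_frame_start:
  assumes \<pi>: "\<pi> \<in> policies S" and \<pi>': "\<pi>' \<in> policies S" and G: "\<And>s. history_functional s (G s)"
  shows "(\<integral>\<^sup>+w. G (frame_start r w) w \<partial>law S (switch_at_frame r \<pi> \<pi>'))
    = (\<integral>\<^sup>+w. G (frame_start r w) w \<partial>law S \<pi>)"
  unfolding nn_integral_frame_start[OF \<pi> G] nn_integral_frame_start[OF switch_at_frame_policy[OF \<pi> \<pi>'] G]
proof (rule suminf_cong)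
  fix s
  let ?Y = "\<lambda>w. G s w * indicator {w. frame_starts_at r s w} w"
  have Y: "history_functional s ?Y"
    by (intro history_functional_mult G history_functional_frame_starts_at)
  have "(\<integral>\<^sup>+w. ?Y (past s w) \<partial>law S (switch_at_frame r \<pi> \<pi>')) = (\<integral>\<^sup>+w. ?Y (past s w) \<partial>law S \<pi>)"
  proof (rule nn_integral_law_switch_past[OF \<pi> \<pi>'])
    show "?Y \<in> borel_measurable (histories s)"
      using Y by (simp add: history_functional_def)
    show "num_renewals (s - 1) h < r" if "?Y h \<noteq> 0" "s \<noteq> 0" for h
      using that by (intro frame_starts_at_num_renewals_less) (auto split: split_indicator_asm)
  qed
  then show "(\<integral>\<^sup>+w. ?Y w \<partial>law S (switch_at_frame r \<pi> \<pi>')) = (\<integral>\<^sup>+w. ?Y w \<partial>law S \<pi>)"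
    by (simp only: history_functional_past[OF Y])
qed

text \<open>
  The conditional mean of a quantity at position \<open>j\<close> of a frame is a constant \<open>c\<close> that depends neither
  on the policy in use before the frame nor on the frame. At position \<open>0\<close> this holds because the
  state is the renewal state. Under an \<open>(\<Omega>, z)\<close>-only policy the law of a slot depends on the past
  only through the preceding slot, so the quantity at position \<open>j + 1\<close> can be replaced by its
  conditional mean, which is a quantity at position \<open>j\<close>.

  The constant is asserted only to exist. A single constant serves all policies that
  agree with \<open>\<pi>'\<close> on the frame, and comparing two of them eliminates it.
\<close>

lemma nn_integral_frame_slot:
  assumes \<pi>': "\<pi>' \<in> omega_z_only_policies S" and "F \<in> borel_measurable (slot_space S)"
  shows "\<exists>c. \<forall>\<sigma>\<in>policies S. \<forall>r s Y.
    (\<forall>t h. num_renewals t h = r \<longrightarrow> \<sigma> t h = \<pi>' t h) \<longrightarrow> history_functional s Y \<longrightarrow>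
    (\<forall>w. Y w \<noteq> 0 \<longrightarrow> frame_starts_at r s w) \<longrightarrow>
    (\<integral>\<^sup>+w. Y w * indicator {w. no_renewal s j w} w * F (w (s + j)) \<partial>law S \<sigma>)
      = (\<integral>\<^sup>+w. Y w \<partial>law S \<sigma>) * c"
proof -
  obtain k where k: "\<And>t h \<Omega> z. \<pi>' t h \<Omega> z = k \<Omega> z" and pol: "\<pi>' \<in> policies S"
    using \<pi>' by (auto simp: omega_z_only_policies_def)
  define K where "K q = measure_pmf q \<bind> (\<lambda>z. event_law S \<bind> (\<lambda>\<Omega>. k \<Omega> z \<bind>
      (\<lambda>a. return (slot_space S) (\<Omega>, z, a))))" for q
  define next_state where "next_state x = transition S (fst (snd x)) (snd (snd x)) (fst x)"
    for x :: "('w, 'z, 'a) slot"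
  have slot_law_K: "slot_law S \<sigma> t h = K (state_law S t h)" if "\<sigma> t h = \<pi>' t h" for \<sigma> t h
    using that by (simp add: slot_law_def K_def k)
  have meas: "(\<lambda>x. \<integral>\<^sup>+y. f y \<partial>K (next_state x)) \<in> borel_measurable (slot_space S)"
    if f: "f \<in> borel_measurable (slot_space S)" for f
  proof -
    have "(\<lambda>x. \<lambda>i\<in>{0..<1::nat}. x) \<in> slot_space S \<rightarrow>\<^sub>M histories 1"
      by (rule measurable_restrict) simp
    from measurable_compose[OF measurable_compose[OF this measurable_slot_law[OF pol]]
        nn_integral_measurable_subprob_algebra[OF f]]
    show ?thesis by (simp add: slot_law_K next_state_def)
  qed
  show ?thesis
    using assms(2)
  proof (induction j arbitrary: F)
    case (0 F)
    have "(\<integral>\<^sup>+w. Y w * F (w s) \<partial>law S \<sigma>)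
        = (\<integral>\<^sup>+w. Y w \<partial>law S \<sigma>) * (\<integral>\<^sup>+x. F x \<partial>K (return_pmf (renewal_state S)))"
      if \<sigma>: "\<sigma> \<in> policies S" and agree: "\<forall>t h. num_renewals t h = r \<longrightarrow> \<sigma> t h = \<pi>' t h"
        and Y: "history_functional s Y" and start: "\<forall>w. Y w \<noteq> 0 \<longrightarrow> frame_starts_at r s w"
      for \<sigma> r s Y
    proof -
      have "Y w * (\<integral>\<^sup>+x. F x \<partial>slot_law S \<sigma> s (past s w))
          = Y w * (\<integral>\<^sup>+x. F x \<partial>K (return_pmf (renewal_state S)))" for w
      proof (cases "Y w = 0")
        case False
        then have "frame_starts_at r s (past s w)"
          using start by (simp add: frame_starts_at_past)
        then show ?thesis
          using agree by (simp add: slot_law_K state_at_frame_start frame_starts_at_def)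
      qed simp
      then show ?thesis
        using history_functional_measurable[OF Y]
        by (simp add: nn_integral_law_step_mult[OF \<sigma> Y 0] nn_integral_multc borel_measurable_law[OF \<sigma>])
    qed
    then show ?case by (auto simp: no_renewal_0)
  next
    case (Suc j F)
    \<comment> \<open>The conditional mean of \<open>F\<close> at the next position, given that the frame continues.\<close>
    let ?F = "\<lambda>x. indicator {x. \<not> snd (fst x)} x * (\<integral>\<^sup>+y. F y \<partial>K (next_state x))"
    have F': "?F \<in> borel_measurable (slot_space S)"
      by (intro borel_measurable_times_ennreal meas Suc.prems) measurable
    have step: "(\<integral>\<^sup>+w. Y w * indicator {w. no_renewal s (Suc j) w} w * F (w (s + Suc j)) \<partial>law S \<sigma>)
        = (\<integral>\<^sup>+w. Y w * indicator {w. no_renewal s j w} w * ?F (w (s + j)) \<partial>law S \<sigma>)"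
      if \<sigma>: "\<sigma> \<in> policies S" and agree: "\<forall>t h. num_renewals t h = r \<longrightarrow> \<sigma> t h = \<pi>' t h"
        and Y: "history_functional s Y" and start: "\<forall>w. Y w \<noteq> 0 \<longrightarrow> frame_starts_at r s w"
      for \<sigma> r s Y
    proof -
      let ?Y = "\<lambda>w. Y w * indicator {w. no_renewal s (Suc j) w} w"
      have Y': "history_functional (s + Suc j) ?Y"
        by (intro history_functional_mult history_functional_mono[OF Y] history_functional_no_renewal) auto
      have "?Y w * (\<integral>\<^sup>+x. F x \<partial>slot_law S \<sigma> (s + Suc j) (past (s + Suc j) w))
          = Y w * indicator {w. no_renewal s j w} w * ?F (w (s + j))" for w
      proof (cases "Y w \<noteq> 0 \<and> no_renewal s (Suc j) w")
        case True
        then have "num_renewals (s + Suc j) (past (s + Suc j) w) = r"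
          using start num_renewals_no_renewal[of s "Suc j" w] by (simp add: frame_starts_at_def del: add_Suc_right)
        then have "slot_law S \<sigma> (s + Suc j) (past (s + Suc j) w) = K (next_state (w (s + j)))"
          using agree by (simp add: slot_law_K next_state_def)
        then show ?thesis
          using True by (simp add: no_renewal_Suc)
      next
        case False
        then show ?thesis by (auto simp: no_renewal_Suc indicator_def)
      qed
      then show ?thesis
        by (simp only: nn_integral_law_step_mult[OF \<sigma> Y' Suc.prems])
    qed
    from Suc.IH[OF F'] obtain c where
      c: "\<forall>\<sigma>\<in>policies S. \<forall>r s Y.
        (\<forall>t h. num_renewals t h = r \<longrightarrow> \<sigma> t h = \<pi>' t h) \<longrightarrow> history_functional s Y \<longrightarrow>
        (\<forall>w. Y w \<noteq> 0 \<longrightarrow> frame_starts_at r s w) \<longrightarrow>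
        (\<integral>\<^sup>+w. Y w * indicator {w. no_renewal s j w} w * ?F (w (s + j)) \<partial>law S \<sigma>)
          = (\<integral>\<^sup>+w. Y w \<partial>law S \<sigma>) * c"
      by (rule exE)
    show ?case
    proof (intro exI[of _ c] ballI allI impI)
      fix \<sigma> r s Y
      assume "\<sigma> \<in> policies S" "\<forall>t h. num_renewals t h = r \<longrightarrow> \<sigma> t h = \<pi>' t h"
        "history_functional s Y" "\<forall>w. Y w \<noteq> 0 \<longrightarrow> frame_starts_at r s w"
      note * = this
      note step[OF *] also note c[THEN bspec, OF *(1), THEN spec, THEN spec, THEN spec, THEN mp, THEN mp, THEN mp, OF *(2-4)]
      finally show "(\<integral>\<^sup>+w. Y w * indicator {w. no_renewal s (Suc j) w} w * F (w (s + Suc j)) \<partial>law S \<sigma>)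
          = (\<integral>\<^sup>+w. Y w \<partial>law S \<sigma>) * c" .
    qed
  qed
qed

text \<open>
  Regeneration: every frame starts in the renewal state, so a frame that is controlled by an
  \<open>(\<Omega>, z)\<close>-only policy is independent of what precedes it and distributed as the first frame
  under that policy.
\<close>

lemma nn_integral_frame_regeneration:
  assumes \<pi>: "\<pi> \<in> policies S" and \<pi>': "\<pi>' \<in> omega_z_only_policies S"
    and G: "\<And>s. history_functional s (G s)" and F: "F \<in> borel_measurable (slot_space S)"
  shows "(\<integral>\<^sup>+w. G (frame_start r w) w * (\<Sum>j<frame_length r w. F (w (frame_start r w + j)))
        \<partial>law S (switch_at_frame r \<pi> \<pi>'))
    = (\<integral>\<^sup>+w. G (frame_start r w) w \<partial>law S \<pi>) *
      (\<integral>\<^sup>+w. (\<Sum>j<frame_length 0 w. F (w (frame_start 0 w + j))) \<partial>law S \<pi>')"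
proof -
  have pol: "\<pi>' \<in> policies S"
    using \<pi>' by (simp add: omega_z_only_policies_def)
  note \<sigma> = switch_at_frame_policy[OF \<pi> pol, of r]
  from choice[OF allI[OF nn_integral_frame_slot[OF \<pi>' F]]] obtain c where
    "\<forall>j. \<forall>\<sigma>\<in>policies S. \<forall>r s Y.
      (\<forall>t h. num_renewals t h = r \<longrightarrow> \<sigma> t h = \<pi>' t h) \<longrightarrow> history_functional s Y \<longrightarrow>
      (\<forall>w. Y w \<noteq> 0 \<longrightarrow> frame_starts_at r s w) \<longrightarrow>
      (\<integral>\<^sup>+w. Y w * indicator {w. no_renewal s j w} w * F (w (s + j)) \<partial>law S \<sigma>)
        = (\<integral>\<^sup>+w. Y w \<partial>law S \<sigma>) * c j"
    by (rule exE)
  note c = this[THEN spec, THEN bspec, THEN spec, THEN spec, THEN spec, THEN mp, THEN mp, THEN mp]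
  have frame: "(\<integral>\<^sup>+w. G (frame_start r w) w * (\<Sum>j<frame_length r w. F (w (frame_start r w + j))) \<partial>law S \<sigma>)
      = (\<integral>\<^sup>+w. G (frame_start r w) w \<partial>law S \<sigma>) * (\<Sum>j. c j)"
    if \<sigma>: "\<sigma> \<in> policies S" and agree: "\<And>t h. num_renewals t h = r \<Longrightarrow> \<sigma> t h = \<pi>' t h"
      and G: "\<And>s. history_functional s (G s)" for \<sigma> r G
  proof -
    have "(\<integral>\<^sup>+w. (G s w * indicator {w. frame_starts_at r s w} w) *
        indicator {w. no_renewal s j w} w * F (w (s + j)) \<partial>law S \<sigma>)
        = (\<integral>\<^sup>+w. G s w * indicator {w. frame_starts_at r s w} w \<partial>law S \<sigma>) * c j" for s j
      by (rule c[OF \<sigma>]) (auto simp: agree intro!: history_functional_mult G history_functional_frame_starts_at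
          split: split_indicator_asm)
    then show ?thesis
      by (simp add: nn_integral_frame_sum[OF \<sigma> G F] nn_integral_frame_start[OF \<sigma> G])
  qed
  have "(\<integral>\<^sup>+w. 1 * (\<Sum>j<frame_length 0 w. F (w (frame_start 0 w + j))) \<partial>law S \<pi>')
      = (\<integral>\<^sup>+w. 1 \<partial>law S \<pi>') * (\<Sum>j. c j)"
    by (rule frame[OF pol, where G = "\<lambda>_ _. 1"]) (auto intro: history_functional_const)
  also have "\<dots> = (\<Sum>j. c j)"
    by (simp add: prob_space.emeasure_space_1[OF prob_space_law[OF pol]])
  finally show ?thesis
    using frame[OF \<sigma> _ G, of r] nn_integral_switch_frame_start[OF \<pi> pol G]
    by (simp add: switch_at_frame_late)
qed

section \<open>Costs and backlogs\<close>

text \<open>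
  Queue increments and penalties enter the analysis only as functions of the current slot that are
  bounded by \<open>\<beta>\<close> on admissible slots, and both kinds of queues only as the reflected sums of such
  functions. Everything up to the comparison of policies is done at this level.
\<close>

definition cost :: "(('w, 'z, 'a) slot \<Rightarrow> real) \<Rightarrow> bool" where
  "cost q \<longleftrightarrow> q \<in> borel_measurable (slot_space S) \<and> (\<forall>x. admissible x \<longrightarrow> \<bar>q x\<bar> \<le> \<beta>)"

primrec backlog :: "(('w, 'z, 'a) slot \<Rightarrow> real) \<Rightarrow> nat \<Rightarrow> ('w, 'z, 'a) path \<Rightarrow> real" where
  "backlog q 0 w = 0"
| "backlog q (Suc t) w = max (backlog q t w + q (w t)) 0"

abbreviation admissible_path :: "('w, 'z, 'a) path \<Rightarrow> bool" where
  "admissible_path w \<equiv> \<forall>t. admissible (w t)"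

lemma cost_bound: "cost q \<Longrightarrow> admissible x \<Longrightarrow> \<bar>q x\<bar> \<le> \<beta>"
  unfolding cost_def by blast

lemma cost_measurable: "cost q \<Longrightarrow> q \<in> borel_measurable (slot_space S)"
  by (simp add: cost_def)

lemma backlog_nonneg: "0 \<le> backlog q t w"
  by (cases t) auto

lemma backlog_increment:
  assumes "cost q" "admissible_path w"
  shows "\<bar>backlog q (s + m) w - backlog q s w\<bar> \<le> \<beta> * real m"
proof (induction m)
  case (Suc m)
  have "\<bar>q (w (s + m))\<bar> \<le> \<beta>"
    using assms by (simp add: cost_bound)
  then have "\<bar>backlog q (s + Suc m) w - backlog q (s + m) w\<bar> \<le> \<beta>"
    using backlog_nonneg[of q "s + m" w] by auto
  with Suc show ?case by (simp add: algebra_simps)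
qed simp

lemma backlog_le: "cost q \<Longrightarrow> admissible_path w \<Longrightarrow> backlog q t w \<le> \<beta> * real t"
  using backlog_increment[of q w 0 t] by simp

lemma sum_cost_le_backlog: "(\<Sum>\<tau><t. q (w \<tau>)) \<le> backlog q t w"
  by (induction t) auto

text \<open>
  Within the window the backlog differs from its initial value by at most \<open>\<beta>\<close> per slot, so
  replacing it by the initial value in the increment of slot \<open>j\<close> costs at most \<open>2 \<beta>\<^sup>2 j\<close>. With the
  squared increments these errors add up to \<open>\<beta>\<^sup>2 m\<^sup>2\<close>.
\<close>

lemma backlog_square_drift:
  assumes q: "cost q" and w: "admissible_path w"
  shows "(backlog q (s + m) w)\<^sup>2
    \<le> (backlog q s w)\<^sup>2 + 2 * backlog q s w * (\<Sum>j<m. q (w (s + j))) + \<beta>\<^sup>2 * (real m)\<^sup>2"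
proof (induction m)
  case (Suc m)
  let ?a = "backlog q s w" and ?b = "backlog q (s + m) w" and ?d = "q (w (s + m))"
  have d: "\<bar>?d\<bar> \<le> \<beta>"
    using q w by (simp add: cost_bound)
  have "?d\<^sup>2 \<le> \<beta>\<^sup>2"
    using d by (metis abs_le_square_iff abs_of_nonneg abs_ge_zero order_trans)
  moreover have "(?b - ?a) * ?d \<le> \<beta>\<^sup>2 * real m"
  proof -
    have "(?b - ?a) * ?d \<le> \<bar>?b - ?a\<bar> * \<bar>?d\<bar>"
      by (simp flip: abs_mult)
    also have "\<dots> \<le> (\<beta> * real m) * \<beta>"
      using d backlog_increment[OF q w] by (intro mult_mono) (auto intro: order_trans[OF abs_ge_zero])
    finally show ?thesis by (simp add: power2_eq_square algebra_simps)
  qed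
  moreover have "(backlog q (s + Suc m) w)\<^sup>2 \<le> (?b + ?d)\<^sup>2"
    by (simp add: max_def)
  moreover have "(?b + ?d)\<^sup>2 = ?b\<^sup>2 + 2 * ?a * ?d + 2 * ((?b - ?a) * ?d) + ?d\<^sup>2"
    by (simp add: power2_eq_square algebra_simps)
  moreover have "\<beta>\<^sup>2 * (real m)\<^sup>2 + 2 * (\<beta>\<^sup>2 * real m) + \<beta>\<^sup>2 = \<beta>\<^sup>2 * (real (Suc m))\<^sup>2"
    by (simp add: power2_eq_square algebra_simps)
  ultimately show ?case
    using Suc by (simp add: algebra_simps)
qed simp

text \<open>
  A policy chooses admissible actions, and \<open>\<beta>\<close> bounds the absolute value of their penalties.
\<close>

lemma bound_nonneg:
  assumes \<pi>: "\<pi> \<in> policies S" shows "0 \<le> \<beta>"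
proof -
  interpret prob_space "law S \<pi>" by (rule prob_space_law[OF \<pi>])
  have "AE w in law S \<pi>. 0 \<le> \<beta>"
    using AE_admissible[OF \<pi>]
  proof (rule AE_mp, intro AE_I2 impI)
    fix w :: "('w, 'z, 'a) path" assume "admissible_path w"
    then have "\<bar>penalty S 0 (action_at w 0) (event_at w 0) (state_at w 0)\<bar> \<le> \<beta>"
      by (intro penalty_bounded) (auto simp: admissible_def)
    then show "0 \<le> \<beta>" by simp
  qed
  then show ?thesis by simp
qed

section \<open>Measurability along paths\<close>

lemma backlog_past: "backlog q t (past t w) = backlog q t w"
proof -
  have "s \<le> t \<Longrightarrow> backlog q s (past t w) = backlog q s w" for s
    by (induction s) auto
  then show ?thesis by simp
qed

lemma measurable_backlog_past:
  assumes "cost q" shows "backlog q t \<in> borel_measurable (histories t)"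
proof -
  have "s \<le> t \<Longrightarrow> backlog q s \<in> borel_measurable (histories t)" for s
  proof (induction s)
    case (Suc s)
    have "(\<lambda>h. h s) \<in> histories t \<rightarrow>\<^sub>M slot_space S"
      using Suc by (intro measurable_component_singleton) auto
    from measurable_compose[OF this cost_measurable[OF assms]] Suc show ?case
      by simp
  qed (simp add: backlog.simps(1)[abs_def])
  then show ?thesis by simp
qed

lemma history_functional_backlog:
  assumes "cost q" "f \<in> borel_measurable borel"
  shows "history_functional t (\<lambda>w. ennreal (f (backlog q t w)))"
  using measurable_compose[OF measurable_backlog_past[OF assms(1)] assms(2), of t]
  by (simp add: history_functional_def backlog_past)

lemma measurable_backlog:
  assumes "cost q" shows "backlog q t \<in> borel_measurable paths"
  using measurable_compose[OF measurable_past measurable_backlog_past[OF assms], of t]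
  by (simp add: backlog_past)

lemma measurable_renewal_at: "Measurable.pred paths (\<lambda>w. renewal_at w t)"
  by (rule measurable_compose[OF measurable_path_slot measurable_renewal])

lemma measurable_frame_start: "frame_start r \<in> paths \<rightarrow>\<^sub>M count_space UNIV"
proof (induction r)
  case (Suc r)
  note [measurable] = Suc measurable_renewal_at
  show ?case
    unfolding frame_start.simps by measurable
qed simp

lemma measurable_at_frame_start:
  "(\<And>s. f s \<in> paths \<rightarrow>\<^sub>M N) \<Longrightarrow> (\<lambda>w. f (frame_start r w) w) \<in> paths \<rightarrow>\<^sub>M N"
  by (rule measurable_compose_countable[OF _ measurable_frame_start])

lemma measurable_frame_length: "frame_length r \<in> paths \<rightarrow>\<^sub>M count_space UNIV"
proof -
  note [measurable] = measurable_frame_start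
  show ?thesis unfolding frame_length_def[abs_def] by measurable
qed

definition frame_cost :: "(('w, 'z, 'a) slot \<Rightarrow> real) \<Rightarrow> nat \<Rightarrow> ('w, 'z, 'a) path \<Rightarrow> real" where
  "frame_cost q r w = (\<Sum>j<frame_length r w. q (w (frame_start r w + j)))"

lemma measurable_frame_cost:
  assumes "cost q" shows "frame_cost q r \<in> borel_measurable paths"
proof -
  have "(\<lambda>w. \<Sum>j<n. q (w (s + j))) \<in> borel_measurable paths" for n s
    by (intro borel_measurable_sum measurable_compose[OF measurable_path_slot cost_measurable[OF assms]])
  then have "(\<lambda>w. \<Sum>j<frame_length r w. q (w (s + j))) \<in> borel_measurable paths" for s
    by (rule measurable_compose_countable[OF _ measurable_frame_length])
  then show ?thesis
    unfolding frame_cost_def[abs_def] by (rule measurable_at_frame_start)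
qed

lemma frame_sum_eq_frame_cost: "frame_sum (\<lambda>t w. q (w t)) r w = frame_cost q r w"
proof -
  have "(\<Sum>t = a..<b. q (w t)) = (\<Sum>j<b - a. q (w (a + j)))" for a b
    using sum.atLeastLessThan_shift_0[of "\<lambda>t. q (w t)" a b]
    by (simp add: atLeast0LessThan add.commute comp_def)
  then show ?thesis by (simp only: frame_sum_def frame_cost_def frame_length_def)
qed

lemma abs_frame_cost_le:
  assumes "cost q" "admissible_path w"
  shows "\<bar>frame_cost q r w\<bar> \<le> \<beta> * real (frame_length r w)"
proof -
  have "\<bar>frame_cost q r w\<bar> \<le> (\<Sum>j<frame_length r w. \<bar>q (w (frame_start r w + j))\<bar>)"
    unfolding frame_cost_def by (rule sum_abs)
  also have "\<dots> \<le> (\<Sum>j<frame_length r w. \<beta>)"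
    using assms by (intro sum_mono cost_bound) auto
  finally show ?thesis by (simp add: mult.commute)
qed

lemma frame_start_Suc: "recurrent w \<Longrightarrow> frame_start (Suc r) w = frame_start r w + frame_length r w"
  using frame_start_less[of w r] by (simp add: frame_length_def del: frame_start.simps)

lemma sum_frames:
  assumes "recurrent w"
  shows "(\<Sum>r<R. \<Sum>j<frame_length r w. f (frame_start r w + j)) = (\<Sum>\<tau><frame_start R w. f \<tau>)"
proof (induction R)
  case (Suc R)
  have "(\<Sum>\<tau><a + b. f \<tau>) = (\<Sum>\<tau><a. f \<tau>) + (\<Sum>j<b. f (a + j))" for a b
    by (induction b) (simp_all add: add.assoc)
  with Suc show ?case by (simp add: frame_start_Suc[OF assms] del: frame_start.simps(2))
qed simp

section \<open>Moments of frames\<close>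

text \<open>
  Here and below, \<open>has_bochner_integral\<close> records integrability together with the value of an
  expectation.
\<close>

lemma has_expectation_mult_frame_sum:
  assumes \<pi>: "\<pi> \<in> policies S"
    and g: "\<And>s. history_functional s (\<lambda>w. ennreal (g s w))" "\<And>s w. 0 \<le> g s w"
    and int: "has_bochner_integral (law S \<pi>) (\<lambda>w. g (frame_start r w) w) m"
    and c: "\<And>j. 0 \<le> c j" "(\<lambda>j. (1 - renewal_prob S) ^ j * c j) sums k"
  shows "has_bochner_integral (law S \<pi>)
    (\<lambda>w. g (frame_start r w) w * (\<Sum>j<frame_length r w. c j)) (m * k)"
proof (rule has_bochner_integral_nn_integral)
  have p: "0 \<le> 1 - renewal_prob S" using renewal_prob_le_1 by simp
  have m: "0 \<le> m"
    using has_bochner_integral_integral_eq[OF int] g(2) by (auto intro: integral_nonneg_AE)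
  have k: "0 \<le> k"
    using c p by (intro sums_le[OF _ sums_zero c(2)]) auto
  have "(\<lambda>w. (\<Sum>j<frame_length r w. c j)) \<in> borel_measurable paths"
    by (rule measurable_compose[OF measurable_frame_length]) simp
  then show "(\<lambda>w. g (frame_start r w) w * (\<Sum>j<frame_length r w. c j)) \<in> borel_measurable (law S \<pi>)"
    using borel_measurable_has_bochner_integral[OF int]
    by (intro borel_measurable_times) (auto simp: borel_measurable_law[OF \<pi>])
  show "AE w in law S \<pi>. 0 \<le> g (frame_start r w) w * (\<Sum>j<frame_length r w. c j)"
    using g c by (intro AE_I2 mult_nonneg_nonneg sum_nonneg) auto
  show "0 \<le> m * k" using m k by simp
  have "(\<integral>\<^sup>+w. ennreal (g (frame_start r w) w * (\<Sum>j<frame_length r w. c j)) \<partial>law S \<pi>)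
      = (\<integral>\<^sup>+w. ennreal (g (frame_start r w) w) * (\<Sum>j<frame_length r w. ennreal (c j)) \<partial>law S \<pi>)"
    using g c by (simp add: ennreal_mult sum_nonneg)
  also have "\<dots> = (\<integral>\<^sup>+w. ennreal (g (frame_start r w) w) \<partial>law S \<pi>) *
      (\<Sum>j. ennreal ((1 - renewal_prob S) ^ j) * ennreal (c j))"
    by (rule nn_integral_frame_length[OF \<pi> g(1)])
  also have "(\<integral>\<^sup>+w. ennreal (g (frame_start r w) w) \<partial>law S \<pi>) = ennreal m"
    using int g(2) by (subst nn_integral_eq_integral) (auto simp: has_bochner_integral_iff)
  also have "(\<Sum>j. ennreal ((1 - renewal_prob S) ^ j) * ennreal (c j)) = ennreal k"
  proof -
    have "ennreal ((1 - renewal_prob S) ^ j) * ennreal (c j) = ennreal ((1 - renewal_prob S) ^ j * c j)" for j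
      using c p by (simp add: ennreal_mult)
    moreover have "0 \<le> (1 - renewal_prob S) ^ j * c j" for j
      using c(1) p by simp
    ultimately show ?thesis
      by (simp only: suminf_ennreal_eq[OF _ c(2)])
  qed
  finally show "(\<integral>\<^sup>+w. ennreal (g (frame_start r w) w * (\<Sum>j<frame_length r w. c j)) \<partial>law S \<pi>)
      = ennreal (m * k)"
    using m k by (simp add: ennreal_mult)
qed

lemma has_expectation_mult_frame_length:
  assumes "\<pi> \<in> policies S" "\<And>s. history_functional s (\<lambda>w. ennreal (g s w))" "\<And>s w. 0 \<le> g s w"
    "has_bochner_integral (law S \<pi>) (\<lambda>w. g (frame_start r w) w) m"
  shows "has_bochner_integral (law S \<pi>)
    (\<lambda>w. g (frame_start r w) w * real (frame_length r w)) (m / renewal_prob S)"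
  using has_expectation_mult_frame_sum[OF assms, of "\<lambda>_. 1" "1 / renewal_prob S"]
    geometric_sums[of "1 - renewal_prob S"] renewal_prob_pos renewal_prob_le_1
  by simp

lemma has_expectation_mult_frame_length_square:
  assumes "\<pi> \<in> policies S" "\<And>s. history_functional s (\<lambda>w. ennreal (g s w))" "\<And>s w. 0 \<le> g s w"
    "has_bochner_integral (law S \<pi>) (\<lambda>w. g (frame_start r w) w) m"
  shows "has_bochner_integral (law S \<pi>)
    (\<lambda>w. g (frame_start r w) w * (real (frame_length r w))\<^sup>2)
    (m * ((2 - renewal_prob S) / (renewal_prob S)\<^sup>2))"
  using has_expectation_mult_frame_sum[OF assms, of "\<lambda>j. 2 * real j + 1" "(2 - renewal_prob S) / (renewal_prob S)\<^sup>2"]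
    sums_geometric_odd[of "1 - renewal_prob S"] renewal_prob_pos renewal_prob_le_1
  by (simp add: sum_odd_numbers)

lemma has_expectation_one:
  assumes \<pi>: "\<pi> \<in> policies S" shows "has_bochner_integral (law S \<pi>) (\<lambda>w. 1) (1::real)"
proof -
  interpret prob_space "law S \<pi>" by (rule prob_space_law[OF \<pi>])
  show ?thesis by (simp add: has_bochner_integral_iff prob_space)
qed

lemma has_expectation_frame_length:
  assumes \<pi>: "\<pi> \<in> policies S"
  shows "has_bochner_integral (law S \<pi>) (\<lambda>w. real (frame_length r w)) (1 / renewal_prob S)"
  using has_expectation_mult_frame_length[OF \<pi> history_functional_const _ has_expectation_one[OF \<pi>]]
  by simp

lemma has_expectation_frame_length_square:
  assumes \<pi>: "\<pi> \<in> policies S"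
  shows "has_bochner_integral (law S \<pi>) (\<lambda>w. (real (frame_length r w))\<^sup>2)
    ((2 - renewal_prob S) / (renewal_prob S)\<^sup>2)"
  using has_expectation_mult_frame_length_square[OF \<pi> history_functional_const _ has_expectation_one[OF \<pi>]]
  by simp

lemma measurable_real_frame_start: "(\<lambda>w. f (frame_start r w)) \<in> borel_measurable paths"
  by (rule measurable_compose[OF measurable_frame_start]) simp

lemma has_expectation_frame_start:
  assumes \<pi>: "\<pi> \<in> policies S"
  shows "has_bochner_integral (law S \<pi>) (\<lambda>w. real (frame_start r w)) (real r / renewal_prob S)"
proof (induction r)
  case 0
  then show ?case by (simp add: has_bochner_integral_zero)
next
  case (Suc r)
  have int: "has_bochner_integral (law S \<pi>) (\<lambda>w. real (frame_start r w) + real (frame_length r w))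
      (real r / renewal_prob S + 1 / renewal_prob S)"
    by (intro has_bochner_integral_add Suc has_expectation_frame_length \<pi>)
  have eq: "AE w in law S \<pi>. real (frame_start r w) + real (frame_length r w) = real (frame_start (Suc r) w)"
    by (rule AE_mp[OF AE_infinitely_many_renewals[OF \<pi>]])
      (auto simp: frame_start_Suc simp del: frame_start.simps)
  have "(\<lambda>w. real (frame_start (Suc r) w)) \<in> borel_measurable (law S \<pi>)"
    unfolding borel_measurable_law[OF \<pi>] by (rule measurable_real_frame_start)
  from has_bochner_integralI_AE[OF int this eq] show ?case
    by (simp add: add_divide_distrib add.commute del: frame_start.simps)
qed

text \<open>
  The lengths of the first \<open>r\<close> frames have variance \<open>(1 - \<phi>) / \<phi>\<^sup>2\<close> each. Uncorrelatedness of
  \<open>t\<^sub>r\<close> with the next length makes the variances add up.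
\<close>

lemma has_expectation_frame_start_square:
  assumes \<pi>: "\<pi> \<in> policies S"
  shows "has_bochner_integral (law S \<pi>) (\<lambda>w. (real (frame_start r w))\<^sup>2)
    ((real r / renewal_prob S)\<^sup>2 + real r * ((1 - renewal_prob S) / (renewal_prob S)\<^sup>2))"
proof (induction r)
  case 0
  then show ?case by (simp add: has_bochner_integral_zero)
next
  case (Suc r)
  let ?p = "renewal_prob S"
  let ?m = "(real r / ?p)\<^sup>2 + real r * ((1 - ?p) / ?p\<^sup>2)"
  have int: "has_bochner_integral (law S \<pi>) (\<lambda>w. (real (frame_start r w))\<^sup>2
      + 2 * (real (frame_start r w) * real (frame_length r w)) + (real (frame_length r w))\<^sup>2)
      (?m + 2 * (real r / ?p / ?p) + (2 - ?p) / ?p\<^sup>2)"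
    by (intro has_bochner_integral_add Suc has_bochner_integral_mult_right \<pi>
        has_expectation_mult_frame_length[where g = "\<lambda>s _. real s"] history_functional_const
        has_expectation_frame_start has_expectation_frame_length_square) auto
  have eq: "AE w in law S \<pi>. (real (frame_start r w))\<^sup>2
      + 2 * (real (frame_start r w) * real (frame_length r w)) + (real (frame_length r w))\<^sup>2
      = (real (frame_start (Suc r) w))\<^sup>2"
    by (rule AE_mp[OF AE_infinitely_many_renewals[OF \<pi>]])
      (auto simp: frame_start_Suc power2_sum simp del: frame_start.simps)
  have val: "?m + 2 * (real r / ?p / ?p) + (2 - ?p) / ?p\<^sup>2
      = (real (Suc r) / ?p)\<^sup>2 + real (Suc r) * ((1 - ?p) / ?p\<^sup>2)"
  proof -
    have "a\<^sup>2 / p\<^sup>2 + a * ((1 - p) / p\<^sup>2) + 2 * (a / p / p) + (2 - p) / p\<^sup>2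
        = (a + 1)\<^sup>2 / p\<^sup>2 + (a + 1) * ((1 - p) / p\<^sup>2)" if "p \<noteq> 0" for a p :: real
      using that by (simp add: field_simps power2_eq_square)
    from this[of ?p "real r"] show ?thesis
      using renewal_prob_pos by (simp add: power_divide add.commute)
  qed
  have "(\<lambda>w. (real (frame_start (Suc r) w))\<^sup>2) \<in> borel_measurable (law S \<pi>)"
    unfolding borel_measurable_law[OF \<pi>] by (rule measurable_real_frame_start)
  from has_bochner_integralI_AE[OF int this eq] show ?case
    unfolding val .
qed

lemma has_expectation_frame_start_deviation:
  assumes \<pi>: "\<pi> \<in> policies S"
  shows "has_bochner_integral (law S \<pi>) (\<lambda>w. (real (frame_start r w) - real r / renewal_prob S)\<^sup>2)
    (real r * ((1 - renewal_prob S) / (renewal_prob S)\<^sup>2))"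
proof -
  let ?m = "real r / renewal_prob S"
  have int: "has_bochner_integral (law S \<pi>) (\<lambda>w. (real (frame_start r w))\<^sup>2
      + (- 2 * ?m) * real (frame_start r w) + ?m\<^sup>2 * 1)
      ((?m\<^sup>2 + real r * ((1 - renewal_prob S) / (renewal_prob S)\<^sup>2)) + (- 2 * ?m) * ?m + ?m\<^sup>2 * 1)"
    by (intro has_bochner_integral_add has_bochner_integral_mult_right
        has_expectation_frame_start_square has_expectation_frame_start has_expectation_one \<pi>)
  have eq: "x\<^sup>2 + (- 2 * m) * x + m\<^sup>2 * 1 = (x - m)\<^sup>2" and val: "(m\<^sup>2 + c) + (- 2 * m) * m + m\<^sup>2 * 1 = c"
    for x m c :: real
    by (simp_all add: power2_eq_square algebra_simps)
  show ?thesis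
    using int unfolding eq val .
qed

section \<open>Costs over a frame\<close>

text \<open>
  The factor \<open>g\<close> is typically a backlog at the start of the frame and hence unbounded; the product is
  integrable because \<open>g\<close> is independent of the length of the frame.
\<close>

lemma integrable_mult_frame_cost:
  assumes \<pi>: "\<pi> \<in> policies S" and q: "cost q"
    and g: "\<And>s. history_functional s (\<lambda>w. ennreal (g s w))" "\<And>s w. 0 \<le> g s w"
    and int: "integrable (law S \<pi>) (\<lambda>w. g (frame_start r w) w)"
  shows "integrable (law S \<pi>) (\<lambda>w. g (frame_start r w) w * frame_cost q r w)"
proof (rule Bochner_Integration.integrable_bound)
  show "integrable (law S \<pi>) (\<lambda>w. \<beta> * (g (frame_start r w) w * real (frame_length r w)))"
    using has_expectation_mult_frame_length[OF \<pi> g has_bochner_integral_integrable[OF int]]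
    by (intro integrable_mult_right) (auto simp: has_bochner_integral_iff)
  show "(\<lambda>w. g (frame_start r w) w * frame_cost q r w) \<in> borel_measurable (law S \<pi>)"
    using int measurable_frame_cost[OF q]
    by (intro borel_measurable_times) (auto simp: borel_measurable_law[OF \<pi>])
  show "AE w in law S \<pi>. norm (g (frame_start r w) w * frame_cost q r w)
      \<le> norm (\<beta> * (g (frame_start r w) w * real (frame_length r w)))"
  proof (rule AE_mp[OF AE_admissible[OF \<pi>]], intro AE_I2 impI)
    fix w :: "('w, 'z, 'a) path" assume "admissible_path w"
    then have "g (frame_start r w) w * \<bar>frame_cost q r w\<bar>
        \<le> g (frame_start r w) w * (\<beta> * real (frame_length r w))"
      by (intro mult_left_mono abs_frame_cost_le q g)
    then show "norm (g (frame_start r w) w * frame_cost q r w)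
      \<le> norm (\<beta> * (g (frame_start r w) w * real (frame_length r w)))"
      using g(2) bound_nonneg[OF \<pi>] by (simp add: abs_mult mult.left_commute)
  qed
qed

lemma integrable_frame_cost:
  assumes \<pi>: "\<pi> \<in> policies S" and q: "cost q"
  shows "integrable (law S \<pi>) (frame_cost q r)"
  using integrable_mult_frame_cost[OF \<pi> q, of "\<lambda>_ _. 1" r] history_functional_const
    has_expectation_one[OF \<pi>] by (simp add: has_bochner_integral_iff)

lemma abs_expectation_frame_cost_le:
  assumes \<pi>: "\<pi> \<in> policies S" and q: "cost q"
  shows "\<bar>\<integral>w. frame_cost q r w \<partial>law S \<pi>\<bar> \<le> \<beta> / renewal_prob S"
proof -
  note T = has_expectation_frame_length[OF \<pi>, of r]
  have "\<bar>\<integral>w. frame_cost q r w \<partial>law S \<pi>\<bar> \<le> (\<integral>w. \<bar>frame_cost q r w\<bar> \<partial>law S \<pi>)"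
    by (rule integral_abs_bound)
  also have "\<dots> \<le> (\<integral>w. \<beta> * real (frame_length r w) \<partial>law S \<pi>)"
    using T integrable_frame_cost[OF \<pi> q]
    by (intro integral_mono_AE eventually_mono[OF AE_admissible[OF \<pi>]])
      (auto simp: has_bochner_integral_iff intro!: abs_frame_cost_le q)
  also have "\<dots> = \<beta> / renewal_prob S"
    using T by (simp add: has_bochner_integral_iff)
  finally show ?thesis .
qed

text \<open>
  The version of the regeneration property for signed costs: a backlog at the start of the frame and the
  cost over the frame are independent, and the latter has the mean that it has in the first frame
  under \<open>\<pi>'\<close>.
\<close>

lemma has_expectation_frame_regeneration:
  assumes \<pi>: "\<pi> \<in> policies S" and \<pi>': "\<pi>' \<in> omega_z_only_policies S" and q: "cost q"
    and g: "\<And>s. history_functional s (\<lambda>w. ennreal (g s w))" "\<And>s w. 0 \<le> g s w"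
    and int: "integrable (law S \<pi>) (\<lambda>w. g (frame_start r w) w)"
  shows "has_bochner_integral (law S (switch_at_frame r \<pi> \<pi>'))
    (\<lambda>w. g (frame_start r w) w * frame_cost q r w)
    ((\<integral>w. g (frame_start r w) w \<partial>law S \<pi>) * (\<integral>w. frame_cost q 0 w \<partial>law S \<pi>'))"
proof -
  let ?\<sigma> = "switch_at_frame r \<pi> \<pi>'" and ?g = "\<lambda>w. g (frame_start r w) w"
  let ?D = "\<lambda>r w. frame_cost q r w + \<beta> * real (frame_length r w)"
  have pol: "\<pi>' \<in> policies S"
    using \<pi>' by (simp add: omega_z_only_policies_def)
  note \<sigma> = switch_at_frame_policy[OF \<pi> pol, of r]
  define m where "m = (\<integral>w. ?g w \<partial>law S \<pi>)"
  define k where "k = (\<integral>w. frame_cost q 0 w \<partial>law S \<pi>')"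
  have m: "0 \<le> m"
    unfolding m_def using g by (intro integral_nonneg_AE) auto
  have \<beta>: "0 \<le> \<beta>" by (rule bound_nonneg[OF \<pi>])
  have g_\<pi>: "(\<integral>\<^sup>+w. ennreal (?g w) \<partial>law S \<pi>) = ennreal m"
    unfolding m_def using g int by (intro nn_integral_eq_integral) auto
  have meas_g: "?g \<in> borel_measurable paths"
    using int by (auto simp: borel_measurable_law[OF \<pi>, symmetric])
  have g_\<sigma>: "has_bochner_integral (law S ?\<sigma>) ?g m"
    using nn_integral_switch_frame_start[OF \<pi> pol g(1), of r] g m meas_g
    by (intro has_bochner_integral_nn_integral)
      (auto simp: g_\<pi> borel_measurable_law[OF \<sigma>])
  \<comment> \<open>The shift by \<open>\<beta>\<close> makes the cost nonnegative on admissible slots.\<close>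
  have shift: "ennreal (?D r w) = (\<Sum>j<frame_length r w. ennreal (q (w (frame_start r w + j)) + \<beta>))"
    and D_nonneg: "0 \<le> ?D r w" if "admissible_path w" for r w
  proof -
    have "0 \<le> q (w t) + \<beta>" for t
      using cost_bound[OF q, of "w t"] that by auto
    moreover have "?D r w = (\<Sum>j<frame_length r w. q (w (frame_start r w + j)) + \<beta>)"
      by (simp add: frame_cost_def sum.distrib mult.commute)
    ultimately show "ennreal (?D r w) = (\<Sum>j<frame_length r w. ennreal (q (w (frame_start r w + j)) + \<beta>))"
      and "0 \<le> ?D r w"
      by (auto simp: sum_nonneg)
  qed
  have int_D: "has_bochner_integral (law S \<pi>') (?D 0) (k + \<beta> * (1 / renewal_prob S))"
    unfolding k_def
    by (intro has_bochner_integral_add has_bochner_integral_integrable integrable_frame_cost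
        has_bochner_integral_mult_right has_expectation_frame_length pol q)
  have D_nonneg': "AE w in law S \<pi>'. 0 \<le> ?D 0 w"
    by (rule eventually_mono[OF AE_admissible[OF pol]]) (rule D_nonneg)
  have k: "0 \<le> k + \<beta> * (1 / renewal_prob S)"
    using D_nonneg' integral_nonneg_AE[of "?D 0" "law S \<pi>'"] int_D
    by (simp add: has_bochner_integral_iff)
  have F: "(\<lambda>x. ennreal (q x + \<beta>)) \<in> borel_measurable (slot_space S)"
    using cost_measurable[OF q] by simp
  have "(\<integral>\<^sup>+w. ennreal (?g w * ?D r w) \<partial>law S ?\<sigma>)
      = (\<integral>\<^sup>+w. ennreal (?g w) * (\<Sum>j<frame_length r w. ennreal (q (w (frame_start r w + j)) + \<beta>)) \<partial>law S ?\<sigma>)"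
    by (intro nn_integral_cong_AE eventually_mono[OF AE_admissible[OF \<sigma>]])
      (simp add: shift[symmetric] ennreal_mult g D_nonneg)
  also have "\<dots> = ennreal m *
      (\<integral>\<^sup>+w. (\<Sum>j<frame_length 0 w. ennreal (q (w (frame_start 0 w + j)) + \<beta>)) \<partial>law S \<pi>')"
    unfolding nn_integral_frame_regeneration[OF \<pi> \<pi>' g(1) F] g_\<pi> ..
  also have "(\<integral>\<^sup>+w. (\<Sum>j<frame_length 0 w. ennreal (q (w (frame_start 0 w + j)) + \<beta>)) \<partial>law S \<pi>')
      = (\<integral>\<^sup>+w. ennreal (?D 0 w) \<partial>law S \<pi>')"
    by (intro nn_integral_cong_AE eventually_mono[OF AE_admissible[OF pol]]) (rule shift[symmetric])
  also have "\<dots> = ennreal (k + \<beta> * (1 / renewal_prob S))"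
    using int_D D_nonneg' by (subst nn_integral_eq_integral) (auto simp: has_bochner_integral_iff)
  also have "ennreal m * ennreal (k + \<beta> * (1 / renewal_prob S)) = ennreal (m * (k + \<beta> * (1 / renewal_prob S)))"
    using m k by (simp add: ennreal_mult)
  finally have nn: "(\<integral>\<^sup>+w. ennreal (?g w * ?D r w) \<partial>law S ?\<sigma>)
      = ennreal (m * (k + \<beta> * (1 / renewal_prob S)))" .
  have meas_T: "(\<lambda>w. real (frame_length r w)) \<in> borel_measurable paths"
    by (rule measurable_compose[OF measurable_frame_length]) simp
  have "has_bochner_integral (law S ?\<sigma>) (\<lambda>w. ?g w * ?D r w) (m * (k + \<beta> * (1 / renewal_prob S)))"
  proof (rule has_bochner_integral_nn_integral[OF _ _ _ nn])
    show "(\<lambda>w. ?g w * ?D r w) \<in> borel_measurable (law S ?\<sigma>)"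
      using meas_g meas_T measurable_frame_cost[OF q] by (simp add: borel_measurable_law[OF \<sigma>])
    show "AE w in law S ?\<sigma>. 0 \<le> ?g w * ?D r w"
      by (rule eventually_mono[OF AE_admissible[OF \<sigma>]]) (intro mult_nonneg_nonneg D_nonneg g)
    show "0 \<le> m * (k + \<beta> * (1 / renewal_prob S))"
      using m k by simp
  qed
  from has_bochner_integral_diff[OF this
      has_bochner_integral_mult_right[where c = \<beta>, OF has_expectation_mult_frame_length[OF \<sigma> g g_\<sigma>]]]
  show ?thesis
    by (simp add: algebra_simps m_def k_def)
qed

section \<open>The queues as backlogs\<close>

definition queue_cost :: "'n \<Rightarrow> ('w, 'z, 'a) slot \<Rightarrow> real" where
  "queue_cost n x = queue_diff S n (snd (snd x)) (fst x) (fst (snd x))"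

definition penalty_cost :: "nat \<Rightarrow> ('w, 'z, 'a) slot \<Rightarrow> real" where
  "penalty_cost l x = penalty S l (snd (snd x)) (fst x) (fst (snd x))"

lemma cost_queue_cost: "n \<in> queues S \<Longrightarrow> cost (queue_cost n)"
  unfolding cost_def queue_cost_def[abs_def] admissible_def
  using measurable_by_state[where f = "\<lambda>z a \<Omega>. queue_diff S n a \<Omega> z", OF queue_diff_measurable]
    queue_diff_bounded by auto

lemma cost_penalty_cost: "l \<le> num_penalties S \<Longrightarrow> cost (penalty_cost l)"
  unfolding cost_def penalty_cost_def[abs_def] admissible_def
  using measurable_by_state[where f = "\<lambda>z a \<Omega>. penalty S l a \<Omega> z", OF penalty_measurable]
    penalty_bounded by auto

lemma queue_eq_backlog: "queue S n t w = backlog (queue_cost n) t w"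
  by (induction t) (simp_all add: diff_at_def queue_cost_def)

lemma virtual_queue_eq_backlog: "virtual_queue S l t w = backlog (penalty_cost l) t w"
  by (induction t) (simp_all add: penalty_at_def penalty_cost_def)

lemma diff_at_eq: "diff_at S n = (\<lambda>t w. queue_cost n (w t))"
  by (simp add: fun_eq_iff diff_at_def queue_cost_def)

lemma penalty_at_eq: "penalty_at S l = (\<lambda>t w. penalty_cost l (w t))"
  by (simp add: fun_eq_iff penalty_at_def penalty_cost_def)

lemma frame_sum_diff_at: "frame_sum (diff_at S n) r w = frame_cost (queue_cost n) r w"
  unfolding diff_at_eq by (rule frame_sum_eq_frame_cost)

lemma frame_sum_penalty_at: "frame_sum (penalty_at S l) r w = frame_cost (penalty_cost l) r w"
  unfolding penalty_at_eq by (rule frame_sum_eq_frame_cost)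

text \<open>
  The two kinds of queues enter the argument in the same way, so they are indexed together.
\<close>

definition constraints :: "('n + nat) set" where
  "constraints = queues S <+> {1..num_penalties S}"

definition constraint_cost :: "'n + nat \<Rightarrow> ('w, 'z, 'a) slot \<Rightarrow> real" where
  "constraint_cost = case_sum queue_cost penalty_cost"

lemma finite_constraints: "finite constraints"
  by (simp add: constraints_def finite_queues)

lemma card_constraints: "card constraints = card (queues S) + num_penalties S"
  by (simp add: constraints_def card_Plus finite_queues)

lemma cost_constraint_cost: "i \<in> constraints \<Longrightarrow> cost (constraint_cost i)"
  by (auto simp: constraints_def constraint_cost_def intro: cost_queue_cost cost_penalty_cost)

lemma sum_constraints:
  fixes f :: "'n + nat \<Rightarrow> real"
  shows "sum f constraints = (\<Sum>n\<in>queues S. f (Inl n)) + (\<Sum>l=1..num_penalties S. f (Inr l))"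
  by (simp add: constraints_def sum.Plus finite_queues)

lemma frame_objective_eq:
  "frame_objective S V r w
    = (\<Sum>i\<in>constraints. backlog (constraint_cost i) (frame_start r w) w * frame_cost (constraint_cost i) r w)
      + V * frame_cost (penalty_cost 0) r w"
  by (simp add: frame_objective_def frame_drift_def sum_constraints constraint_cost_def
      queue_eq_backlog virtual_queue_eq_backlog frame_sum_diff_at frame_sum_penalty_at)

section \<open>Conditioning on the queues at the start of a frame\<close>

abbreviation vector_space :: "((nat \<Rightarrow> real) \<times> ('n \<Rightarrow> real)) measure" where
  "vector_space \<equiv> (\<Pi>\<^sub>M l\<in>{1..num_penalties S}. borel) \<Otimes>\<^sub>M (\<Pi>\<^sub>M n\<in>queues S. borel)"

lemma measurable_queue_vector_past: "queue_vector S t \<in> histories t \<rightarrow>\<^sub>M vector_space"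
  unfolding queue_vector_def[abs_def] queue_eq_backlog virtual_queue_eq_backlog
  by (intro measurable_Pair measurable_restrict measurable_backlog_past cost_queue_cost cost_penalty_cost) auto

lemma queue_vector_past: "queue_vector S t (past t w) = queue_vector S t w"
  by (simp add: queue_vector_def queue_eq_backlog virtual_queue_eq_backlog backlog_past)

lemma measurable_queue_vector_frame_start:
  "(\<lambda>w. queue_vector S (frame_start r w) w) \<in> paths \<rightarrow>\<^sub>M vector_space"
proof (rule measurable_at_frame_start)
  show "queue_vector S t \<in> paths \<rightarrow>\<^sub>M vector_space" for t
    using measurable_compose[OF measurable_past measurable_queue_vector_past, of t]
    by (simp add: queue_vector_past)
qed

lemma sets_queue_algebra:
  "sets (queue_algebra S r)
    = {(\<lambda>w. queue_vector S (frame_start r w) w) -` A \<inter> space paths | A. A \<in> sets vector_space}"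
  unfolding queue_algebra_def
  by (rule sets_vimage_algebra2) (use measurable_queue_vector_frame_start in \<open>auto simp: measurable_def\<close>)

lemma subalgebra_queue_algebra:
  assumes \<pi>: "\<pi> \<in> policies S" shows "subalgebra (law S \<pi>) (queue_algebra S r)"
  unfolding subalgebra_def
proof
  show "space (queue_algebra S r) = space (law S \<pi>)"
    by (simp add: queue_algebra_def space_law[OF \<pi>])
  show "sets (queue_algebra S r) \<subseteq> sets (law S \<pi>)"
    unfolding sets_queue_algebra sets_law[OF \<pi>]
    using measurable_sets[OF measurable_queue_vector_frame_start] by auto
qed

lemma sigma_finite_queue_algebra:
  assumes \<pi>: "\<pi> \<in> policies S" shows "sigma_finite_subalgebra (law S \<pi>) (queue_algebra S r)"
proof (rule finite_measure_subalgebra_is_sigma_finite)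
  interpret prob_space "law S \<pi>" by (rule prob_space_law[OF \<pi>])
  show "finite_measure_subalgebra (law S \<pi>) (queue_algebra S r)"
    by unfold_locales (rule subalgebra_queue_algebra[OF \<pi>])
qed

text \<open>
  The queues at the start of frame \<open>r\<close> are determined before the policies part, so they have the same
  law under both.
\<close>

lemma restr_to_queue_algebra_switch:
  assumes \<pi>: "\<pi> \<in> policies S" and \<pi>': "\<pi>' \<in> policies S"
  shows "restr_to_subalg (law S (switch_at_frame r \<pi> \<pi>')) (queue_algebra S r)
    = restr_to_subalg (law S \<pi>) (queue_algebra S r)"
proof (rule measure_eqI)
  let ?\<sigma> = "switch_at_frame r \<pi> \<pi>'"
  note \<sigma> = switch_at_frame_policy[OF \<pi> \<pi>', of r]
  note sub = subalgebra_queue_algebra[OF \<pi>, of r] subalgebra_queue_algebra[OF \<sigma>, of r]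
  show "sets (restr_to_subalg (law S ?\<sigma>) (queue_algebra S r))
      = sets (restr_to_subalg (law S \<pi>) (queue_algebra S r))"
    by (simp add: sets_restr_to_subalg sub)
  fix E assume "E \<in> sets (restr_to_subalg (law S ?\<sigma>) (queue_algebra S r))"
  then have E: "E \<in> sets (queue_algebra S r)"
    by (simp add: sets_restr_to_subalg sub)
  then obtain A where A: "A \<in> sets vector_space"
    and E_eq: "E = (\<lambda>w. queue_vector S (frame_start r w) w) -` A \<inter> space paths"
    unfolding sets_queue_algebra by auto
  define G where "G s w = (indicator A (queue_vector S s w) :: ennreal)" for s w
  have G: "history_functional s (G s)" for s
    unfolding history_functional_def G_def
    using A by (auto simp: queue_vector_past intro!: measurable_compose[OF measurable_queue_vector_past])
  have "emeasure (law S \<rho>) E = (\<integral>\<^sup>+w. G (frame_start r w) w \<partial>law S \<rho>)" if \<rho>: "\<rho> \<in> policies S" for \<rho>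
  proof -
    have "E \<in> sets (law S \<rho>)"
      using E subalgebra_queue_algebra[OF \<rho>, of r] by (auto simp: subalgebra_def)
    then have "emeasure (law S \<rho>) E = (\<integral>\<^sup>+w. indicator E w \<partial>law S \<rho>)"
      by simp
    also have "\<dots> = (\<integral>\<^sup>+w. G (frame_start r w) w \<partial>law S \<rho>)"
      by (intro nn_integral_cong) (simp add: G_def E_eq space_law[OF \<rho>] indicator_def)
    finally show ?thesis .
  qed
  then show "emeasure (restr_to_subalg (law S ?\<sigma>) (queue_algebra S r)) E
      = emeasure (restr_to_subalg (law S \<pi>) (queue_algebra S r)) E"
    using nn_integral_switch_frame_start[OF \<pi> \<pi>' G, of r]
    by (simp add: emeasure_restr_to_subalg[OF _ E] sub \<pi> \<sigma>)
qed

section \<open>The approximation inequality in expectation\<close>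

lemma backlog_functional:
  assumes "cost q" shows "history_functional s (\<lambda>w. ennreal (backlog q s w))"
  using history_functional_backlog[OF assms, of "\<lambda>x. x"] by simp

lemma measurable_backlog_frame_start:
  assumes \<pi>: "\<pi> \<in> policies S" and q: "cost q"
  shows "(\<lambda>w. backlog q (frame_start r w) w) \<in> borel_measurable (law S \<pi>)"
  unfolding borel_measurable_law[OF \<pi>] by (rule measurable_at_frame_start[OF measurable_backlog[OF q]])

lemma integrable_backlog_frame_start:
  assumes \<pi>: "\<pi> \<in> policies S" and q: "cost q"
  shows "integrable (law S \<pi>) (\<lambda>w. backlog q (frame_start r w) w)"
proof (rule Bochner_Integration.integrable_bound)
  show "integrable (law S \<pi>) (\<lambda>w. \<beta> * real (frame_start r w))"
    using has_expectation_frame_start[OF \<pi>, of r] by (simp add: has_bochner_integral_iff)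
  show "AE w in law S \<pi>. norm (backlog q (frame_start r w) w) \<le> norm (\<beta> * real (frame_start r w))"
    by (rule eventually_mono[OF AE_admissible[OF \<pi>]])
      (simp add: backlog_nonneg backlog_le[OF q] bound_nonneg[OF \<pi>])
qed (rule measurable_backlog_frame_start[OF \<pi> q])

lemma integrable_backlog_square_frame_start:
  assumes \<pi>: "\<pi> \<in> policies S" and q: "cost q"
  shows "integrable (law S \<pi>) (\<lambda>w. (backlog q (frame_start r w) w)\<^sup>2)"
proof (rule Bochner_Integration.integrable_bound)
  show "integrable (law S \<pi>) (\<lambda>w. \<beta>\<^sup>2 * (real (frame_start r w))\<^sup>2)"
    using has_expectation_frame_start_square[OF \<pi>, of r] by (simp add: has_bochner_integral_iff)
  show "AE w in law S \<pi>. norm ((backlog q (frame_start r w) w)\<^sup>2) \<le> norm (\<beta>\<^sup>2 * (real (frame_start r w))\<^sup>2)"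
    by (rule eventually_mono[OF AE_admissible[OF \<pi>]])
      (simp flip: power_mult_distrib add: power_mono backlog_nonneg backlog_le[OF q])
  show "(\<lambda>w. (backlog q (frame_start r w) w)\<^sup>2) \<in> borel_measurable (law S \<pi>)"
    by (intro borel_measurable_power measurable_backlog_frame_start \<pi> q)
qed

lemma integrable_backlog_mult_frame_cost:
  assumes "\<pi> \<in> policies S" "cost q"
  shows "integrable (law S \<pi>) (\<lambda>w. backlog q (frame_start r w) w * frame_cost q r w)"
  using assms by (intro integrable_mult_frame_cost backlog_functional backlog_nonneg integrable_backlog_frame_start)

lemma has_expectation_frame_objective:
  assumes \<pi>: "\<pi> \<in> policies S"
  shows "has_bochner_integral (law S \<pi>) (frame_objective S V r)
    ((\<Sum>i\<in>constraints. \<integral>w. backlog (constraint_cost i) (frame_start r w) w * frame_cost (constraint_cost i) r w \<partial>law S \<pi>)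
      + V * (\<integral>w. frame_cost (penalty_cost 0) r w \<partial>law S \<pi>))"
  unfolding frame_objective_eq[abs_def]
  by (intro has_bochner_integral_add has_bochner_integral_sum has_bochner_integral_mult_right
      has_bochner_integral_integrable integrable_frame_cost integrable_backlog_mult_frame_cost \<pi>
      cost_constraint_cost cost_penalty_cost) auto

definition mean_backlog :: "('w, 'z, 'a) policy \<Rightarrow> nat \<Rightarrow> real" where
  "mean_backlog \<pi> r = (\<Sum>i\<in>constraints. \<integral>w. backlog (constraint_cost i) (frame_start r w) w \<partial>law S \<pi>)"

text \<open>
  The conditional expectation under the switched policy is a function of the queues at the start
  of the frame, and these have the same law under both policies. Hence its mean under \<open>\<pi>\<close> is the
  mean of the objective under the switched policy.
\<close>

lemma cd_approximation_expectation:
  assumes \<pi>: "\<pi> \<in> policies S" and \<pi>': "\<pi>' \<in> policies S" and cd: "cd_approximation S V C \<delta> r \<pi>"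
  shows "(\<integral>w. frame_objective S V r w \<partial>law S \<pi>)
    \<le> (\<integral>w. frame_objective S V r w \<partial>law S (switch_at_frame r \<pi> \<pi>'))
      + C + \<delta> * mean_backlog \<pi> r + V * \<delta>"
proof -
  let ?\<sigma> = "switch_at_frame r \<pi> \<pi>'" and ?F = "queue_algebra S r" and ?f = "frame_objective S V r"
  note \<sigma> = switch_at_frame_policy[OF \<pi> \<pi>', of r]
  interpret P: prob_space "law S \<pi>" by (rule prob_space_law[OF \<pi>])
  interpret A: sigma_finite_subalgebra "law S \<pi>" ?F by (rule sigma_finite_queue_algebra[OF \<pi>])
  interpret B: sigma_finite_subalgebra "law S ?\<sigma>" ?F by (rule sigma_finite_queue_algebra[OF \<sigma>])
  let ?a = "real_cond_exp (law S \<pi>) ?F ?f" and ?b = "real_cond_exp (law S ?\<sigma>) ?F ?f"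
  note sub = subalgebra_queue_algebra[OF \<pi>, of r] subalgebra_queue_algebra[OF \<sigma>, of r]
  have int: "integrable (law S \<rho>) ?f" if "\<rho> \<in> policies S" for \<rho>
    using has_expectation_frame_objective[OF that] by (simp add: has_bochner_integral_iff)
  have b_meas: "?b \<in> borel_measurable ?F"
    by (rule borel_measurable_cond_exp)
  have b_int: "integrable (law S \<pi>) ?b"
  proof (rule integrable_from_subalg[OF sub(1)])
    show "integrable (restr_to_subalg (law S \<pi>) ?F) ?b"
      unfolding restr_to_queue_algebra_switch[OF \<pi> \<pi>', symmetric]
      by (rule integrable_in_subalg[OF sub(2) b_meas B.real_cond_exp_int(1)[OF int[OF \<sigma>]]])
  qed
  have b_eq: "(\<integral>w. ?b w \<partial>law S \<pi>) = (\<integral>w. ?f w \<partial>law S ?\<sigma>)"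
    using integral_subalgebra2[OF sub(1) b_meas] integral_subalgebra2[OF sub(2) b_meas]
      restr_to_queue_algebra_switch[OF \<pi> \<pi>', of r] B.real_cond_exp_int(2)[OF int[OF \<sigma>]]
    by simp
  let ?U = "\<lambda>w. \<Sum>i\<in>constraints. backlog (constraint_cost i) (frame_start r w) w"
  have U: "has_bochner_integral (law S \<pi>) ?U (mean_backlog \<pi> r)"
    unfolding mean_backlog_def
    by (intro has_bochner_integral_sum has_bochner_integral_integrable integrable_backlog_frame_start \<pi>
        cost_constraint_cost)
  have rhs: "has_bochner_integral (law S \<pi>) (\<lambda>w. ?b w + \<delta> * ?U w + (C + V * \<delta>) * 1)
      ((\<integral>w. ?f w \<partial>law S ?\<sigma>) + \<delta> * mean_backlog \<pi> r + (C + V * \<delta>) * 1)"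
    unfolding b_eq[symmetric]
    by (intro has_bochner_integral_add has_bochner_integral_mult_right U has_expectation_one \<pi>
        has_bochner_integral_integrable b_int)
  have "(\<integral>w. ?f w \<partial>law S \<pi>) = (\<integral>w. ?a w \<partial>law S \<pi>)"
    by (rule A.real_cond_exp_int(2)[OF int[OF \<pi>], symmetric])
  also have "\<dots> \<le> (\<integral>w. ?b w + \<delta> * ?U w + (C + V * \<delta>) * 1 \<partial>law S \<pi>)"
  proof (rule integral_mono_AE)
    have "AE w in law S \<pi>. ?a w \<le> ?b w
       + C + \<delta> * (\<Sum>n\<in>queues S. queue S n (frame_start r w) w)
       + \<delta> * (\<Sum>l=1..num_penalties S. virtual_queue S l (frame_start r w) w) + V * \<delta>"
      using cd \<pi>' by (simp add: cd_approximation_def)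
    then show "AE w in law S \<pi>. ?a w \<le> ?b w + \<delta> * ?U w + (C + V * \<delta>) * 1"
      by (rule eventually_mono)
        (simp add: sum_constraints constraint_cost_def queue_eq_backlog virtual_queue_eq_backlog algebra_simps)
    show "integrable (law S \<pi>) ?a"
      by (rule A.real_cond_exp_int(1)[OF int[OF \<pi>]])
    show "integrable (law S \<pi>) (\<lambda>w. ?b w + \<delta> * ?U w + (C + V * \<delta>) * 1)"
      using rhs by (simp only: has_bochner_integral_iff)
  qed
  also have "\<dots> = (\<integral>w. ?f w \<partial>law S ?\<sigma>) + \<delta> * mean_backlog \<pi> r + (C + V * \<delta>) * 1"
    using rhs by (simp only: has_bochner_integral_iff)
  finally show ?thesis by (simp add: algebra_simps)
qed

text \<open>
  By regeneration the objective of the switched policy factorises. This is where the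
  stationarity of the comparison policy is used: its frame averages, which the two assumptions control,
  do not depend on the queues.
\<close>

lemma expectation_switched_objective:
  assumes \<pi>: "\<pi> \<in> policies S" and \<pi>': "\<pi>' \<in> omega_z_only_policies S"
  shows "(\<integral>w. frame_objective S V r w \<partial>law S (switch_at_frame r \<pi> \<pi>'))
    = (\<Sum>i\<in>constraints. (\<integral>w. backlog (constraint_cost i) (frame_start r w) w \<partial>law S \<pi>) *
        (\<integral>w. frame_cost (constraint_cost i) 0 w \<partial>law S \<pi>'))
      + V * (\<integral>w. frame_cost (penalty_cost 0) 0 w \<partial>law S \<pi>')"
proof -
  have pol: "\<pi>' \<in> policies S"
    using \<pi>' by (simp add: omega_z_only_policies_def)
  note \<sigma> = switch_at_frame_policy[OF \<pi> pol, of r]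
  have "(\<integral>w. backlog (constraint_cost i) (frame_start r w) w * frame_cost (constraint_cost i) r w
        \<partial>law S (switch_at_frame r \<pi> \<pi>'))
      = (\<integral>w. backlog (constraint_cost i) (frame_start r w) w \<partial>law S \<pi>) *
        (\<integral>w. frame_cost (constraint_cost i) 0 w \<partial>law S \<pi>')" if "i \<in> constraints" for i
    by (rule has_bochner_integral_integral_eq, rule has_expectation_frame_regeneration[OF \<pi> \<pi>'])
      (use that \<pi> in \<open>auto intro: backlog_functional backlog_nonneg integrable_backlog_frame_start cost_constraint_cost\<close>)
  moreover have "(\<integral>w. 1 * frame_cost (penalty_cost 0) r w \<partial>law S (switch_at_frame r \<pi> \<pi>'))
      = (\<integral>w. 1 \<partial>law S \<pi>) * (\<integral>w. frame_cost (penalty_cost 0) 0 w \<partial>law S \<pi>')"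
    by (rule has_bochner_integral_integral_eq,
        rule has_expectation_frame_regeneration[OF \<pi> \<pi>', where g = "\<lambda>_ _. 1"])
      (use has_expectation_one[OF \<pi>] in \<open>auto intro: history_functional_const cost_penalty_cost
        simp: has_bochner_integral_iff\<close>)
  ultimately show ?thesis
    using has_bochner_integral_integral_eq[OF has_expectation_frame_objective[OF \<sigma>, of V r]]
      has_bochner_integral_integral_eq[OF has_expectation_one[OF \<pi>]]
    by simp
qed

section \<open>Drift of the squared backlogs\<close>

lemma backlog_square_frame_drift:
  assumes \<pi>: "\<pi> \<in> policies S" and q: "cost q"
  shows "(\<integral>w. (backlog q (frame_start (Suc r) w) w)\<^sup>2 \<partial>law S \<pi>)
    \<le> (\<integral>w. (backlog q (frame_start r w) w)\<^sup>2 \<partial>law S \<pi>)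
      + 2 * (\<integral>w. backlog q (frame_start r w) w * frame_cost q r w \<partial>law S \<pi>)
      + \<beta>\<^sup>2 * ((2 - renewal_prob S) / (renewal_prob S)\<^sup>2)"
proof -
  let ?b = "\<lambda>r w. backlog q (frame_start r w) w"
  have rhs: "has_bochner_integral (law S \<pi>)
      (\<lambda>w. (?b r w)\<^sup>2 + 2 * (?b r w * frame_cost q r w) + \<beta>\<^sup>2 * (real (frame_length r w))\<^sup>2)
      ((\<integral>w. (?b r w)\<^sup>2 \<partial>law S \<pi>) + 2 * (\<integral>w. ?b r w * frame_cost q r w \<partial>law S \<pi>)
        + \<beta>\<^sup>2 * ((2 - renewal_prob S) / (renewal_prob S)\<^sup>2))"
    by (intro has_bochner_integral_add has_bochner_integral_mult_right has_bochner_integral_integrable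
        integrable_backlog_square_frame_start integrable_backlog_mult_frame_cost
        has_expectation_frame_length_square \<pi> q)
  have "(\<integral>w. (?b (Suc r) w)\<^sup>2 \<partial>law S \<pi>)
      \<le> (\<integral>w. (?b r w)\<^sup>2 + 2 * (?b r w * frame_cost q r w) + \<beta>\<^sup>2 * (real (frame_length r w))\<^sup>2 \<partial>law S \<pi>)"
  proof (rule integral_mono_AE)
    show "AE w in law S \<pi>. (?b (Suc r) w)\<^sup>2
        \<le> (?b r w)\<^sup>2 + 2 * (?b r w * frame_cost q r w) + \<beta>\<^sup>2 * (real (frame_length r w))\<^sup>2"
      using AE_infinitely_many_renewals[OF \<pi>] AE_admissible[OF \<pi>]
    proof eventually_elim
      case (elim w)
      show ?case
        using backlog_square_drift[OF q elim(2), of "frame_start r w" "frame_length r w"]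
        by (simp add: frame_start_Suc[OF elim(1)] frame_cost_def mult.assoc del: frame_start.simps)
    qed
  qed (use rhs integrable_backlog_square_frame_start[OF \<pi> q] in \<open>auto simp: has_bochner_integral_iff simp del: frame_start.simps\<close>)
  then show ?thesis
    using rhs by (simp only: has_bochner_integral_iff)
qed

section \<open>From frames to slots\<close>

lemma integrable_backlog:
  assumes \<pi>: "\<pi> \<in> policies S" and q: "cost q"
  shows "integrable (law S \<pi>) (backlog q t)"
proof -
  interpret prob_space "law S \<pi>" by (rule prob_space_law[OF \<pi>])
  show ?thesis
  proof (rule integrable_const_bound[where B = "\<beta> * real t"])
    show "AE w in law S \<pi>. norm (backlog q t w) \<le> \<beta> * real t"
      by (rule eventually_mono[OF AE_admissible[OF \<pi>]]) (simp add: backlog_nonneg backlog_le[OF q])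
    show "backlog q t \<in> borel_measurable (law S \<pi>)"
      unfolding borel_measurable_law[OF \<pi>] by (rule measurable_backlog[OF q])
  qed
qed

lemma integrable_slot_cost:
  assumes \<pi>: "\<pi> \<in> policies S" and q: "cost q"
  shows "integrable (law S \<pi>) (\<lambda>w. q (w t))"
proof -
  interpret prob_space "law S \<pi>" by (rule prob_space_law[OF \<pi>])
  show ?thesis
  proof (rule integrable_const_bound[where B = \<beta>])
    show "AE w in law S \<pi>. norm (q (w t)) \<le> \<beta>"
      by (rule eventually_mono[OF AE_admissible[OF \<pi>]]) (simp add: cost_bound[OF q])
    show "(\<lambda>w. q (w t)) \<in> borel_measurable (law S \<pi>)"
      unfolding borel_measurable_law[OF \<pi>]
      by (rule measurable_compose[OF measurable_path_slot cost_measurable[OF q]])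
  qed
qed

text \<open>
  Strong stability over slots is inherited from frames: within frame \<open>r\<close> a backlog exceeds its initial
  value by at most \<open>\<beta> T\<^sub>r\<close>, and that initial value is independent of \<open>T\<^sub>r\<close>. Frames have length at
  least one, so the first \<open>t\<close> slots lie in the first \<open>t\<close> frames.
\<close>

lemma sum_backlog_le_frames:
  assumes \<pi>: "\<pi> \<in> policies S" and q: "cost q"
  shows "(\<Sum>\<tau><t. \<integral>w. backlog q \<tau> w \<partial>law S \<pi>)
    \<le> (\<Sum>r<t. (\<integral>w. backlog q (frame_start r w) w \<partial>law S \<pi>) / renewal_prob S
        + \<beta> * ((2 - renewal_prob S) / (renewal_prob S)\<^sup>2))"
proof -
  let ?h = "\<lambda>w. \<Sum>r<t. backlog q (frame_start r w) w * real (frame_length r w)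
      + \<beta> * (real (frame_length r w))\<^sup>2"
  have rhs: "has_bochner_integral (law S \<pi>) ?h
      (\<Sum>r<t. (\<integral>w. backlog q (frame_start r w) w \<partial>law S \<pi>) / renewal_prob S
        + \<beta> * ((2 - renewal_prob S) / (renewal_prob S)\<^sup>2))"
    by (intro has_bochner_integral_sum has_bochner_integral_add has_bochner_integral_mult_right
        has_expectation_mult_frame_length has_expectation_frame_length_square \<pi> q
        backlog_functional backlog_nonneg has_bochner_integral_integrable integrable_backlog_frame_start)
  have "(\<Sum>\<tau><t. \<integral>w. backlog q \<tau> w \<partial>law S \<pi>) = (\<integral>w. (\<Sum>\<tau><t. backlog q \<tau> w) \<partial>law S \<pi>)"
    by (simp add: integrable_backlog[OF \<pi> q])
  also have "\<dots> \<le> (\<integral>w. ?h w \<partial>law S \<pi>)"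
  proof (rule integral_mono_AE)
    show "AE w in law S \<pi>. (\<Sum>\<tau><t. backlog q \<tau> w) \<le> ?h w"
      using AE_infinitely_many_renewals[OF \<pi>] AE_admissible[OF \<pi>]
    proof eventually_elim
      case (elim w)
      have "(\<Sum>\<tau><t. backlog q \<tau> w) \<le> (\<Sum>\<tau><frame_start t w. backlog q \<tau> w)"
        using frame_start_ge[OF elim(1), of t] by (intro sum_mono2) (auto simp: backlog_nonneg)
      also have "\<dots> = (\<Sum>r<t. \<Sum>j<frame_length r w. backlog q (frame_start r w + j) w)"
        by (rule sum_frames[OF elim(1), symmetric])
      also have "\<dots> \<le> (\<Sum>r<t. \<Sum>j<frame_length r w.
          backlog q (frame_start r w) w + \<beta> * real (frame_length r w))"
      proof (intro sum_mono)
        fix r j assume "j \<in> {..<frame_length r w}"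
        then have "\<beta> * real j \<le> \<beta> * real (frame_length r w)"
          using bound_nonneg[OF \<pi>] by (intro mult_left_mono) auto
        with backlog_increment[OF q elim(2), of "frame_start r w" j]
        show "backlog q (frame_start r w + j) w
            \<le> backlog q (frame_start r w) w + \<beta> * real (frame_length r w)"
          by linarith
      qed
      also have "\<dots> = ?h w"
        by (simp add: power2_eq_square algebra_simps)
      finally show ?case .
    qed
    show "integrable (law S \<pi>) (\<lambda>w. \<Sum>\<tau><t. backlog q \<tau> w)"
      by (intro Bochner_Integration.integrable_sum integrable_backlog \<pi> q)
    show "integrable (law S \<pi>) ?h"
      using rhs by (simp only: has_bochner_integral_iff)
  qed
  also have "\<dots> = (\<Sum>r<t. (\<integral>w. backlog q (frame_start r w) w \<partial>law S \<pi>) / renewal_prob S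
        + \<beta> * ((2 - renewal_prob S) / (renewal_prob S)\<^sup>2))"
    using rhs by (simp only: has_bochner_integral_iff)
  finally show ?thesis .
qed

lemma sum_backlog_linear:
  assumes \<pi>: "\<pi> \<in> policies S" and i: "i \<in> constraints"
    and K: "\<And>R. (\<Sum>r<R. mean_backlog \<pi> r) \<le> K * real R"
  shows "\<exists>K'\<ge>0. \<forall>t. (\<Sum>\<tau><t. \<integral>w. backlog (constraint_cost i) \<tau> w \<partial>law S \<pi>) \<le> K' * real t"
proof (intro exI conjI allI)
  let ?v = "\<beta> * ((2 - renewal_prob S) / (renewal_prob S)\<^sup>2)"
  let ?E = "\<lambda>r. \<integral>w. backlog (constraint_cost i) (frame_start r w) w \<partial>law S \<pi>"
  let ?K = "\<bar>K\<bar> / renewal_prob S + ?v"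
  show "0 \<le> ?K"
    using bound_nonneg[OF \<pi>] renewal_prob_pos renewal_prob_le_1
    by (intro add_nonneg_nonneg mult_nonneg_nonneg divide_nonneg_nonneg) auto
  fix t
  have E: "?E r \<le> mean_backlog \<pi> r" for r
    unfolding mean_backlog_def using i finite_constraints
    by (intro member_le_sum[where f = "\<lambda>i. \<integral>w. backlog (constraint_cost i) (frame_start r w) w \<partial>law S \<pi>"]
        integral_nonneg_AE) (auto simp: backlog_nonneg)
  have "(\<Sum>r<t. ?E r) \<le> (\<Sum>r<t. mean_backlog \<pi> r)"
    by (intro sum_mono E)
  also have "\<dots> \<le> \<bar>K\<bar> * real t"
    using K[of t] mult_right_mono[OF abs_ge_self, of "real t" K] by simp
  finally have "(\<Sum>r<t. ?E r) / renewal_prob S \<le> \<bar>K\<bar> * real t / renewal_prob S"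
    using renewal_prob_pos by (intro divide_right_mono) auto
  with sum_backlog_le_frames[OF \<pi> cost_constraint_cost[OF i], of t]
  show "(\<Sum>\<tau><t. \<integral>w. backlog (constraint_cost i) \<tau> w \<partial>law S \<pi>) \<le> ?K * real t"
    by (simp add: sum.distrib sum_divide_distrib algebra_simps)
qed

lemma time_avg_finite:
  assumes "\<And>t. (\<Sum>\<tau><t. \<integral>w. f \<tau> w \<partial>law S \<pi>) \<le> K * real t"
  shows "time_avg S \<pi> f < \<infinity>"
proof -
  have "\<forall>\<^sub>F t in sequentially. ereal (1 / real t * (\<Sum>\<tau><t. \<integral>w. f \<tau> w \<partial>law S \<pi>)) \<le> ereal K"
    using eventually_gt_at_top[of 0]
    by eventually_elim (use assms in \<open>simp add: field_simps\<close>)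
  then have "time_avg S \<pi> f \<le> ereal K"
    unfolding time_avg_def by (rule Limsup_bounded)
  also have "\<dots> < \<infinity>" by simp
  finally show ?thesis .
qed

text \<open>
  A mean backlog that is \<open>a\<close> at time \<open>t\<close> was at least \<open>a - \<beta> m\<close> during the preceding \<open>m\<close> slots. So a
  linear bound \<open>K t\<close> on the sum of the mean backlogs gives \<open>m a \<le> K t + \<beta> m\<^sup>2\<close>, which makes
  \<open>a / t\<close> small for \<open>m\<close> large and \<open>t\<close> much larger.
\<close>

lemma time_avg_cost_nonpos:
  assumes \<pi>: "\<pi> \<in> policies S" and q: "cost q" and K: "0 \<le> K"
    "\<And>t. (\<Sum>\<tau><t. \<integral>w. backlog q \<tau> w \<partial>law S \<pi>) \<le> K * real t"
  shows "time_avg S \<pi> (\<lambda>t w. q (w t)) \<le> 0"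
proof -
  define a where "a t = (\<integral>w. backlog q t w \<partial>law S \<pi>)" for t
  interpret prob_space "law S \<pi>" by (rule prob_space_law[OF \<pi>])
  note \<beta> = bound_nonneg[OF \<pi>]
  have a_nonneg: "0 \<le> a t" for t
    unfolding a_def by (intro integral_nonneg_AE) (simp add: backlog_nonneg)
  have increment: "a (s + j) \<le> a s + \<beta> * real j" for s j
  proof -
    have "a (s + j) \<le> (\<integral>w. backlog q s w + \<beta> * real j \<partial>law S \<pi>)"
      unfolding a_def
    proof (rule integral_mono_AE)
      show "AE w in law S \<pi>. backlog q (s + j) w \<le> backlog q s w + \<beta> * real j"
        using AE_admissible[OF \<pi>]
        by eventually_elim (use backlog_increment[OF q] in \<open>smt (verit)\<close>)
    qed (use integrable_backlog[OF \<pi> q] in auto)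
    then show ?thesis
      using integrable_backlog[OF \<pi> q] by (simp add: a_def prob_space)
  qed
  have window: "real m * a t \<le> K * real t + \<beta> * (real m)\<^sup>2" if "m \<le> t" for m t
  proof -
    have "real m * a t = (\<Sum>\<tau>\<in>{t - m..<t}. a t)"
      using that by simp
    also have "\<dots> \<le> (\<Sum>\<tau>\<in>{t - m..<t}. a \<tau> + \<beta> * real m)"
    proof (rule sum_mono)
      fix \<tau> assume \<tau>: "\<tau> \<in> {t - m..<t}"
      then have "a t \<le> a \<tau> + \<beta> * real (t - \<tau>)"
        using increment[of \<tau> "t - \<tau>"] by simp
      also have "\<beta> * real (t - \<tau>) \<le> \<beta> * real m"
        using \<tau> \<beta> by (intro mult_left_mono) auto
      finally show "a t \<le> a \<tau> + \<beta> * real m" by simp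
    qed
    also have "\<dots> = (\<Sum>\<tau>\<in>{t - m..<t}. a \<tau>) + \<beta> * (real m)\<^sup>2"
      using that by (simp add: sum.distrib power2_eq_square)
    also have "(\<Sum>\<tau>\<in>{t - m..<t}. a \<tau>) \<le> (\<Sum>\<tau><t. a \<tau>)"
      by (intro sum_mono2) (auto simp: a_nonneg)
    also have "\<dots> \<le> K * real t"
      using K(2)[of t] by (simp add: a_def)
    finally show ?thesis by simp
  qed
  have avg: "(\<Sum>\<tau><t. \<integral>w. q (w \<tau>) \<partial>law S \<pi>) \<le> a t" for t
  proof -
    have "(\<Sum>\<tau><t. \<integral>w. q (w \<tau>) \<partial>law S \<pi>) = (\<integral>w. (\<Sum>\<tau><t. q (w \<tau>)) \<partial>law S \<pi>)"
      by (simp add: integrable_slot_cost[OF \<pi> q])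
    also have "\<dots> \<le> a t"
      unfolding a_def
      by (intro integral_mono Bochner_Integration.integrable_sum integrable_slot_cost integrable_backlog
          sum_cost_le_backlog \<pi> q)
    finally show ?thesis .
  qed
  have "time_avg S \<pi> (\<lambda>t w. q (w t)) \<le> 0 + ereal e" if e: "0 < e" for e
  proof -
    obtain m :: nat where m: "2 * K / e < real m" "0 < m"
      using reals_Archimedean2[of "max (2 * K / e) 0"] by auto
    obtain t0 :: nat where t0: "2 * \<beta> * real m / e < real t0"
      using reals_Archimedean2 by blast
    have "ereal (1 / real t * (\<Sum>\<tau><t. \<integral>w. q (w \<tau>) \<partial>law S \<pi>)) \<le> ereal e" if t: "t \<ge> max (max m t0) 1" for t
    proof -
      have "2 * K \<le> e * real m" "2 * \<beta> * real m \<le> e * real t"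
        using m(1) t0 t e by (simp_all add: field_simps) (smt (verit) mult_left_mono of_nat_mono)
      then have bounds: "2 * K * real t \<le> e * real m * real t" "2 * \<beta> * real m * real m \<le> e * real t * real m"
        by (intro mult_right_mono; simp)+
      have "2 * (real m * a t) \<le> 2 * K * real t + 2 * \<beta> * real m * real m"
        using window[of m t] t by (simp add: power2_eq_square)
      also have "\<dots> \<le> e * real m * real t + e * real t * real m"
        by (rule add_mono[OF bounds])
      finally have "real m * a t \<le> real m * (e * real t)"
        by (simp add: mult_ac)
      then have "a t \<le> e * real t"
        using m(2) by simp
      with avg[of t] t show ?thesis
        by (simp add: field_simps)
    qed
    then show ?thesis
      unfolding time_avg_def
      by (intro Limsup_bounded eventually_sequentiallyI[of "max (max m t0) 1"]) simp
  qed
  then show ?thesis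
    by (rule ereal_le_epsilon2[rule_format])
qed

text \<open>
  The first \<open>R = \<lfloor>\<phi> t\<rfloor>\<close> frames end at time \<open>t\<close> up to a mean error of order \<open>sqrt t\<close>, because the
  variance of \<open>t\<^sub>R\<close> is linear in \<open>R\<close>. So for a bounded cost, a bound on the averages over frames
  carries over to the average over slots.
\<close>

lemma time_avg_le_frame_avg:
  assumes \<pi>: "\<pi> \<in> policies S" and q: "cost q"
    and frames: "\<And>R. (\<Sum>r<R. \<integral>w. frame_cost q r w \<partial>law S \<pi>) \<le> real R * (c / renewal_prob S)"
  shows "time_avg S \<pi> (\<lambda>t w. q (w t)) \<le> ereal c"
proof -
  let ?p = "renewal_prob S"
  note \<beta> = bound_nonneg[OF \<pi>] and p = renewal_prob_pos renewal_prob_le_1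
  define v where "v = (1 - ?p) / ?p\<^sup>2"
  have v: "0 \<le> v" using p by (simp add: v_def)
  have shift: "\<bar>(\<Sum>\<tau><t. q (w \<tau>)) - (\<Sum>\<tau><s. q (w \<tau>))\<bar> \<le> \<beta> * \<bar>real t - real s\<bar>"
    if w: "admissible_path w" for s t w
  proof -
    have *: "\<bar>(\<Sum>\<tau><b. q (w \<tau>)) - (\<Sum>\<tau><a. q (w \<tau>))\<bar> \<le> \<beta> * (real b - real a)" if "a \<le> b" for a b
      using that
    proof (induction rule: dec_induct)
      case (step n)
      then show ?case
        using cost_bound[OF q w[rule_format, of n]] by (simp add: algebra_simps)
    qed simp
    show ?thesis
      using *[of s t] *[of t s] by (cases "s \<le> t") (auto simp: abs_minus_commute)
  qed
  have "1 / real t * (\<Sum>\<tau><t. \<integral>w. q (w \<tau>) \<partial>law S \<pi>)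
      \<le> c + (\<bar>c\<bar> + \<beta>) / ?p / real t + \<beta> * (1 + v) / sqrt (real t)" if t: "0 < t" for t
  proof -
    define R where "R = nat \<lfloor>?p * real t\<rfloor>"
    have R: "real R \<le> ?p * real t" "?p * real t < real R + 1"
      unfolding R_def using p by (auto simp: of_nat_floor)
    have R_t: "\<bar>real t - real R / ?p\<bar> \<le> 1 / ?p" "real R \<le> real t"
    proof -
      have "\<bar>?p * real t - real R\<bar> / ?p \<le> 1 / ?p"
        using R p by (intro divide_right_mono) auto
      moreover have "real t - real R / ?p = (?p * real t - real R) / ?p"
        using p by (simp add: diff_divide_distrib)
      ultimately show "\<bar>real t - real R / ?p\<bar> \<le> 1 / ?p"
        using p by (simp add: abs_divide)
      show "real R \<le> real t"
        using R(1) mult_right_mono[OF p(2), of "real t"] by simp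
    qed
    \<comment> \<open>The deviation \<open>?x\<close> has mean square of order \<open>t\<close>. Its absolute value is bounded through its
      square, balanced at \<open>sqrt t\<close>, so that the mean absolute value is of order \<open>sqrt t\<close>.\<close>
    let ?x = "\<lambda>w. real (frame_start R w) - real R / ?p"
    let ?h = "\<lambda>w. (\<Sum>r<R. frame_cost q r w) + \<beta> * ((1 / ?p + sqrt (real t)) * 1 + (1 / sqrt (real t)) * (?x w)\<^sup>2)"
    have h: "has_bochner_integral (law S \<pi>) ?h ((\<Sum>r<R. \<integral>w. frame_cost q r w \<partial>law S \<pi>)
        + \<beta> * ((1 / ?p + sqrt (real t)) * 1 + (1 / sqrt (real t)) * (real R * v)))"
      unfolding v_def
      by (intro has_bochner_integral_add has_bochner_integral_sum has_bochner_integral_mult_right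
          has_bochner_integral_integrable integrable_frame_cost has_expectation_one
          has_expectation_frame_start_deviation \<pi> q)
    have abs_le: "\<bar>x\<bar> \<le> sqrt (real t) + (1 / sqrt (real t)) * x\<^sup>2" for x
    proof (cases "\<bar>x\<bar> \<le> sqrt (real t)")
      case True
      then show ?thesis by (smt (verit) real_sqrt_ge_zero of_nat_0_le_iff divide_nonneg_nonneg mult_nonneg_nonneg zero_le_power2)
    next
      case False
      then have "\<bar>x\<bar> * sqrt (real t) \<le> \<bar>x\<bar> * \<bar>x\<bar>"
        by (intro mult_left_mono) auto
      then have "\<bar>x\<bar> \<le> (1 / sqrt (real t)) * x\<^sup>2"
        using t by (simp add: field_simps power2_eq_square)
      then show ?thesis by (smt (verit) real_sqrt_ge_zero of_nat_0_le_iff)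
    qed
    have "(\<Sum>\<tau><t. \<integral>w. q (w \<tau>) \<partial>law S \<pi>) = (\<integral>w. (\<Sum>\<tau><t. q (w \<tau>)) \<partial>law S \<pi>)"
      by (simp add: integrable_slot_cost[OF \<pi> q])
    also have "\<dots> \<le> (\<integral>w. ?h w \<partial>law S \<pi>)"
    proof (rule integral_mono_AE)
      show "AE w in law S \<pi>. (\<Sum>\<tau><t. q (w \<tau>)) \<le> ?h w"
        using AE_infinitely_many_renewals[OF \<pi>] AE_admissible[OF \<pi>]
      proof eventually_elim
        case (elim w)
        have "(\<Sum>\<tau><t. q (w \<tau>)) \<le> (\<Sum>\<tau><frame_start R w. q (w \<tau>)) + \<beta> * \<bar>real t - real (frame_start R w)\<bar>"
          using shift[OF elim(2), of t "frame_start R w"] by linarith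
        also have "(\<Sum>\<tau><frame_start R w. q (w \<tau>)) = (\<Sum>r<R. frame_cost q r w)"
          unfolding frame_cost_def by (rule sum_frames[OF elim(1), symmetric])
        also have "\<beta> * \<bar>real t - real (frame_start R w)\<bar>
            \<le> \<beta> * ((1 / ?p + sqrt (real t)) * 1 + (1 / sqrt (real t)) * (?x w)\<^sup>2)"
        proof (intro mult_left_mono \<beta>)
          have "\<bar>real t - real (frame_start R w)\<bar> \<le> \<bar>real t - real R / ?p\<bar> + \<bar>?x w\<bar>"
            by linarith
          also have "\<dots> \<le> 1 / ?p + (sqrt (real t) + (1 / sqrt (real t)) * (?x w)\<^sup>2)"
            by (intro add_mono R_t(1) abs_le)
          finally show "\<bar>real t - real (frame_start R w)\<bar>
              \<le> (1 / ?p + sqrt (real t)) * 1 + (1 / sqrt (real t)) * (?x w)\<^sup>2"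
            by simp
        qed
        finally show ?case by simp
      qed
      show "integrable (law S \<pi>) (\<lambda>w. \<Sum>\<tau><t. q (w \<tau>))"
        by (intro Bochner_Integration.integrable_sum integrable_slot_cost \<pi> q)
      show "integrable (law S \<pi>) ?h"
        using h by (simp only: has_bochner_integral_iff)
    qed
    also have "\<dots> = (\<Sum>r<R. \<integral>w. frame_cost q r w \<partial>law S \<pi>)
        + \<beta> * ((1 / ?p + sqrt (real t)) * 1 + (1 / sqrt (real t)) * (real R * v))"
      using h by (simp only: has_bochner_integral_iff)
    also have "(\<Sum>r<R. \<integral>w. frame_cost q r w \<partial>law S \<pi>) \<le> c * real t + \<bar>c\<bar> / ?p"
    proof -
      have "c * (real R / ?p - real t) \<le> \<bar>c\<bar> * \<bar>real R / ?p - real t\<bar>"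
        by (simp flip: abs_mult)
      also have "\<dots> \<le> \<bar>c\<bar> * (1 / ?p)"
        using R_t(1) by (intro mult_left_mono) (auto simp: abs_minus_commute)
      finally show ?thesis
        using frames[of R] by (simp add: algebra_simps)
    qed
    also have "(1 / ?p + sqrt (real t)) * 1 + (1 / sqrt (real t)) * (real R * v)
        \<le> 1 / ?p + (1 + v) * sqrt (real t)"
    proof -
      have "(1 / sqrt (real t)) * (real R * v) \<le> (1 / sqrt (real t)) * (real t * v)"
        using R_t(2) v by (intro mult_left_mono mult_right_mono) auto
      also have "\<dots> = v * (real t / sqrt (real t))"
        by simp
      also have "\<dots> = v * sqrt (real t)"
        by (simp only: real_div_sqrt of_nat_0_le_iff)
      finally show ?thesis by (simp add: algebra_simps)
    qed
    finally have "(\<Sum>\<tau><t. \<integral>w. q (w \<tau>) \<partial>law S \<pi>)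
        \<le> c * real t + \<bar>c\<bar> / ?p + \<beta> * (1 / ?p + (1 + v) * sqrt (real t))"
      using \<beta> by (simp add: mult_left_mono)
    then have "1 / real t * (\<Sum>\<tau><t. \<integral>w. q (w \<tau>) \<partial>law S \<pi>)
        \<le> 1 / real t * (c * real t + \<bar>c\<bar> / ?p + \<beta> * (1 / ?p + (1 + v) * sqrt (real t)))"
      by (intro mult_left_mono) auto
    also have "\<dots> = c + (\<bar>c\<bar> + \<beta>) / ?p / real t + \<beta> * (1 + v) * (sqrt (real t) / real t)"
      using t p by (simp add: field_simps)
    also have "sqrt (real t) / real t = 1 / sqrt (real t)"
      using t by (simp add: sqrt_divide_self_eq inverse_eq_divide)
    finally show ?thesis by simp
  qed
  then have "\<forall>\<^sub>F t in sequentially. ereal (1 / real t * (\<Sum>\<tau><t. \<integral>w. q (w \<tau>) \<partial>law S \<pi>))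
      \<le> ereal (c + (\<bar>c\<bar> + \<beta>) / ?p / real t + \<beta> * (1 + v) / sqrt (real t))"
    by (intro eventually_mono[OF eventually_gt_at_top[of 0]]) simp
  then have "time_avg S \<pi> (\<lambda>t w. q (w t))
      \<le> limsup (\<lambda>t. ereal (c + (\<bar>c\<bar> + \<beta>) / ?p / real t + \<beta> * (1 + v) / sqrt (real t)))"
    unfolding time_avg_def by (rule Limsup_mono)
  also have "(\<lambda>t. c + (\<bar>c\<bar> + \<beta>) / ?p / real t + \<beta> * (1 + v) / sqrt (real t)) \<longlonglongrightarrow> c + 0 + 0"
    by (intro tendsto_add tendsto_const tendsto_divide_0[OF tendsto_const]
        filterlim_at_top_imp_at_infinity filterlim_real_sequentially
        filterlim_compose[OF sqrt_at_top filterlim_real_sequentially])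
  then have "limsup (\<lambda>t. ereal (c + (\<bar>c\<bar> + \<beta>) / ?p / real t + \<beta> * (1 + v) / sqrt (real t))) = ereal c"
    by (intro lim_imp_Limsup) auto
  finally show ?thesis .
qed

section \<open>Drift plus penalty\<close>

text \<open>
  The constant \<open>B\<close> of the theorem. Divided by \<open>\<phi>\<^sup>2\<close> it is half the number of constraints times
  \<open>\<beta>\<^sup>2\<close> times the second moment \<open>(2 - \<phi>) / \<phi>\<^sup>2\<close> of the length of a frame.
\<close>

definition drift_constant :: real where
  "drift_constant = (2 - renewal_prob S) * \<beta>\<^sup>2 * real (card constraints) / 2"

text \<open>
  Summation over the frames telescopes the quadratic Lyapunov function, which starts at zero and stays
  nonnegative. The objective of a frame is the linear part of its drift plus \<open>V\<close> times its penalty.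
\<close>

lemma sum_penalty_le_sum_objective:
  assumes \<pi>: "\<pi> \<in> policies S"
  shows "V * (\<Sum>r<R. \<integral>w. frame_cost (penalty_cost 0) r w \<partial>law S \<pi>)
    \<le> (\<Sum>r<R. \<integral>w. frame_objective S V r w \<partial>law S \<pi>) + real R * (drift_constant / (renewal_prob S)\<^sup>2)"
proof -
  define Y where "Y r = (\<integral>w. frame_cost (penalty_cost 0) r w \<partial>law S \<pi>)" for r
  define lyapunov where
    "lyapunov r = (\<Sum>i\<in>constraints. \<integral>w. (backlog (constraint_cost i) (frame_start r w) w)\<^sup>2 \<partial>law S \<pi>) / 2" for r
  define k where "k = drift_constant / (renewal_prob S)\<^sup>2"
  have nonneg: "0 \<le> lyapunov r" for r
    unfolding lyapunov_def by (intro divide_nonneg_nonneg sum_nonneg integral_nonneg_AE) auto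
  have step: "lyapunov (Suc r) + V * Y r
      \<le> lyapunov r + (\<integral>w. frame_objective S V r w \<partial>law S \<pi>) + k" for r
  proof -
    have "(\<Sum>i\<in>constraints. \<integral>w. (backlog (constraint_cost i) (frame_start (Suc r) w) w)\<^sup>2 \<partial>law S \<pi>)
        \<le> (\<Sum>i\<in>constraints. (\<integral>w. (backlog (constraint_cost i) (frame_start r w) w)\<^sup>2 \<partial>law S \<pi>)
          + 2 * (\<integral>w. backlog (constraint_cost i) (frame_start r w) w * frame_cost (constraint_cost i) r w \<partial>law S \<pi>)
          + \<beta>\<^sup>2 * ((2 - renewal_prob S) / (renewal_prob S)\<^sup>2))"
      by (intro sum_mono backlog_square_frame_drift \<pi> cost_constraint_cost)
    moreover have "k = real (card constraints) * (\<beta>\<^sup>2 * ((2 - renewal_prob S) / (renewal_prob S)\<^sup>2)) / 2"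
      by (simp add: k_def drift_constant_def mult_ac)
    ultimately show ?thesis
      unfolding lyapunov_def Y_def has_bochner_integral_integral_eq[OF has_expectation_frame_objective[OF \<pi>]]
      by (simp add: sum.distrib sum_distrib_left[symmetric] del: frame_start.simps)
  qed
  have "lyapunov R + V * (\<Sum>r<R. Y r)
      \<le> (\<Sum>r<R. \<integral>w. frame_objective S V r w \<partial>law S \<pi>) + real R * k"
  proof (induction R)
    case 0
    then show ?case by (simp add: lyapunov_def)
  next
    case (Suc R)
    then show ?case using step[of R] by (simp add: algebra_simps)
  qed
  then show ?thesis
    using nonneg[of R] by (simp add: Y_def k_def)
qed

text \<open>
  The frame objective of an approximate minimiser is compared with that of an \<open>(\<Omega>, z)\<close>-only policy
  whose constraints hold with slack \<open>e\<close> per slot. The slack acts on the backlogs with weight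
  \<open>e / \<phi>\<close>, its accumulation over a frame of mean length \<open>1 / \<phi>\<close>.
\<close>

lemma objective_le:
  assumes \<pi>: "\<pi> \<in> policies S" and cd: "cd_approximation S V C \<delta> r \<pi>" and V: "0 \<le> V"
    and \<pi>': "\<pi>' \<in> omega_z_only_policies S"
    and slack: "\<And>i. i \<in> constraints \<Longrightarrow> renewal_prob S * (\<integral>w. frame_cost (constraint_cost i) 0 w \<partial>law S \<pi>') \<le> - e"
    and y: "renewal_prob S * (\<integral>w. frame_cost (penalty_cost 0) 0 w \<partial>law S \<pi>') \<le> y"
  shows "(\<integral>w. frame_objective S V r w \<partial>law S \<pi>)
    \<le> - (e / renewal_prob S) * mean_backlog \<pi> r + V * (y / renewal_prob S) + C + \<delta> * mean_backlog \<pi> r + V * \<delta>"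
proof -
  have pol: "\<pi>' \<in> policies S"
    using \<pi>' by (simp add: omega_z_only_policies_def)
  have "(\<Sum>i\<in>constraints. (\<integral>w. backlog (constraint_cost i) (frame_start r w) w \<partial>law S \<pi>) *
        (\<integral>w. frame_cost (constraint_cost i) 0 w \<partial>law S \<pi>'))
      \<le> (\<Sum>i\<in>constraints. (\<integral>w. backlog (constraint_cost i) (frame_start r w) w \<partial>law S \<pi>) * (- e / renewal_prob S))"
    using slack renewal_prob_pos
    by (intro sum_mono mult_left_mono integral_nonneg_AE) (auto simp: backlog_nonneg field_simps)
  also have "\<dots> = - (e / renewal_prob S) * mean_backlog \<pi> r"
    unfolding mean_backlog_def sum_distrib_right[symmetric] by simp
  finally have "(\<integral>w. frame_objective S V r w \<partial>law S (switch_at_frame r \<pi> \<pi>'))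
      \<le> - (e / renewal_prob S) * mean_backlog \<pi> r + V * (\<integral>w. frame_cost (penalty_cost 0) 0 w \<partial>law S \<pi>')"
    unfolding expectation_switched_objective[OF \<pi> \<pi>'] by simp
  moreover have "V * (\<integral>w. frame_cost (penalty_cost 0) 0 w \<partial>law S \<pi>') \<le> V * (y / renewal_prob S)"
    using y V renewal_prob_pos by (intro mult_left_mono) (auto simp: field_simps)
  ultimately show ?thesis
    using cd_approximation_expectation[OF \<pi> pol cd] by linarith
qed

text \<open>
  With positive slack, each unit of backlog at the start of a frame lowers the bound on the objective by
  \<open>e / \<phi> - \<delta>\<close>. The objectives cannot sum to less than what the bounded penalties allow, so the
  backlogs have bounded averages.
\<close>

lemma sum_mean_backlog_le:
  assumes \<pi>: "\<pi> \<in> policies S" and cd: "\<And>r. cd_approximation S V C \<delta> r \<pi>" and V: "0 \<le> V"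
    and e: "renewal_prob S * \<delta> < e" and \<pi>': "\<pi>' \<in> omega_z_only_policies S"
    and slack: "\<And>i. i \<in> constraints \<Longrightarrow> renewal_prob S * (\<integral>w. frame_cost (constraint_cost i) 0 w \<partial>law S \<pi>') \<le> - e"
  shows "(\<Sum>r<R. mean_backlog \<pi> r)
    \<le> (drift_constant / renewal_prob S + C * renewal_prob S + V * (renewal_prob S * \<delta> + 2 * \<beta>)) /
        (e - renewal_prob S * \<delta>) * real R"
proof -
  let ?p = "renewal_prob S" and ?U = "\<Sum>r<R. mean_backlog \<pi> r"
  have pol: "\<pi>' \<in> policies S"
    using \<pi>' by (simp add: omega_z_only_policies_def)
  note p = renewal_prob_pos
  have y: "?p * (\<integral>w. frame_cost (penalty_cost 0) 0 w \<partial>law S \<pi>') \<le> \<beta>"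
    using abs_expectation_frame_cost_le[OF pol cost_penalty_cost[of 0], of 0] p
    by (simp add: field_simps abs_le_iff)
  have "- (\<beta> / ?p) \<le> (\<integral>w. frame_cost (penalty_cost 0) r w \<partial>law S \<pi>)" for r
    using abs_expectation_frame_cost_le[OF \<pi> cost_penalty_cost[of 0], of r] by linarith
  then have "(\<Sum>r<R. - (\<beta> / ?p)) \<le> (\<Sum>r<R. \<integral>w. frame_cost (penalty_cost 0) r w \<partial>law S \<pi>)"
    by (intro sum_mono)
  then have "V * (\<Sum>r<R. - (\<beta> / ?p)) \<le> V * (\<Sum>r<R. \<integral>w. frame_cost (penalty_cost 0) r w \<partial>law S \<pi>)"
    using V by (rule mult_left_mono)
  also have "\<dots> \<le> (\<Sum>r<R. \<integral>w. frame_objective S V r w \<partial>law S \<pi>) + real R * (drift_constant / ?p\<^sup>2)"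
    by (rule sum_penalty_le_sum_objective[OF \<pi>])
  also have "(\<Sum>r<R. \<integral>w. frame_objective S V r w \<partial>law S \<pi>)
      \<le> (\<Sum>r<R. - (e / ?p) * mean_backlog \<pi> r + V * (\<beta> / ?p) + C + \<delta> * mean_backlog \<pi> r + V * \<delta>)"
    by (intro sum_mono objective_le[OF \<pi> cd V \<pi>' slack y])
  also have "\<dots> = (\<Sum>r<R. (\<delta> - e / ?p) * mean_backlog \<pi> r + (V * (\<beta> / ?p) + C + V * \<delta>))"
    by (simp add: algebra_simps)
  also have "\<dots> = (\<delta> - e / ?p) * ?U + real R * (V * (\<beta> / ?p) + C + V * \<delta>)"
    by (simp only: sum.distrib sum_distrib_left[symmetric] sum_constant card_lessThan)
      (simp add: algebra_simps)
  finally have "(e / ?p - \<delta>) * ?U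
      \<le> real R * (drift_constant / ?p\<^sup>2 + C + V * \<delta> + 2 * V * (\<beta> / ?p))"
    by (simp add: algebra_simps)
  then have "?p * ((e / ?p - \<delta>) * ?U)
      \<le> ?p * (real R * (drift_constant / ?p\<^sup>2 + C + V * \<delta> + 2 * V * (\<beta> / ?p)))"
    using p by (intro mult_left_mono) auto
  also have "?p * ((e / ?p - \<delta>) * ?U) = (e - ?p * \<delta>) * ?U"
    using p by (simp add: field_simps)
  also have "?p * (real R * (drift_constant / ?p\<^sup>2 + C + V * \<delta> + 2 * V * (\<beta> / ?p)))
      = real R * (drift_constant / ?p + C * ?p + V * (?p * \<delta> + 2 * \<beta>))"
    using p by (simp add: field_simps power2_eq_square)
  finally have "(e - ?p * \<delta>) * ?U \<le> real R * (drift_constant / ?p + C * ?p + V * (?p * \<delta> + 2 * \<beta>))" .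
  then show ?thesis
    using e by (simp add: field_simps)
qed

text \<open>
  The bounds from the two comparison policies are combined with weights \<open>\<theta> = \<phi> \<delta> / \<epsilon>\<close> and
  \<open>1 - \<theta>\<close>. For this \<open>\<theta>\<close> the backlog terms cancel.
\<close>

lemma sum_penalty_le:
  assumes \<pi>: "\<pi> \<in> policies S" and cd: "\<And>r. cd_approximation S V C \<delta> r \<pi>" and V: "0 < V"
    and \<delta>: "0 \<le> \<delta>" and e: "renewal_prob S * \<delta> < e"
    and \<pi>1: "\<pi>1 \<in> omega_z_only_policies S"
    and opt: "renewal_prob S * (\<integral>w. frame_cost (penalty_cost 0) 0 w \<partial>law S \<pi>1) = y"
    and feasible: "\<And>i. i \<in> constraints \<Longrightarrow> renewal_prob S * (\<integral>w. frame_cost (constraint_cost i) 0 w \<partial>law S \<pi>1) \<le> 0"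
    and \<pi>2: "\<pi>2 \<in> omega_z_only_policies S"
    and slack: "\<And>i. i \<in> constraints \<Longrightarrow> renewal_prob S * (\<integral>w. frame_cost (constraint_cost i) 0 w \<partial>law S \<pi>2) \<le> - e"
  shows "(\<Sum>r<R. \<integral>w. frame_cost (penalty_cost 0) r w \<partial>law S \<pi>)
    \<le> real R * ((y + (drift_constant / renewal_prob S + C * renewal_prob S) / V
        + renewal_prob S * \<delta> * (1 + (\<beta> - y) / e)) / renewal_prob S)"
proof -
  let ?p = "renewal_prob S"
  have pol: "\<pi>2 \<in> policies S"
    using \<pi>2 by (simp add: omega_z_only_policies_def)
  note p = renewal_prob_pos
  have e_pos: "0 < e"
    using e \<delta> p by (smt (verit) mult_nonneg_nonneg)
  define \<theta> where "\<theta> = ?p * \<delta> / e"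
  have \<theta>: "0 \<le> \<theta>" "\<theta> \<le> 1"
    using e e_pos \<delta> p by (auto simp: \<theta>_def)
  have cancel: "\<theta> * (e / ?p) = \<delta>"
    using p e_pos by (simp add: \<theta>_def)
  have y: "?p * (\<integral>w. frame_cost (penalty_cost 0) 0 w \<partial>law S \<pi>2) \<le> \<beta>"
    using abs_expectation_frame_cost_le[OF pol cost_penalty_cost[of 0], of 0] p
    by (simp add: field_simps abs_le_iff)
  define J where "J r = (\<integral>w. frame_objective S V r w \<partial>law S \<pi>)" for r
  have J: "J r \<le> V * ((y + \<theta> * (\<beta> - y)) / ?p) + C + V * \<delta>" for r
  proof -
    let ?U = "mean_backlog \<pi> r"
    have 1: "J r \<le> V * (y / ?p) + C + \<delta> * ?U + V * \<delta>"
      using objective_le[OF \<pi> cd less_imp_le[OF V] \<pi>1, of 0 y r] opt feasible by (simp add: J_def)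
    have 2: "J r \<le> - (e / ?p) * ?U + V * (\<beta> / ?p) + C + \<delta> * ?U + V * \<delta>"
      unfolding J_def by (rule objective_le[OF \<pi> cd less_imp_le[OF V] \<pi>2 slack y])
    have "J r = (1 - \<theta>) * J r + \<theta> * J r"
      by (simp add: algebra_simps)
    also have "\<dots> \<le> (1 - \<theta>) * (V * (y / ?p) + C + \<delta> * ?U + V * \<delta>)
        + \<theta> * (- (e / ?p) * ?U + V * (\<beta> / ?p) + C + \<delta> * ?U + V * \<delta>)"
      using \<theta> by (intro add_mono mult_left_mono 1 2) auto
    also have "\<dots> = (1 - \<theta>) * (V * (y / ?p)) + \<theta> * (V * (\<beta> / ?p)) + C + V * \<delta>
        + (\<delta> - \<theta> * (e / ?p)) * ?U"
      by (simp add: algebra_simps)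
    also have "\<dots> = V * ((y + \<theta> * (\<beta> - y)) / ?p) + C + V * \<delta>"
      unfolding cancel using p by (simp add: field_simps)
    finally show ?thesis .
  qed
  have "V * (\<Sum>r<R. \<integral>w. frame_cost (penalty_cost 0) r w \<partial>law S \<pi>)
      \<le> (\<Sum>r<R. J r) + real R * (drift_constant / ?p\<^sup>2)"
    unfolding J_def by (rule sum_penalty_le_sum_objective[OF \<pi>])
  also have "(\<Sum>r<R. J r) \<le> (\<Sum>r<R. V * ((y + \<theta> * (\<beta> - y)) / ?p) + C + V * \<delta>)"
    by (intro sum_mono J)
  also have "\<dots> + real R * (drift_constant / ?p\<^sup>2)
      = V * (real R * ((y + (drift_constant / ?p + C * ?p) / V + ?p * \<delta> * (1 + (\<beta> - y) / e)) / ?p))"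
    using p V e_pos by (simp add: \<theta>_def field_simps power2_eq_square)
  finally show ?thesis
    using V by (simp only: mult_le_cancel_left_pos)
qed

end

section \<open>Performance of approximate drift-plus-penalty control\<close>

theorem theorem1:
  fixes S :: "('w, 'z::finite, 'a, 'n) system"
    and \<beta> \<epsilon> V C \<delta> :: real
    and \<pi> :: "('w, 'z, 'a) policy"
  defines "\<phi> \<equiv> renewal_prob S"
    and "L \<equiv> num_penalties S"
    and "B \<equiv> (2 - renewal_prob S) * \<beta>\<^sup>2 * real (card (queues S) + num_penalties S) / 2"
  assumes system: "forced_renewal_system S \<beta>"
    and A1: "assumption1 S"
    and A2: "\<epsilon> > 0" "assumption2 S \<epsilon>"
    and nonneg: "V \<ge> 0" "C \<ge> 0" "\<delta> \<ge> 0"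
    and policy: "\<pi> \<in> policies S"
    and approx: "\<And>r. cd_approximation S V C \<delta> r \<pi>"
    and eps: "\<epsilon> > \<phi> * \<delta>"
  shows "(\<forall>l\<in>{1..L}. strongly_stable S \<pi> (virtual_queue S l)) \<and>
     (\<forall>n\<in>queues S. strongly_stable S \<pi> (queue S n)) \<and>
     (\<forall>l\<in>{1..L}. time_avg S \<pi> (penalty_at S l) \<le> 0) \<and>
     (\<forall>n\<in>queues S. time_avg S \<pi> (queue S n) < \<infinity>) \<and>
     (AE w in law S \<pi>. \<forall>t. action_at w t \<in> actions S (event_at w t) (state_at w t)) \<and>
     (\<forall>R>0. 1 / real R * (\<Sum>r<R.
          (\<Sum>n\<in>queues S. \<integral>w. queue S n (frame_start r w) w \<partial>law S \<pi>) +
          (\<Sum>l=1..L. \<integral>w. virtual_queue S l (frame_start r w) w \<partial>law S \<pi>))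
        \<le> (B / \<phi> + C * \<phi> + V * (\<phi> * \<delta> + 2 * \<beta>)) / (\<epsilon> - \<phi> * \<delta>)) \<and>
     (V > 0 \<longrightarrow> time_avg S \<pi> (penalty_at S 0)
        \<le> y0_opt S + ereal ((B / \<phi> + C * \<phi>) / V)
          + ereal (\<phi> * \<delta>) * (1 + (ereal \<beta> - y0_opt S) / ereal \<epsilon>))"
proof -
  interpret forced_renewal_system S \<beta> by (rule system)
  have B: "drift_constant = B"
    by (simp add: drift_constant_def card_constraints B_def)
  obtain \<pi>1 where \<pi>1: "\<pi>1 \<in> omega_z_only_policies S"
    and opt: "ereal (\<phi> * (\<integral>w. frame_cost (penalty_cost 0) 0 w \<partial>law S \<pi>1)) = y0_opt S"
    and feasible: "\<And>n. n \<in> queues S \<Longrightarrow> \<phi> * (\<integral>w. frame_cost (queue_cost n) 0 w \<partial>law S \<pi>1) \<le> 0"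
      "\<And>l. l \<in> {1..L} \<Longrightarrow> \<phi> * (\<integral>w. frame_cost (penalty_cost l) 0 w \<partial>law S \<pi>1) \<le> 0"
    using A1 unfolding assumption1_def frame_sum_diff_at frame_sum_penalty_at \<phi>_def L_def by blast
  obtain \<pi>2 where \<pi>2: "\<pi>2 \<in> omega_z_only_policies S"
    and slack: "\<And>n. n \<in> queues S \<Longrightarrow> \<phi> * (\<integral>w. frame_cost (queue_cost n) 0 w \<partial>law S \<pi>2) \<le> - \<epsilon>"
      "\<And>l. l \<in> {1..L} \<Longrightarrow> \<phi> * (\<integral>w. frame_cost (penalty_cost l) 0 w \<partial>law S \<pi>2) \<le> - \<epsilon>"
    using A2(2) unfolding assumption2_def frame_sum_diff_at frame_sum_penalty_at \<phi>_def L_def by blast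
  define y where "y = \<phi> * (\<integral>w. frame_cost (penalty_cost 0) 0 w \<partial>law S \<pi>1)"
  have feasible': "renewal_prob S * (\<integral>w. frame_cost (constraint_cost i) 0 w \<partial>law S \<pi>1) \<le> 0"
    and slack': "renewal_prob S * (\<integral>w. frame_cost (constraint_cost i) 0 w \<partial>law S \<pi>2) \<le> - \<epsilon>"
    if "i \<in> constraints" for i
    using that feasible slack by (auto simp: constraints_def constraint_cost_def \<phi>_def L_def)
  define K where "K = (B / \<phi> + C * \<phi> + V * (\<phi> * \<delta> + 2 * \<beta>)) / (\<epsilon> - \<phi> * \<delta>)"
  have mean: "(\<Sum>r<R. mean_backlog \<pi> r) \<le> K * real R" for R
    using sum_mean_backlog_le[OF policy approx nonneg(1) _ \<pi>2 slack'] eps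
    by (simp add: K_def B \<phi>_def)
  have linear: "\<exists>K'\<ge>0. \<forall>t. (\<Sum>\<tau><t. \<integral>w. backlog (constraint_cost i) \<tau> w \<partial>law S \<pi>) \<le> K' * real t"
    if "i \<in> constraints" for i
    by (rule sum_backlog_linear[OF policy that mean])
  have stable: "time_avg S \<pi> (backlog (constraint_cost i)) < \<infinity>" if "i \<in> constraints" for i
    using linear[OF that] time_avg_finite by blast
  have satisfied: "time_avg S \<pi> (\<lambda>t w. constraint_cost i (w t)) \<le> 0" if "i \<in> constraints" for i
    using linear[OF that] time_avg_cost_nonpos[OF policy cost_constraint_cost[OF that]] by blast
  have queues: "queue S n = backlog (constraint_cost (Inl n))"
    and virtual_queues: "virtual_queue S l = backlog (constraint_cost (Inr l))" for n l
    by (simp_all add: fun_eq_iff constraint_cost_def queue_eq_backlog virtual_queue_eq_backlog)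
  have penalties: "penalty_at S l = (\<lambda>t w. constraint_cost (Inr l) (w t))" for l
    by (simp add: constraint_cost_def penalty_at_eq)
  have Inl: "Inl n \<in> constraints" if "n \<in> queues S" for n
    using that by (auto simp: constraints_def)
  have Inr: "Inr l \<in> constraints" if "l \<in> {1..L}" for l
    using that by (auto simp: constraints_def L_def)
  have frames: "1 / real R * (\<Sum>r<R.
          (\<Sum>n\<in>queues S. \<integral>w. queue S n (frame_start r w) w \<partial>law S \<pi>) +
          (\<Sum>l=1..L. \<integral>w. virtual_queue S l (frame_start r w) w \<partial>law S \<pi>)) \<le> K" if "R > 0" for R
    using mean[of R] that
    by (simp add: mean_backlog_def sum_constraints queues virtual_queues L_def field_simps)
  have "time_avg S \<pi> (penalty_at S 0)
        \<le> y0_opt S + ereal ((B / \<phi> + C * \<phi>) / V)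
          + ereal (\<phi> * \<delta>) * (1 + (ereal \<beta> - y0_opt S) / ereal \<epsilon>)" if "V > 0"
  proof -
    let ?c = "y + (B / \<phi> + C * \<phi>) / V + \<phi> * \<delta> * (1 + (\<beta> - y) / \<epsilon>)"
    have "(\<Sum>r<R. \<integral>w. frame_cost (penalty_cost 0) r w \<partial>law S \<pi>) \<le> real R * (?c / \<phi>)" for R
      using sum_penalty_le[OF policy approx that nonneg(3) _ \<pi>1 _ feasible' \<pi>2 slack', of y R] eps
      by (simp add: B \<phi>_def y_def)
    then have "time_avg S \<pi> (penalty_at S 0) \<le> ereal ?c"
      unfolding penalty_at_eq \<phi>_def
      by (intro time_avg_le_frame_avg policy cost_penalty_cost) auto
    also have "ereal ?c = y0_opt S + ereal ((B / \<phi> + C * \<phi>) / V)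
          + ereal (\<phi> * \<delta>) * (1 + (ereal \<beta> - y0_opt S) / ereal \<epsilon>)"
      using A2(1) by (simp add: opt[symmetric] y_def[symmetric] one_ereal_def)
    finally show ?thesis .
  qed
  moreover have "AE w in law S \<pi>. \<forall>t. action_at w t \<in> actions S (event_at w t) (state_at w t)"
    by (rule eventually_mono[OF AE_admissible[OF policy]]) (simp add: admissible_def)
  ultimately show ?thesis
    using stable satisfied frames Inl Inr
    unfolding strongly_stable_def queues virtual_queues penalties K_def by blast
qed

end
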